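(* Let $V=V^*\in L^1(0,1)$ and let $\widetilde V\in\mathrm{Iso}(V)$. Fix some $\alpha\ge 1$ and suppose that $\mathcal E_\beta(\widetilde V)=\mathcal E_\beta(V)$ for all $\beta\ne\alpha$. Then $\mathcal F_\alpha(\widetilde V)=\mathcal F_\alpha(V)$ and $\mathcal E_\alpha(\widetilde V)\cap\mathcal F_\alpha(V)=\{0\}$.
   Context: Fix an integer $N\ge 1$. Here $V=V^*\in L^1(0,1)$ means that $V$ is an integrable function on $(0,1)$ with values in the Hermitian complex $N\times N$ matrices; potentials equal almost everywhere are identified. Let $H$ be the self-adjoint operator in $L^2(0,1)^N$ given by $H\psi=-\psi''+V(x)\psi$ with boundary conditions $\psi(0)=\psi(1)=0$. Let $\lambda_1<\lambda_2<\dots<\lambda_\alpha<\dots$ be its distinct eigenvalues, and let $k_\alpha\in[1,N]$ be the multiplicity of $\lambda_\alpha$, i.e. the dimension of the corresponding eigenspace. $\varphi(x,\lambda)$ is the $N\times N$ matrix-valued solution of $-\varphi''+V\varphi=\lambda\varphi$ with $\varphi(0,\lambda)=0$, $\varphi'(0,\lambda)=I$ (the identity matrix), where $'=\partial/\partial x$. Set $S_\alpha=\int_0^1\varphi(t,\lambda_\alpha)^*\varphi(t,\lambda_\alpha)\,dt>0$ and $\mathcal E_\alpha=\mathrm{Ker}\,\varphi(1,\lambda_\alpha)\subset\mathbb C^N$ (one has $\dim\mathcal E_\alpha=k_\alpha$). The "forbidden subspace" is $\mathcal F_\alpha=\mathbb C^N\ominus S_\alpha(\mathcal E_\alpha)$,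 where $\mathbb C^N\ominus\mathcal S$ denotes the orthogonal complement of $\mathcal S$ in $\mathbb C^N$. The dependence on the potential is indicated by writing $\lambda_\alpha(V),k_\alpha(V),\mathcal E_\alpha(V),\mathcal F_\alpha(V)$. The isospectral set is $\mathrm{Iso}(V)=\{\widetilde V=\widetilde V^*\in L^1(0,1):\ \lambda_\alpha(\widetilde V)=\lambda_\alpha(V),\ k_\alpha(\widetilde V)=k_\alpha(V)\text{ for all }\alpha\ge1\}$. *)

theory Defs
  imports "HOL-Analysis.Analysis" "HOL-Library.Function_Algebras"
begin

text \<open>
  The dimension \<open>N \<ge> 1\<close> is \<open>CARD('n)\<close>. Potentials are represented by functions on the real line of
  which only the values on \<open>(0,1)\<close> up to null sets matter.
\<close>

definition adj :: "complex^'n^'n \<Rightarrow> complex^'n^'n" where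
  "adj A = transpose (map_matrix cnj A)"

definition hermitian_potential :: "(real \<Rightarrow> complex^'n^'n) \<Rightarrow> bool" where
  "hermitian_potential V \<longleftrightarrow>
     V absolutely_integrable_on {0<..<1} \<and>
     (AE x in lebesgue_on {0<..<1}. adj (V x) = V x)"

definition L2 :: "(real \<Rightarrow> complex^'n) set" where
  "L2 = {f. f \<in> borel_measurable (lebesgue_on {0<..<1}) \<and>
            integrable (lebesgue_on {0<..<1}) (\<lambda>x. (norm (f x))\<^sup>2)}"

text \<open>
  \<open>f\<close> is continuously differentiable on \<open>[0,1]\<close> with derivative \<open>f1\<close>, and \<open>f1\<close> is absolutely
  continuous with derivative \<open>f2 \<in> L\<^sup>1\<close>, that is, \<open>f1\<close> is an indefinite Lebesgue integral of \<open>f2\<close>.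
\<close>

definition has_derivs ::
  "(real \<Rightarrow> 'b::euclidean_space) \<Rightarrow> (real \<Rightarrow> 'b) \<Rightarrow> (real \<Rightarrow> 'b) \<Rightarrow> bool" where
  "has_derivs f f1 f2 \<longleftrightarrow>
     (\<forall>x\<in>{0..1}. (f has_vector_derivative f1 x) (at x within {0..1})) \<and>
     f2 absolutely_integrable_on {0..1} \<and>
     (\<forall>x\<in>{0..1}. (f2 has_integral (f1 x - f1 0)) {0..x})"

text \<open>
  The graph of the operator \<open>H\<close>: \<open>\<psi>\<close> is in its maximal Dirichlet domain and \<open>H \<psi> = f\<close> in \<open>L\<^sup>2\<close>.
  An element of the domain is given by its continuous representative on \<open>[0,1]\<close>, continued by \<open>0\<close> to
  the real line so that distinct functions are distinct elements of \<open>L\<^sup>2(0,1)\<^sup>N\<close>.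
\<close>

definition H_graph ::
  "(real \<Rightarrow> complex^'n^'n) \<Rightarrow> (real \<Rightarrow> complex^'n) \<Rightarrow> (real \<Rightarrow> complex^'n) \<Rightarrow> bool" where
  "H_graph V \<psi> f \<longleftrightarrow>
     (\<forall>x. x \<notin> {0..1} \<longrightarrow> \<psi> x = 0) \<and> \<psi> \<in> L2 \<and> f \<in> L2 \<and> \<psi> 0 = 0 \<and> \<psi> 1 = 0 \<and>
     (\<exists>\<psi>1 \<psi>2. has_derivs \<psi> \<psi>1 \<psi>2 \<and>
        (AE x in lebesgue_on {0<..<1}. - \<psi>2 x + V x *v \<psi> x = f x))"

definition eigenspace ::
  "(real \<Rightarrow> complex^'n^'n) \<Rightarrow> complex \<Rightarrow> (real \<Rightarrow> complex^'n) set" where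
  "eigenspace V z = {\<psi>. H_graph V \<psi> (\<lambda>x. z *s \<psi> x)}"

text \<open>\<open>H\<close> is self-adjoint, so all its eigenvalues are real.\<close>

definition eigenvalues :: "(real \<Rightarrow> complex^'n^'n) \<Rightarrow> real set" where
  "eigenvalues V = {l. \<exists>\<psi>\<in>eigenspace V (of_real l). \<psi> \<noteq> 0}"

text \<open>
  The increasing enumeration \<open>\<lambda>\<^sub>1 < \<lambda>\<^sub>2 < \<dots>\<close> of the eigenvalues. Indices start at \<open>1\<close>; the value at
  index \<open>0\<close> is irrelevant.
\<close>

definition eigval :: "(real \<Rightarrow> complex^'n^'n) \<Rightarrow> nat \<Rightarrow> real" where
  "eigval V \<alpha> =
     (THE l :: nat \<Rightarrow> real. strict_mono l \<and> range l = eigenvalues V) (\<alpha> - 1)"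

interpretation cfun: vector_space
  "\<lambda>(c::complex) (f :: real \<Rightarrow> complex^'n). (\<lambda>x. c *s f x)"
  by unfold_locales (auto simp: fun_eq_iff vec_eq_iff algebra_simps)

definition multiplicity_ev :: "(real \<Rightarrow> complex^'n^'n) \<Rightarrow> nat \<Rightarrow> nat" where
  "multiplicity_ev V \<alpha> = cfun.dim (eigenspace V (of_real (eigval V \<alpha>)))"

text \<open>
  The matrix solution of \<open>-\<phi>'' + V \<phi> = z \<phi>\<close>, \<open>\<phi>(0) = 0\<close>, \<open>\<phi>'(0) = I\<close> on \<open>[0,1]\<close>, with the value \<open>0\<close>
  outside \<open>[0,1]\<close> to make it unique as a function on the real line.
\<close>

definition phi :: "(real \<Rightarrow> complex^'n^'n) \<Rightarrow> complex \<Rightarrow> real \<Rightarrow> complex^'n^'n" where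
  "phi V z = (THE \<phi>. (\<forall>x. x \<notin> {0..1} \<longrightarrow> \<phi> x = 0) \<and>
     (\<exists>\<phi>1 \<phi>2. has_derivs \<phi> \<phi>1 \<phi>2 \<and> \<phi> 0 = 0 \<and> \<phi>1 0 = mat 1 \<and>
        (AE x in lebesgue_on {0<..<1}. - \<phi>2 x + V x ** \<phi> x = mat z ** \<phi> x)))"

definition S_mat :: "(real \<Rightarrow> complex^'n^'n) \<Rightarrow> nat \<Rightarrow> complex^'n^'n" where
  "S_mat V \<alpha> =
     integral {0..1} (\<lambda>t. adj (phi V (of_real (eigval V \<alpha>)) t) ** phi V (of_real (eigval V \<alpha>)) t)"

definition E_space :: "(real \<Rightarrow> complex^'n^'n) \<Rightarrow> nat \<Rightarrow> (complex^'n) set" where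
  "E_space V \<alpha> = {h. phi V (of_real (eigval V \<alpha>)) 1 *v h = 0}"

definition cinner :: "complex^'n \<Rightarrow> complex^'n \<Rightarrow> complex" where
  "cinner u v = (\<Sum>i\<in>UNIV. u $ i * cnj (v $ i))"

definition orth_compl :: "(complex^'n) set \<Rightarrow> (complex^'n) set" where
  "orth_compl S = {u. \<forall>v\<in>S. cinner u v = 0}"

definition F_space :: "(real \<Rightarrow> complex^'n^'n) \<Rightarrow> nat \<Rightarrow> (complex^'n) set" where
  "F_space V \<alpha> = orth_compl ((\<lambda>h. S_mat V \<alpha> *v h) ` E_space V \<alpha>)"

definition Iso :: "(real \<Rightarrow> complex^'n^'n) \<Rightarrow> (real \<Rightarrow> complex^'n^'n) set" where
  "Iso V = {W. hermitian_potential W \<and>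
     (\<forall>\<alpha>\<ge>1. eigval W \<alpha> = eigval V \<alpha> \<and> multiplicity_ev W \<alpha> = multiplicity_ev V \<alpha>)}"

end

theory Submission
  imports Defs "HOL-Complex_Analysis.Complex_Analysis" "HOL-Real_Asymp.Real_Asymp"
begin

text \<open>
  Write \<open>A(z)\<close> and \<open>B(z)\<close> for the entire matrix functions \<open>\<phi>(1, z)\<close> of \<open>V\<close> and of \<open>W\<close>, let \<open>a = \<lambda>\<^sub>\<alpha>\<close>, and let a prime
  on \<open>A\<close> and \<open>B\<close> stand for \<open>d/dz\<close>.

  \<^emph>\<open>The forbidden subspace in terms of \<open>A\<close>.\<close> Lagrange's identity for two solutions (\<open>wronskian_identity\<close>),
  divided by \<open>z - a\<close> in the limit \<open>z \<rightarrow> a\<close>, expresses the Gram matrix \<open>S\<^sub>\<alpha>\<close> on \<open>\<E>\<^sub>\<alpha>\<close> through \<open>A'(a)\<close>. Since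
  moreover the vectors \<open>\<partial>\<^sub>x\<phi>(1, a) h\<close> with \<open>h \<in> \<E>\<^sub>\<alpha>\<close> fill the orthogonal complement of \<open>Ran A(a)\<close>, one gets
  \<open>\<F>\<^sub>\<alpha> = {u. A'(a) u \<in> Ran A(a)}\<close> (\<open>F_space_eq\<close>). Positivity of \<open>S\<^sub>\<alpha>\<close> gives \<open>\<E>\<^sub>\<alpha> \<inter> \<F>\<^sub>\<alpha> = {0}\<close>, and this
  transversality says precisely that \<open>A(z)\<^sup>-\<^sup>1\<close> has at most a simple pole at \<open>a\<close> (\<open>simple_pole_boundI\<close>).

  \<^emph>\<open>Comparing the potentials.\<close> All singular points of \<open>A\<close> are eigenvalues, and they are also the eigenvalues
  of \<open>W\<close>. At an eigenvalue other than \<open>a\<close> the kernels of \<open>A\<close> and \<open>B\<close> agree, which cancels the simple pole of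
  \<open>A\<^sup>-\<^sup>1\<close> in \<open>B A\<^sup>-\<^sup>1\<close>; only the one at \<open>a\<close> survives. The asymptotics \<open>\<phi>(1, w\<^sup>2) = w\<^sup>-\<^sup>1 sin w (I + O(1/w))\<close> on
  the circles \<open>|w| = \<pi> (n + 1/2)\<close> show that \<open>B A\<^sup>-\<^sup>1\<close> tends to \<open>I\<close> there. By Liouville's theorem
  \<open>B(z) = (I + R / (z - a)) A(z)\<close> with a constant matrix \<open>R\<close> (\<open>quotient_single_pole\<close>).

  \<^emph>\<open>Conclusion.\<close> Expanding this relation at \<open>a\<close> yields \<open>B(a) = A(a) + R A'(a)\<close> and
  \<open>B'(a) u - A'(a) u \<in> Ran R\<close> for all \<open>u\<close>. Because \<open>B\<^sup>-\<^sup>1 R = (z - a) (A\<^sup>-\<^sup>1 - B\<^sup>-\<^sup>1)\<close> stays bounded near \<open>a\<close>, also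
  \<open>Ran R \<subseteq> Ran B(a)\<close>. Hence \<open>A'(a) u \<in> Ran A(a)\<close> implies \<open>B'(a) u \<in> Ran B(a)\<close>
  (\<open>range_inclusion_of_single_pole_quotient\<close>), that is \<open>\<F>\<^sub>\<alpha>(V) \<subseteq> \<F>\<^sub>\<alpha>(W)\<close>, and the roles of \<open>V\<close> and \<open>W\<close> can
  be exchanged.

  The numbering of the eigenvalues is meaningful only if they form an infinite set that is bounded below
  and has no finite accumulation point. They are bounded below because \<open>w\<^sup>-\<^sup>1 sin w\<close> dominates the error
  term far out on the imaginary axis, and do not accumulate because the poles of \<open>A\<^sup>-\<^sup>1\<close> are isolated.
  Finitely many poles would make \<open>A\<^sup>-\<^sup>1\<close> a rational function, which is incompatible with its exponential
  decay along the negative half-axis (\<open>singular_points_infinite\<close>).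
\<close>

section \<open>Matrices, norms and the Hermitian form\<close>

lemma norm_vec_sq: "(norm (x :: 'a::real_normed_vector^'n))\<^sup>2 = (\<Sum>i\<in>UNIV. (norm (x $ i))\<^sup>2)"
  by (simp add: norm_vec_def L2_set_def sum_nonneg)

lemma norm_sum_mult_le:
  fixes a b :: "'n::finite \<Rightarrow> complex"
  shows "(norm (\<Sum>j\<in>UNIV. a j * b j))\<^sup>2 \<le> (\<Sum>j\<in>UNIV. (norm (a j))\<^sup>2) * (\<Sum>j\<in>UNIV. (norm (b j))\<^sup>2)"
proof -
  have "norm (\<Sum>j\<in>UNIV. a j * b j) \<le> (\<Sum>j\<in>UNIV. \<bar>norm (a j)\<bar> * \<bar>norm (b j)\<bar>)"
    by (rule order_trans[OF norm_sum]) (simp add: norm_mult)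
  also have "\<dots> \<le> L2_set (\<lambda>j. norm (a j)) UNIV * L2_set (\<lambda>j. norm (b j)) UNIV"
    by (rule L2_set_mult_ineq)
  finally have "(norm (\<Sum>j\<in>UNIV. a j * b j))\<^sup>2 \<le> (L2_set (\<lambda>j. norm (a j)) UNIV * L2_set (\<lambda>j. norm (b j)) UNIV)\<^sup>2"
    by (rule power_mono) simp
  then show ?thesis
    by (simp add: power_mult_distrib L2_set_def sum_nonneg)
qed

lemma norm_matrix_vector_mult_le:
  fixes A :: "complex^'n^'m"
  shows "norm (A *v x) \<le> norm A * norm x"
proof (rule power2_le_imp_le)
  have "(norm (A *v x))\<^sup>2 = (\<Sum>i\<in>UNIV. (norm (\<Sum>j\<in>UNIV. A$i$j * x$j))\<^sup>2)"
    by (simp add: norm_vec_sq matrix_vector_mult_def)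
  also have "\<dots> \<le> (\<Sum>i\<in>UNIV. (\<Sum>j\<in>UNIV. (norm (A$i$j))\<^sup>2) * (\<Sum>j\<in>UNIV. (norm (x$j))\<^sup>2))"
    by (intro sum_mono norm_sum_mult_le)
  also have "\<dots> = (norm A * norm x)\<^sup>2"
    by (simp add: power_mult_distrib norm_vec_sq sum_distrib_right)
  finally show "(norm (A *v x))\<^sup>2 \<le> (norm A * norm x)\<^sup>2" .
qed simp

lemma norm_matrix_mult_le:
  fixes A :: "complex^'n^'m" and B :: "complex^'k^'n"
  shows "norm (A ** B) \<le> norm A * norm B"
proof (rule power2_le_imp_le)
  have "(norm (A ** B))\<^sup>2 = (\<Sum>i\<in>UNIV. \<Sum>k\<in>UNIV. (norm (\<Sum>j\<in>UNIV. A$i$j * B$j$k))\<^sup>2)"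
    by (simp add: norm_vec_sq matrix_matrix_mult_def)
  also have "\<dots> \<le> (\<Sum>i\<in>UNIV. \<Sum>k\<in>UNIV. (\<Sum>j\<in>UNIV. (norm (A$i$j))\<^sup>2) * (\<Sum>j\<in>UNIV. (norm (B$j$k))\<^sup>2))"
    by (intro sum_mono norm_sum_mult_le)
  also have "\<dots> = (\<Sum>i\<in>UNIV. \<Sum>j\<in>UNIV. (norm (A$i$j))\<^sup>2) * (\<Sum>k\<in>UNIV. \<Sum>j\<in>UNIV. (norm (B$j$k))\<^sup>2)"
    by (simp add: sum_product)
  also have "\<dots> = (norm A * norm B)\<^sup>2"
  proof -
    have "(\<Sum>k\<in>UNIV. \<Sum>j\<in>UNIV. (norm (B$j$k))\<^sup>2) = (\<Sum>j\<in>UNIV. \<Sum>k\<in>UNIV. (norm (B$j$k))\<^sup>2)"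
      by (rule sum.swap)
    then show ?thesis
      by (simp add: power_mult_distrib norm_vec_sq)
  qed
  finally show "(norm (A ** B))\<^sup>2 \<le> (norm A * norm B)\<^sup>2" .
qed simp

interpretation mat_mat: bounded_bilinear "(**) :: complex^'n^'m \<Rightarrow> complex^'k^'n \<Rightarrow> complex^'k^'m"
proof
  show "\<exists>K. \<forall>(a::complex^'n^'m) (b::complex^'k^'n). norm (a ** b) \<le> norm a * norm b * K"
    by (intro exI[of _ 1]) (simp add: norm_matrix_mult_le)
qed (auto simp: matrix_matrix_mult_def vec_eq_iff algebra_simps sum.distrib scaleR_sum_right)

interpretation mat_vec: bounded_bilinear "(*v) :: complex^'n^'m \<Rightarrow> complex^'n \<Rightarrow> complex^'m"
proof
  show "\<exists>K. \<forall>(a::complex^'n^'m) (b::complex^'n). norm (a *v b) \<le> norm a * norm b * K"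
    by (intro exI[of _ 1]) (simp add: norm_matrix_vector_mult_le)
qed (auto simp: matrix_vector_mult_def vec_eq_iff algebra_simps sum.distrib scaleR_sum_right)

interpretation cinner: bounded_bilinear "cinner :: complex^'n \<Rightarrow> complex^'n \<Rightarrow> complex"
proof
  show "\<exists>K. \<forall>(a::complex^'n) b. norm (cinner a b) \<le> norm a * norm b * K"
  proof (intro exI[of _ 1] allI)
    fix a b :: "complex^'n"
    have "(norm (cinner a b))\<^sup>2 \<le> (norm a * norm b)\<^sup>2"
      using norm_sum_mult_le[of "\<lambda>i. a$i" "\<lambda>i. cnj (b$i)"]
      by (simp add: cinner_def power_mult_distrib norm_vec_sq)
    then show "norm (cinner a b) \<le> norm a * norm b * 1"
      by (simp add: power2_le_iff_abs_le)
  qed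
qed (auto simp: cinner_def algebra_simps sum.distrib scaleR_sum_right)

lemma cinner_mult_left: "cinner (A *v x) y = cinner x (adj A *v y)"
proof -
  have "cinner (A *v x) y = (\<Sum>i\<in>UNIV. \<Sum>j\<in>UNIV. A$i$j * x$j * cnj (y$i))"
    by (simp add: cinner_def matrix_vector_mult_def sum_distrib_right)
  also have "\<dots> = (\<Sum>j\<in>UNIV. \<Sum>i\<in>UNIV. A$i$j * x$j * cnj (y$i))"
    by (rule sum.swap)
  also have "\<dots> = cinner x (adj A *v y)"
    by (simp add: cinner_def matrix_vector_mult_def sum_distrib_left adj_def transpose_def mult_ac)
  finally show ?thesis .
qed

lemma cinner_adj_left: "cinner (adj A *v x) y = cinner x (A *v y)"
  by (simp add: cinner_mult_left) (simp add: adj_def transpose_def vec_eq_iff)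

lemma cinner_self: "cinner x x = of_real ((norm x)\<^sup>2)"
  by (simp add: cinner_def norm_vec_sq complex_norm_square[symmetric] del: of_real_power)

lemma cinner_commute: "cnj (cinner x y) = cinner y x"
  by (simp add: cinner_def mult.commute)

lemma Re_cinner: "Re (cinner x y) = inner x y"
  by (simp add: cinner_def inner_vec_def inner_complex_def)

lemma mat_mult_vec: "mat z *v x = z *s (x :: complex^'n)"
  by (simp add: vec_eq_iff matrix_vector_mult_def mat_def if_distrib[of "\<lambda>x. x * _"] cong: if_cong)

lemma mat_matrix_mult_nth: "(mat z ** A) $ i $ j = z * (A :: complex^'k^'n) $ i $ j"
  by (simp add: matrix_matrix_mult_def mat_def if_distrib[of "\<lambda>x. x * _"] cong: if_cong)

lemma norm_mat_matrix_mult: "norm (mat z ** A) = norm z * norm (A :: complex^'k^'n)"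
proof -
  have "(norm (mat z ** A))\<^sup>2 = (norm z * norm A)\<^sup>2"
    by (simp add: norm_vec_sq mat_matrix_mult_nth norm_mult power_mult_distrib sum_distrib_left)
  then show ?thesis by (simp add: power2_eq_iff_nonneg)
qed

lemma mat_mult_matrix_vec: "(mat c ** A) *v x = c *s ((A :: complex^'n^'n) *v x)"
  by (metis mat_mult_vec matrix_vector_mul_assoc)

lemma matrix_vector_smult: "M *v (c *s v) = c *s (M *v (v :: complex^'n))"
  by (simp add: vec_eq_iff matrix_vector_mult_def sum_distrib_left mult_ac)

interpretation mat_scale: bounded_bilinear "\<lambda>(A :: complex^'k^'n) c. mat c ** A"
proof
  show "\<exists>K. \<forall>(A :: complex^'k^'n) c. norm (mat c ** A) \<le> norm A * norm c * K"
    by (intro exI[of _ 1]) (simp add: norm_mat_matrix_mult)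
qed (simp_all add: vec_eq_iff mat_matrix_mult_nth algebra_simps)

lemma mat_mult_left_commute: "mat c ** (A ** B) = (A :: complex^'n^'n) ** (mat c ** (B :: complex^'n^'n))"
  by (simp add: vec_eq_iff mat_matrix_mult_nth)
     (simp add: matrix_matrix_mult_def mat_def if_distrib if_distribR sum_distrib_left mult_ac cong: if_cong)

lemma norm_smult_vec: "norm (z *s x) = norm z * norm (x :: complex^'n)"
proof -
  have "(norm (z *s x))\<^sup>2 = (norm z * norm x)\<^sup>2"
    by (simp add: norm_vec_sq norm_mult power_mult_distrib sum_distrib_left)
  then show ?thesis by (simp add: power2_eq_iff_nonneg)
qed

lemma cinner_smult_left: "cinner (z *s x) y = z * cinner x y"
  by (simp add: cinner_def sum_distrib_left mult_ac)

lemma cinner_smult_right: "cinner x (z *s y) = cnj z * cinner x y"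
  by (simp add: cinner_def sum_distrib_left mult_ac)

section \<open>Indefinite integrals and the Volterra operator\<close>

lemma absolutely_integrable_bilinear_continuous:
  fixes f :: "real \<Rightarrow> 'b::euclidean_space" and g :: "real \<Rightarrow> 'c::euclidean_space"
    and prod :: "'b \<Rightarrow> 'c \<Rightarrow> 'd::euclidean_space"
  assumes "bounded_bilinear prod" "f absolutely_integrable_on {a..b}" "continuous_on {a..b} g"
  shows "(\<lambda>t. prod (f t) (g t)) absolutely_integrable_on {a..b}"
proof -
  have "bilinear (\<lambda>x y. prod y x)"
    using assms(1) bilinear_conv_bounded_bilinear bounded_bilinear.flip by blast
  then show ?thesis
  proof (rule absolutely_integrable_bounded_measurable_product)
    show "g \<in> borel_measurable (lebesgue_on {a..b})"
      by (rule continuous_imp_measurable_on_sets_lebesgue[OF assms(3)]) auto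
    show "bounded (g ` {a..b})"
      by (rule compact_imp_bounded[OF compact_continuous_image[OF assms(3)]]) auto
  qed (use assms in auto)
qed

lemma continuous_on_indefinite_integral:
  fixes f :: "real \<Rightarrow> 'b::euclidean_space"
  assumes "f absolutely_integrable_on {a..b}"
  shows "continuous_on {a..b} (\<lambda>x. integral {a..x} f)"
  using assms indefinite_integral_continuous_1 set_lebesgue_integral_eq_integral(1) by blast

lemma primitive_eq_integral:
  fixes f1 f2 :: "real \<Rightarrow> 'b::euclidean_space"
  assumes "\<And>x. x \<in> {0..b} \<Longrightarrow> (f2 has_integral (f1 x - f1 0)) {0..x}" "x \<in> {0..b}"
  shows "f1 x = f1 0 + integral {0..x} f2"
  using integral_unique[OF assms(1)[OF assms(2)]] by simp

text \<open>
  The function \<open>f1\<close> is only absolutely continuous, so the product rule is not available at every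
  point. It is not needed: the difference \<open>D\<close> of the two sides, as a function of the upper limit, has
  increments \<open>D q - D p\<close> of size \<open>(q - p) (A q - A p)\<close> up to a constant, where \<open>A\<close> is the indefinite
  integral of \<open>|f2|\<close>. Continuity of \<open>A\<close> makes the derivative of \<open>D\<close> vanish at every point.
\<close>

lemma integration_by_parts_indefinite:
  fixes f1 f2 :: "real \<Rightarrow> 'b::euclidean_space" and g g1 :: "real \<Rightarrow> 'c::euclidean_space"
    and prod :: "'b \<Rightarrow> 'c \<Rightarrow> 'd::euclidean_space"
  assumes "bounded_bilinear prod" and b: "0 \<le> b"
    and f2: "f2 absolutely_integrable_on {0..b}"
    and f1: "\<And>x. x \<in> {0..b} \<Longrightarrow> (f2 has_integral (f1 x - f1 0)) {0..x}"
    and g: "\<And>x. x \<in> {0..b} \<Longrightarrow> (g has_vector_derivative g1 x) (at x within {0..b})"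
    and g1: "continuous_on {0..b} g1"
  shows "((\<lambda>t. prod (f2 t) (g t) + prod (f1 t) (g1 t)) has_integral
            (prod (f1 b) (g b) - prod (f1 0) (g 0))) {0..b}"
proof -
  interpret prod: bounded_bilinear prod by fact
  obtain K where K: "K > 0" "\<And>x y. norm (prod x y) \<le> norm x * norm y * K"
    using prod.pos_bounded by blast
  define A where "A x = integral {0..x} (\<lambda>t. norm (f2 t))" for x
  define h where "h t = prod (f2 t) (g t) + prod (f1 t) (g1 t)" for t
  define D where "D x = integral {0..x} h - prod (f1 x) (g x)" for x
  have nf2: "(\<lambda>t. norm (f2 t)) integrable_on {0..b}"
    using f2 by (auto simp: absolutely_integrable_on_def)
  have f2i: "f2 integrable_on {0..b}"
    using f2 by (auto simp: absolutely_integrable_on_def)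
  have contA: "continuous_on {0..b} A"
    unfolding A_def by (rule indefinite_integral_continuous_1[OF nf2])
  have f1eq: "f1 x = f1 0 + integral {0..x} f2" if "x \<in> {0..b}" for x
    by (rule primitive_eq_integral[OF f1 that])
  have contf1: "continuous_on {0..b} f1"
    by (rule continuous_on_eq[OF _ f1eq[symmetric]])
       (intro continuous_intros continuous_on_indefinite_integral f2)
  have contg: "continuous_on {0..b} g"
    using g has_vector_derivative_continuous continuous_on_eq_continuous_within by blast
  have gint: "(g1 has_integral (g q - g p)) {p..q}" if "0 \<le> p" "p \<le> q" "q \<le> b" for p q
    using that
    by (intro fundamental_theorem_of_calculus) (auto intro!: has_vector_derivative_within_subset[OF g])
  obtain L where L: "L > 0" "\<And>t. t \<in> {0..b} \<Longrightarrow> norm (g1 t) \<le> L"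
    using compact_imp_bounded[OF compact_continuous_image[OF g1]] by (force simp: bounded_pos)
  have hint: "h integrable_on {0..b}"
    unfolding h_def
    by (intro integrable_add)
       (use absolutely_integrable_bilinear_continuous[OF assms(1) f2 contg] in \<open>auto simp: absolutely_integrable_on_def
        intro!: integrable_continuous_real prod.continuous_on contf1 g1\<close>)
  have sub: "F integrable_on {p..q}" if "F integrable_on {0..b}" "0 \<le> p" "q \<le> b" for F :: "real \<Rightarrow> 'e::euclidean_space" and p q
    using integrable_on_subinterval[OF that(1)] that by auto
  have A_diff: "A q - A p = integral {p..q} (\<lambda>t. norm (f2 t))" if "0 \<le> p" "p \<le> q" "q \<le> b" for p q
    using Henstock_Kurzweil_Integration.integral_combine[OF that(1,2) sub[OF nf2 order_refl that(3)]]
    by (simp add: A_def)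
  have f1_diff: "f1 q - f1 p = integral {p..q} f2" if "0 \<le> p" "p \<le> q" "q \<le> b" for p q
    using Henstock_Kurzweil_Integration.integral_combine[OF that(1,2) sub[OF f2i order_refl that(3)]] f1eq[of p] f1eq[of q] that
    by (simp add: algebra_simps)
  \<comment> \<open>\<open>f1\<close> is frozen at the left end point and \<open>g\<close> at the right one; the errors are at most
    \<open>A q - A p\<close> and \<open>L (q - p)\<close>.\<close>
  have key: "norm (D q - D p) \<le> 2 * K * L * (q - p) * (A q - A p)" if pq: "0 \<le> p" "p \<le> q" "q \<le> b" for p q
  proof -
    have f2pq: "f2 integrable_on {p..q}" and nf2pq: "(\<lambda>t. norm (f2 t)) integrable_on {p..q}"
      and hpq: "h integrable_on {p..q}" using pq by (auto intro: sub f2i nf2 hint)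
    have i1: "((\<lambda>t. prod (f2 t) (g q)) has_integral prod (f1 q - f1 p) (g q)) {p..q}"
      using has_integral_linear[OF integrable_integral[OF f2pq] prod.bounded_linear_left[of "g q"]] f1_diff[OF pq]
      by (simp add: o_def)
    have i2: "((\<lambda>t. prod (f1 p) (g1 t)) has_integral prod (f1 p) (g q - g p)) {p..q}"
      using has_integral_linear[OF gint[OF pq] prod.bounded_linear_right[of "f1 p"]]
      by (simp add: o_def)
    have Dqp: "D q - D p = integral {p..q} h - prod (f1 q - f1 p) (g q) - prod (f1 p) (g q - g p)"
      using Henstock_Kurzweil_Integration.integral_combine[OF pq(1,2) sub[OF hint order_refl pq(3)]]
      by (simp add: D_def prod.diff_left prod.diff_right algebra_simps)
    have "((\<lambda>t. h t - prod (f2 t) (g q) - prod (f1 p) (g1 t)) has_integral D q - D p) {p..q}"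
      unfolding Dqp by (intro has_integral_diff integrable_integral[OF hpq] i1 i2)
    then have Deq: "D q - D p = integral {p..q} (\<lambda>t. h t - prod (f2 t) (g q) - prod (f1 p) (g1 t))"
      and int: "(\<lambda>t. h t - prod (f2 t) (g q) - prod (f1 p) (g1 t)) integrable_on {p..q}"
      by (auto simp: integral_unique intro: has_integral_integrable)
    have Aint: "((\<lambda>t. norm (f2 t)) has_integral (A q - A p)) {p..q}"
      using A_diff[OF pq] nf2pq by (simp add: integrable_integral)
    have Bint: "((\<lambda>t. norm (f2 t) * (L * (q-p) * K) + (A q - A p) * L * K) has_integral
        ((A q - A p) * (L * (q-p) * K) + (q - p) * ((A q - A p) * L * K))) {p..q}"
      using pq by (intro has_integral_add has_integral_mult_left Aint)
        (use has_integral_const_real[of "(A q - A p) * L * K" p q] in auto)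
    have "norm (h t - prod (f2 t) (g q) - prod (f1 p) (g1 t)) \<le> norm (f2 t) * (L * (q-p) * K) + (A q - A p) * L * K"
      if t: "t \<in> {p..q}" for t
    proof -
      have "norm (g t - g q) \<le> L * (q - p)"
      proof -
        have "norm (integral {t..q} g1) \<le> integral {t..q} (\<lambda>_. L)"
          using t pq L gint[of t q] by (intro integral_norm_bound_integral) auto
        then have "norm (g q - g t) \<le> L * (q - t)"
          using t pq gint[of t q] by (simp add: integral_unique mult.commute)
        also have "\<dots> \<le> L * (q - p)" using t L by simp
        finally show ?thesis by (simp add: norm_minus_commute)
      qed
      then have 1: "norm (prod (f2 t) (g t - g q)) \<le> norm (f2 t) * (L * (q-p)) * K"
        by (intro order_trans[OF K(2)] mult_right_mono mult_left_mono) (use K in auto)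
      have f1t: "norm (f1 t - f1 p) \<le> A q - A p"
      proof -
        have "norm (integral {p..t} f2) \<le> integral {p..t} (\<lambda>t. norm (f2 t))"
          using t pq by (intro integral_norm_bound_integral) (auto intro: sub f2i nf2)
        also have "\<dots> \<le> integral {p..q} (\<lambda>t. norm (f2 t))"
          using t pq by (intro integral_subset_le) (auto intro: sub f2i nf2)
        finally show ?thesis
          using t pq f1_diff[of p t] A_diff[OF pq] by simp
      qed
      then have 2: "norm (prod (f1 t - f1 p) (g1 t)) \<le> (A q - A p) * L * K"
        using f1t order_trans[OF norm_ge_zero f1t] K(1) L t pq
        by (intro order_trans[OF K(2)] mult_right_mono mult_mono) auto
      have "h t - prod (f2 t) (g q) - prod (f1 p) (g1 t) = prod (f2 t) (g t - g q) + prod (f1 t - f1 p) (g1 t)"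
        by (simp add: h_def prod.diff_left prod.diff_right)
      then have "norm (h t - prod (f2 t) (g q) - prod (f1 p) (g1 t)) \<le>
          norm (prod (f2 t) (g t - g q)) + norm (prod (f1 t - f1 p) (g1 t))"
        by (simp only: norm_triangle_ineq)
      also have "\<dots> \<le> norm (f2 t) * (L * (q-p)) * K + (A q - A p) * L * K"
        by (rule add_mono[OF 1 2])
      finally show ?thesis by (simp only: mult.assoc)
    qed
    then have "norm (D q - D p) \<le> (A q - A p) * (L * (q-p) * K) + (q - p) * ((A q - A p) * L * K)"
      unfolding Deq using integral_norm_bound_integral[OF int has_integral_integrable[OF Bint]]
      by (simp add: integral_unique[OF Bint])
    then show ?thesis by (simp add: algebra_simps)
  qed
  have "(D has_derivative (\<lambda>_. 0)) (at x within {0..b})" if x: "x \<in> {0..b}" for x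
    unfolding has_derivative_within_alt
  proof (intro conjI allI impI)
    fix e :: real assume e: "e > 0"
    define e' where "e' = e / (2 * K * L)"
    have e': "e' > 0" using e K L by (simp add: e'_def)
    obtain d where d: "d > 0" "\<And>y. y \<in> {0..b} \<Longrightarrow> dist y x < d \<Longrightarrow> dist (A y) (A x) < e'"
      using contA x e' unfolding continuous_on_iff by blast
    have "norm (D y - D x) \<le> e * norm (y - x)" if "y \<in> {0..b}" "norm (y - x) < d" for y
    proof -
      have "norm (D y - D x) \<le> 2 * K * L * \<bar>y - x\<bar> * \<bar>A y - A x\<bar>"
      proof (cases "x \<le> y")
        case True
        have "norm (D y - D x) \<le> 2 * K * L * (y - x) * (A y - A x)"
          by (rule key) (use x that True in auto)
        also have "\<dots> \<le> 2 * K * L * (y - x) * \<bar>A y - A x\<bar>"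
          by (rule mult_left_mono) (use True K L in auto)
        finally show ?thesis using True by simp
      next
        case False
        have "norm (D x - D y) \<le> 2 * K * L * (x - y) * (A x - A y)"
          by (rule key) (use x that False in auto)
        also have "\<dots> \<le> 2 * K * L * (x - y) * \<bar>A y - A x\<bar>"
          by (rule mult_left_mono) (use False K L in auto)
        finally show ?thesis using False by (simp add: norm_minus_commute)
      qed
      also have "\<dots> \<le> 2 * K * L * \<bar>y - x\<bar> * e'"
        using d(2)[of y] that K L by (intro mult_left_mono) (auto simp: dist_real_def)
      also have "\<dots> = e * norm (y - x)"
        using K L by (simp add: e'_def)
      finally show ?thesis .
    qed
    then show "\<exists>d>0. \<forall>y\<in>{0..b}. norm (y - x) < d \<longrightarrow> norm (D y - D x - 0) \<le> e * norm (y - x)"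
      using d(1) by auto
  qed auto
  then obtain c where "\<And>x. x \<in> {0..b} \<Longrightarrow> D x = c"
    using has_derivative_zero_constant[of "{0..b}" D] by auto
  then have "D b = D 0" using b by auto
  then have "integral {0..b} h = prod (f1 b) (g b) - prod (f1 0) (g 0)"
    by (simp add: D_def algebra_simps)
  then show ?thesis
    using hint unfolding h_def by (metis has_integral_integrable_integral)
qed

text \<open>
  The solution of \<open>y'' = f\<close> with \<open>y(0) = y'(0) = 0\<close>. Writing it as an iterated integral, and not with
  the kernel \<open>x - t\<close>, makes its first derivative visible.
\<close>

definition double_integral :: "(real \<Rightarrow> 'b::euclidean_space) \<Rightarrow> real \<Rightarrow> 'b" where
  "double_integral f x = integral {0..x} (\<lambda>s. integral {0..s} f)"

lemma double_integral_cong: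
  assumes "\<And>t. t \<in> {0..1} \<Longrightarrow> f t = g t" "x \<in> {0..1}"
  shows "double_integral f x = double_integral g x"
  unfolding double_integral_def
proof (rule integral_cong)
  fix s assume "s \<in> {0..x}"
  then show "integral {0..s} f = integral {0..s} g"
    using assms by (intro integral_cong) auto
qed

lemma has_vector_derivative_double_integral:
  assumes "f absolutely_integrable_on {0..1}" "x \<in> {0..1}"
  shows "(double_integral f has_vector_derivative integral {0..x} f) (at x within {0..1})"
  unfolding double_integral_def[abs_def]
  by (rule integral_has_vector_derivative[OF continuous_on_indefinite_integral[OF assms(1)] assms(2)])

lemma continuous_on_double_integral:
  assumes "f absolutely_integrable_on {0..1}"
  shows "continuous_on {0..1} (double_integral f)"
  using has_vector_derivative_double_integral[OF assms] has_vector_derivative_continuous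
    continuous_on_eq_continuous_within by blast

lemma double_integral_diff:
  assumes f: "f absolutely_integrable_on {0..1}" and g: "g absolutely_integrable_on {0..1}" and x: "x \<in> {0..1}"
  shows "double_integral (\<lambda>t. f t - g t) x = double_integral f x - double_integral g x"
proof -
  have sub: "F integrable_on {0..s}" if "F absolutely_integrable_on {0..1}" "s \<in> {0..x}" for F :: "real \<Rightarrow> 'a" and s
    using integrable_on_subinterval[of F "{0..1}" 0 s] that x by (auto simp: absolutely_integrable_on_def)
  have sub2: "(\<lambda>s. integral {0..s} F) integrable_on {0..x}" if "F absolutely_integrable_on {0..1}" for F :: "real \<Rightarrow> 'a"
    using continuous_on_subset[OF continuous_on_indefinite_integral[OF that], of "{0..x}"] x
    by (intro integrable_continuous_real) auto
  have "double_integral (\<lambda>t. f t - g t) x = integral {0..x} (\<lambda>s. integral {0..s} f - integral {0..s} g)"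
    unfolding double_integral_def
    by (intro integral_cong Henstock_Kurzweil_Integration.integral_diff sub f g)
  also have "\<dots> = double_integral f x - double_integral g x"
    unfolding double_integral_def
    by (intro Henstock_Kurzweil_Integration.integral_diff sub2 f g)
  finally show ?thesis .
qed

lemma double_integral_add:
  assumes f: "f absolutely_integrable_on {0..1}" and g: "g absolutely_integrable_on {0..1}" and x: "x \<in> {0..1}"
  shows "double_integral (\<lambda>t. f t + g t) x = double_integral f x + double_integral g x"
proof -
  have "(\<lambda>t. f t + g t) absolutely_integrable_on {0..1}"
    by (rule set_integral_add(1)[OF f g])
  from double_integral_diff[OF this g x] show ?thesis
    by (simp add: algebra_simps)
qed

text \<open>
  In the norm weighted by \<open>exp (\<kappa> x)\<close> the outer integration gains a factor \<open>1/\<kappa>\<close>. For \<open>\<kappa>\<close> at least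
  twice the integral of \<open>u\<close> this makes the Volterra operators below contractions with factor \<open>1/2\<close>,
  which takes the place of Gronwall's inequality.
\<close>

lemma norm_double_integral_le:
  fixes f :: "real \<Rightarrow> 'b::euclidean_space"
  assumes f: "f absolutely_integrable_on {0..1}" and u: "u integrable_on {0..1}"
    and le: "\<And>t. t \<in> {0..1} \<Longrightarrow> norm (f t) \<le> u t * (M * exp (\<kappa> * t))"
    and u0: "\<And>t. 0 \<le> u t" and M: "0 \<le> M" and \<kappa>: "0 < \<kappa>" "2 * integral {0..1} u \<le> \<kappa>" and x: "x \<in> {0..1}"
  shows "norm (double_integral f x) \<le> M / 2 * exp (\<kappa> * x)"
proof -
  define I where "I = integral {0..1} u"
  have I0: "0 \<le> I" unfolding I_def by (intro integral_nonneg u u0)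
  have sub: "F integrable_on {0..s}" if "F integrable_on {0..1}" "s \<in> {0..1}" for F :: "real \<Rightarrow> 'c::euclidean_space" and s
    using integrable_on_subinterval[OF that(1), of 0 s] that by auto
  have fi: "f integrable_on {0..1}" using f by (simp add: absolutely_integrable_on_def)
  \<comment> \<open>The inner integral keeps the weight, at the price of the integral of \<open>u\<close>.\<close>
  have inner: "norm (integral {0..s} f) \<le> M * I * exp (\<kappa> * s)" if s: "s \<in> {0..1}" for s
  proof -
    have "norm (integral {0..s} f) \<le> integral {0..s} (\<lambda>t. u t * (M * exp (\<kappa> * s)))"
    proof (rule integral_norm_bound_integral)
      show "f integrable_on {0..s}" by (rule sub[OF fi s])
      show "(\<lambda>t. u t * (M * exp (\<kappa> * s))) integrable_on {0..s}"
        by (intro integrable_on_mult_left sub[OF u s])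
    next
      fix t assume t: "t \<in> {0..s}"
      then have "norm (f t) \<le> u t * (M * exp (\<kappa> * t))" using s by (intro le) auto
      also have "\<dots> \<le> u t * (M * exp (\<kappa> * s))"
        using t \<kappa> by (intro mult_left_mono u0 M) auto
      finally show "norm (f t) \<le> u t * (M * exp (\<kappa> * s))" .
    qed
    also have "\<dots> = integral {0..s} u * (M * exp (\<kappa> * s))" by simp
    also have "\<dots> \<le> I * (M * exp (\<kappa> * s))"
      unfolding I_def using s M by (intro mult_right_mono integral_subset_le sub[OF u s] u) (use u0 in auto)
    finally show ?thesis by (simp add: mult_ac)
  qed
  have ex: "((\<lambda>s. M * I * exp (\<kappa> * s)) has_integral M * I * exp (\<kappa> * x) / \<kappa> - M * I * exp (\<kappa> * 0) / \<kappa>) {0..x}"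
    using x \<kappa> by (intro fundamental_theorem_of_calculus)
     (auto intro!: derivative_eq_intros simp flip: has_real_derivative_iff_has_vector_derivative)
  have "norm (double_integral f x) \<le> integral {0..x} (\<lambda>s. M * I * exp (\<kappa> * s))"
    unfolding double_integral_def
  proof (intro integral_norm_bound_integral)
    show "(\<lambda>s. integral {0..s} f) integrable_on {0..x}"
      using continuous_on_subset[OF continuous_on_indefinite_integral[OF f], of "{0..x}"] x
      by (intro integrable_continuous_real) auto
  qed (use ex inner x in auto)
  also have "\<dots> \<le> M * I * exp (\<kappa> * x) / \<kappa>"
    unfolding integral_unique[OF ex] using M I0 \<kappa> by simp
  also have "\<dots> = M * exp (\<kappa> * x) * (I / \<kappa>)" by simp
  also have "\<dots> \<le> M * exp (\<kappa> * x) * (1 / 2)"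
    using M \<kappa> by (intro mult_left_mono) (auto simp: I_def field_simps)
  finally show ?thesis by simp
qed

text \<open>
  The hypothesis is used with the smallest admissible \<open>M\<close>, the maximum of the weighted norm of \<open>y\<close>;
  then \<open>M \<le> G + M / 2\<close>.
\<close>

lemma weighted_bound_absorb:
  fixes y :: "real \<Rightarrow> 'b::real_normed_vector"
  assumes y: "continuous_on {0..1} y"
    and step: "\<And>M x. 0 \<le> M \<Longrightarrow> (\<And>t. t \<in> {0..1} \<Longrightarrow> norm (y t) \<le> M * exp (\<kappa> * t)) \<Longrightarrow> x \<in> {0..1} \<Longrightarrow>
      norm (y x) \<le> (G + M / 2) * exp (\<kappa> * x)"
    and x: "x \<in> {0..1}"
  shows "norm (y x) \<le> 2 * G * exp (\<kappa> * x)"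
proof -
  define w where "w t = norm (y t) / exp (\<kappa> * t)" for t
  have "continuous_on {0..1} w"
    unfolding w_def by (intro continuous_intros y) auto
  then obtain m where m: "m \<in> {0..1}" "\<And>t. t \<in> {0..1} \<Longrightarrow> w t \<le> w m"
    using continuous_attains_sup[of "{0..1}" w] by auto
  have le: "norm (y t) \<le> w m * exp (\<kappa> * t)" if "t \<in> {0..1}" for t
    using m(2)[OF that] by (simp add: w_def field_simps)
  have "norm (y m) \<le> (G + w m / 2) * exp (\<kappa> * m)"
    by (rule step) (use le m in \<open>auto simp: w_def\<close>)
  then have "w m \<le> G + w m / 2"
    by (subst w_def) (simp add: field_simps)
  then have "w m \<le> 2 * G" by simp
  then show ?thesis
    using le[OF x] by (meson exp_ge_zero mult_right_mono order_trans)
qed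

text \<open>
  The Neumann series: each application of the operator halves the weighted norm once \<open>\<kappa>\<close> exceeds
  twice the integral of \<open>|U|\<close>.
\<close>

lemma volterra_solution_exists:
  fixes U :: "real \<Rightarrow> complex^'n^'n" and g :: "real \<Rightarrow> complex^'n^'n"
  assumes U: "U absolutely_integrable_on {0..1}" and g: "continuous_on {0..1} g"
  obtains y where "continuous_on {0..1} y"
    "\<And>x. x \<in> {0..1} \<Longrightarrow> y x = g x + double_integral (\<lambda>t. U t ** y t) x"
proof -
  define I where "I = integral {0..1} (\<lambda>t. norm (U t))"
  have nU: "(\<lambda>t. norm (U t)) integrable_on {0..1}"
    using U by (simp add: absolutely_integrable_on_def)
  have I0: "I \<ge> 0" unfolding I_def by (intro integral_nonneg nU) auto
  \<comment> \<open>Twice \<open>I\<close> suffices for the contraction; adding \<open>1\<close> keeps the weight positive when \<open>I = 0\<close>.\<close>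
  define \<kappa> where "\<kappa> = 2 * I + 1"
  have \<kappa>: "\<kappa> > 0" using I0 by (simp add: \<kappa>_def)
  have ai: "(\<lambda>t. U t ** y t) absolutely_integrable_on {0..1}" if "continuous_on {0..1} y" for y :: "real \<Rightarrow> complex^'n^'n"
    by (rule absolutely_integrable_bilinear_continuous[OF mat_mat.bounded_bilinear_axioms U that])
  have bound: "norm (double_integral (\<lambda>t. U t ** y t) x) \<le> M / 2 * exp (\<kappa> * x)"
    if y: "continuous_on {0..1} y" and M: "0 \<le> M" and le: "\<And>t. t \<in> {0..1} \<Longrightarrow> norm (y t) \<le> M * exp (\<kappa> * t)"
      and x: "x \<in> {0..1}" for y :: "real \<Rightarrow> complex^'n^'n" and M x
  proof (rule norm_double_integral_le[OF ai[OF y] nU])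
    fix t :: real assume "t \<in> {0..1}"
    then show "norm (U t ** y t) \<le> norm (U t) * (M * exp (\<kappa> * t))"
      by (intro order_trans[OF norm_matrix_mult_le] mult_left_mono le) auto
  qed (use M \<kappa> x in \<open>auto simp: \<kappa>_def I_def\<close>)
  \<comment> \<open>These are the terms of the Neumann series; \<open>s\<close> below stands for its partial sums.\<close>
  define d where "d = rec_nat g (\<lambda>_ y. double_integral (\<lambda>t. U t ** y t))"
  have d0: "d 0 = g" and dS: "\<And>n. d (Suc n) = double_integral (\<lambda>t. U t ** d n t)"
    by (simp_all add: d_def)
  have cd: "continuous_on {0..1} (d n)" for n
    by (induction n) (auto simp: d0 dS g intro: continuous_on_double_integral ai)
  obtain G where G: "G > 0" "\<And>t. t \<in> {0..1} \<Longrightarrow> norm (g t) \<le> G"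
    using compact_imp_bounded[OF compact_continuous_image[OF g]] by (force simp: bounded_pos)
  have dle: "norm (d n t) \<le> G * (1/2)^n * exp (\<kappa> * t)" if "t \<in> {0..1}" for n t
    using that
  proof (induction n arbitrary: t)
    case 0
    have "norm (g t) * 1 \<le> G * exp (\<kappa> * t)"
      using 0 \<kappa> G by (intro mult_mono) auto
    then show ?case by (simp add: d0)
  next
    case (Suc n)
    then show ?case
      using bound[OF cd[of n], of "G * (1/2)^n" t] G by (simp add: dS)
  qed
  have dle': "norm (d n t) \<le> (G * exp \<kappa>) * (1/2)^n" if "t \<in> {0..1}" for n t
  proof -
    have "G * (1/2)^n * exp (\<kappa> * t) \<le> G * (1/2)^n * exp \<kappa>"
      using that \<kappa> G by (intro mult_left_mono) (auto simp: mult_left_le)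
    then show ?thesis using dle[OF that, of n] by (simp add: mult_ac)
  qed
  define s where "s n t = (\<Sum>i<n. d i t)" for n t
  define y where "y t = (\<Sum>i. d i t)" for t
  have lim: "uniform_limit {0..1} s y sequentially"
    unfolding s_def y_def
    by (rule Weierstrass_m_test[OF dle']) (auto intro!: summable_mult summable_geometric)
  have cs: "continuous_on {0..1} (s n)" for n
    unfolding s_def by (intro continuous_on_sum cd)
  have cy: "continuous_on {0..1} y"
    by (rule uniform_limit_theorem[OF _ lim]) (auto simp: cs)
  have step: "s (Suc n) x = g x + double_integral (\<lambda>t. U t ** s n t) x" if x: "x \<in> {0..1}" for n x
  proof (induction n)
    case 0
    have "double_integral (\<lambda>t. U t ** s 0 t) x = 0"
      by (simp add: s_def double_integral_def mat_mat.zero_right)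
    then show ?case by (simp add: s_def d0)
  next
    case (Suc n)
    have "double_integral (\<lambda>t. U t ** s (Suc n) t) x = double_integral (\<lambda>t. U t ** s n t + U t ** d n t) x"
      by (simp add: s_def matrix_add_ldistrib)
    also have "\<dots> = double_integral (\<lambda>t. U t ** s n t) x + d (Suc n) x"
      unfolding dS by (rule double_integral_add[OF ai[OF cs] ai[OF cd] x])
    finally show ?case using Suc by (simp add: s_def)
  qed
  have "y x = g x + double_integral (\<lambda>t. U t ** y t) x" if x: "x \<in> {0..1}" for x
  proof -
    have "norm (y x - (g x + double_integral (\<lambda>t. U t ** y t) x)) \<le> e" if e: "e > 0" for e
    proof -
      define e' where "e' = e / (1 + exp \<kappa>)"
      have e': "e' > 0" using e by (simp add: e'_def add_pos_pos)
      obtain n where n: "\<And>m t. m \<ge> n \<Longrightarrow> t \<in> {0..1} \<Longrightarrow> norm (s m t - y t) < e'"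
        using lim e' unfolding uniform_limit_iff eventually_sequentially dist_norm by meson
      have "norm (double_integral (\<lambda>t. U t ** (s n t - y t)) x) \<le> e' / 2 * exp (\<kappa> * x)"
      proof (rule bound)
        fix t :: real assume t: "t \<in> {0..1}"
        have "norm (s n t - y t) * 1 \<le> e' * exp (\<kappa> * t)"
          using n[OF order_refl t] e' t \<kappa> by (intro mult_mono) auto
        then show "norm (s n t - y t) \<le> e' * exp (\<kappa> * t)" by simp
      qed (use e' x cs cy in \<open>auto intro!: continuous_intros\<close>)
      also have "\<dots> \<le> e' * exp \<kappa>"
        using e' x \<kappa> by (intro mult_mono) (auto simp: mult_left_le)
      finally have 1: "norm (double_integral (\<lambda>t. U t ** s n t) x - double_integral (\<lambda>t. U t ** y t) x) \<le> e' * exp \<kappa>"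
        by (simp add: mat_mat.diff_right double_integral_diff[OF ai[OF cs] ai[OF cy] x])
      have 2: "norm (y x - s (Suc n) x) \<le> e'"
        using n[of "Suc n" x] x by (simp add: norm_minus_commute)
      have "y x - (g x + double_integral (\<lambda>t. U t ** y t) x) =
          (y x - s (Suc n) x) + (double_integral (\<lambda>t. U t ** s n t) x - double_integral (\<lambda>t. U t ** y t) x)"
        by (simp add: step[OF x])
      then have "norm (y x - (g x + double_integral (\<lambda>t. U t ** y t) x)) \<le> e' + e' * exp \<kappa>"
        by (simp only: norm_triangle_mono[OF 2 1])
      also have "\<dots> = e" by (simp add: e'_def field_simps add_nonneg_eq_0_iff)
      finally show ?thesis .
    qed
    then have "norm (y x - (g x + double_integral (\<lambda>t. U t ** y t) x)) \<le> 0"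
      using field_le_epsilon[of _ 0] by force
    then show ?thesis by simp
  qed
  with cy that show thesis by blast
qed

lemma has_derivsD:
  assumes "has_derivs f f1 f2"
  shows "\<And>x. x \<in> {0..1} \<Longrightarrow> (f has_vector_derivative f1 x) (at x within {0..1})"
    "f2 absolutely_integrable_on {0..1}"
    "\<And>x. x \<in> {0..1} \<Longrightarrow> (f2 has_integral (f1 x - f1 0)) {0..x}"
    "continuous_on {0..1} f" "continuous_on {0..1} f1"
    "\<And>x. x \<in> {0..1} \<Longrightarrow> f1 x = f1 0 + integral {0..x} f2"
proof -
  show 1: "\<And>x. x \<in> {0..1} \<Longrightarrow> (f has_vector_derivative f1 x) (at x within {0..1})"
    and 2: "f2 absolutely_integrable_on {0..1}"
    and 3: "\<And>x. x \<in> {0..1} \<Longrightarrow> (f2 has_integral (f1 x - f1 0)) {0..x}"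
    using assms by (auto simp: has_derivs_def)
  show 4: "f1 x = f1 0 + integral {0..x} f2" if "x \<in> {0..1}" for x
    by (rule primitive_eq_integral[OF 3 that])
  show "continuous_on {0..1} f"
    using 1 has_vector_derivative_continuous continuous_on_eq_continuous_within by blast
  show "continuous_on {0..1} f1"
    by (rule continuous_on_eq[OF _ 4[symmetric]])
       (intro continuous_intros continuous_on_indefinite_integral 2)
qed

text \<open>
  The initial value problem as a Volterra equation: the only form in which solutions are estimated.
\<close>

lemma has_derivs_eq_double_integral:
  assumes d: "has_derivs f f1 f2" and x: "x \<in> {0..1}"
  shows "f x = f 0 + x *\<^sub>R f1 0 + double_integral f2 x"
proof -
  note D = has_derivsD[OF d]
  have "(f1 has_integral (f x - f 0)) {0..x}"
  proof (rule fundamental_theorem_of_calculus)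
    fix t assume "t \<in> {0..x}"
    then show "(f has_vector_derivative f1 t) (at t within {0..x})"
      using x by (intro has_vector_derivative_within_subset[OF D(1)]) auto
  qed (use x in auto)
  moreover have "((\<lambda>s. f1 0 + integral {0..s} f2) has_integral (x *\<^sub>R f1 0 + double_integral f2 x)) {0..x}"
  proof (rule has_integral_add)
    show "((\<lambda>s. f1 0) has_integral x *\<^sub>R f1 0) {0..x}"
      using has_integral_const_real[of "f1 0" 0 x] x by simp
    have "continuous_on {0..x} (\<lambda>s. integral {0..s} f2)"
      by (rule continuous_on_subset[OF continuous_on_indefinite_integral[OF D(2)]]) (use x in auto)
    then show "((\<lambda>s. integral {0..s} f2) has_integral double_integral f2 x) {0..x}"
      unfolding double_integral_def by (intro integrable_integral integrable_continuous_real)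
  qed
  then have "(f1 has_integral (x *\<^sub>R f1 0 + double_integral f2 x)) {0..x}"
  proof (rule has_integral_eq[rotated])
    fix s assume "s \<in> {0..x}"
    then show "f1 0 + integral {0..s} f2 = f1 s"
      using x by (intro D(6)[symmetric]) auto
  qed
  ultimately have "f x - f 0 = x *\<^sub>R f1 0 + double_integral f2 x"
    by (rule has_integral_unique)
  then show ?thesis by (simp add: algebra_simps)
qed

lemma has_derivs_diff:
  assumes "has_derivs f f1 f2" "has_derivs g g1 g2"
  shows "has_derivs (\<lambda>x. f x - g x) (\<lambda>x. f1 x - g1 x) (\<lambda>x. f2 x - g2 x)"
  unfolding has_derivs_def
proof (intro conjI ballI)
  note D = has_derivsD[OF assms(1)] and E = has_derivsD[OF assms(2)]
  show "((\<lambda>x. f x - g x) has_vector_derivative f1 x - g1 x) (at x within {0..1})" if "x \<in> {0..1}" for x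
    by (intro has_vector_derivative_diff D(1) E(1) that)
  show "(\<lambda>x. f2 x - g2 x) absolutely_integrable_on {0..1}"
    by (intro set_integral_diff(1) D(2) E(2))
  show "((\<lambda>x. f2 x - g2 x) has_integral f1 x - g1 x - (f1 0 - g1 0)) {0..x}" if "x \<in> {0..1}" for x
    using has_integral_diff[OF D(3)[OF that] E(3)[OF that]] by (simp add: algebra_simps)
qed

lemma has_derivs_linear:
  assumes h: "bounded_linear h" and f: "has_derivs f f1 f2"
  shows "has_derivs (\<lambda>x. h (f x)) (\<lambda>x. h (f1 x)) (\<lambda>x. h (f2 x))"
  unfolding has_derivs_def
proof (intro conjI ballI)
  interpret bounded_linear h by fact
  note D = has_derivsD[OF f]
  show "((\<lambda>x. h (f x)) has_vector_derivative h (f1 x)) (at x within {0..1})" if "x \<in> {0..1}" for x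
    by (rule bounded_linear.has_vector_derivative[OF h D(1)[OF that]])
  show "(\<lambda>x. h (f2 x)) absolutely_integrable_on {0..1}"
    using absolutely_integrable_linear[OF D(2) h] by (simp add: o_def)
  show "((\<lambda>x. h (f2 x)) has_integral h (f1 x) - h (f1 0)) {0..x}" if "x \<in> {0..1}" for x
    using has_integral_linear[OF D(3)[OF that] h] by (simp add: o_def diff)
qed

lemma has_derivs_spike:
  assumes f: "has_derivs f f1 f2" and N: "negligible N" "\<And>t. t \<in> {0..1} - N \<Longrightarrow> g2 t = f2 t"
  shows "has_derivs f f1 g2"
  unfolding has_derivs_def
proof (intro conjI ballI)
  note D = has_derivsD[OF f]
  show "g2 absolutely_integrable_on {0..1}"
    by (rule absolutely_integrable_spike[OF D(2) N])
  show "(g2 has_integral f1 x - f1 0) {0..x}" if "x \<in> {0..1}" for x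
    by (rule has_integral_spike[OF N(1) _ D(3)[OF that]]) (use N(2) that in auto)
qed (rule has_derivsD[OF f])

text \<open>
  Passing from the open to the closed interval costs two points, which join the exceptional set.
\<close>

lemma AE_unit_intervalD:
  assumes "AE x in lebesgue_on {0<..<1::real}. P x"
  obtains N where "negligible N" "\<And>t. t \<in> {0..1} - N \<Longrightarrow> P t"
proof -
  have "AE x in lebesgue. x \<in> {0<..<1} \<longrightarrow> P x"
    using assms by (subst (asm) AE_restrict_space_iff) auto
  then obtain N where N: "N \<in> null_sets lebesgue" "\<And>x. x \<notin> N \<Longrightarrow> x \<in> {0<..<1} \<longrightarrow> P x"
    by (auto simp: completion.AE_iff_null_sets)
  show thesis
  proof (rule that[of "insert 0 (insert 1 N)"])
    show "negligible (insert 0 (insert 1 N))"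
      using N(1) by (simp add: negligible_iff_null_sets[symmetric] negligible_insert)
    fix t :: real assume "t \<in> {0..1} - insert 0 (insert 1 N)"
    then show "P t" using N(2)[of t] by auto
  qed
qed

lemma AE_unit_intervalI:
  assumes "\<And>t. t \<in> {0..1} \<Longrightarrow> P t"
  shows "AE x in lebesgue_on {0<..<1::real}. P x"
  by (rule AE_I2) (use assms in auto)

text \<open>
  The Volterra form of the problem bounds the weighted norm of \<open>d\<close> by half of itself.
\<close>

lemma ode_zero_unique:
  assumes d: "has_derivs d d1 d2" and z: "d 0 = 0" "d1 0 = 0"
    and ae: "AE t in lebesgue_on {0<..<1}. norm (d2 t) \<le> u t * norm (d t)"
    and u: "u integrable_on {0..1}" "\<And>t. 0 \<le> u t" and x: "x \<in> {0..1}"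
  shows "d x = 0"
proof -
  obtain N where N: "negligible N" "\<And>t. t \<in> {0..1} - N \<Longrightarrow> norm (d2 t) \<le> u t * norm (d t)"
    using AE_unit_intervalD[OF ae] by blast
  define e2 where "e2 t = (if t \<in> N then 0 else d2 t)" for t
  have e: "has_derivs d d1 e2"
    by (rule has_derivs_spike[OF d N(1)]) (auto simp: e2_def)
  have e2: "norm (e2 t) \<le> u t * norm (d t)" if "t \<in> {0..1}" for t
    using N(2)[of t] that u(2)[of t] by (auto simp: e2_def)
  define I where "I = integral {0..1} u"
  have I0: "I \<ge> 0" unfolding I_def by (intro integral_nonneg u)
  define \<kappa> where "\<kappa> = 2 * I + 1"
  have \<kappa>: "\<kappa> > 0" using I0 by (simp add: \<kappa>_def)
  have "norm (d x) \<le> 2 * 0 * exp (\<kappa> * x)"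
  proof (rule weighted_bound_absorb[OF _ _ x])
    show "continuous_on {0..1} d" by (rule has_derivsD[OF d])
    fix M x :: real
    assume M: "0 \<le> M" and le: "\<And>t. t \<in> {0..1} \<Longrightarrow> norm (d t) \<le> M * exp (\<kappa> * t)" and x: "x \<in> {0..1}"
    have "norm (double_integral e2 x) \<le> M / 2 * exp (\<kappa> * x)"
    proof (rule norm_double_integral_le[OF has_derivsD(2)[OF e] u(1)])
      fix t :: real assume t: "t \<in> {0..1}"
      show "norm (e2 t) \<le> u t * (M * exp (\<kappa> * t))"
        by (rule order_trans[OF e2[OF t] mult_left_mono[OF le[OF t] u(2)]])
    qed (use M \<kappa> x u in \<open>auto simp: \<kappa>_def I_def\<close>)
    then show "norm (d x) \<le> (0 + M / 2) * exp (\<kappa> * x)"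
      using has_derivs_eq_double_integral[OF e x] z by simp
  qed
  then show ?thesis by simp
qed

section \<open>The matrix solution and the eigenvalues\<close>

lemma potential_minus_spectral_integrable:
  assumes "V absolutely_integrable_on {0..1}"
  shows "(\<lambda>t. V t - mat z) absolutely_integrable_on {0..1::real}"
  by (intro set_integral_diff(1) assms absolutely_integrable_continuous_real continuous_on_const)

lemma potential_mult_integrable:
  fixes V y :: "real \<Rightarrow> complex^'n^'n"
  assumes "V absolutely_integrable_on {0..1}" "continuous_on {0..1} y"
  shows "(\<lambda>t. (V t - mat z) ** y t) absolutely_integrable_on {0..1}"
  by (rule absolutely_integrable_bilinear_continuous[OF mat_mat.bounded_bilinear_axioms
        potential_minus_spectral_integrable[OF assms(1)] assms(2)])

lemma ode_unique:
  fixes V :: "real \<Rightarrow> complex^'n^'n" and d :: "real \<Rightarrow> 'b::euclidean_space"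
  assumes V: "V absolutely_integrable_on {0..1}"
    and d: "has_derivs d d1 d2" "d 0 = 0" "d1 0 = 0"
    and ae: "AE t in lebesgue_on {0<..<1}. norm (d2 t) \<le> norm (V t - mat z) * norm (d t)"
    and x: "x \<in> {0..1}"
  shows "d x = 0"
  by (rule ode_zero_unique[OF d ae _ _ x])
    (use potential_minus_spectral_integrable[OF V, of z] in \<open>auto simp: absolutely_integrable_on_def\<close>)

lemma matrix_solution_exists:
  fixes V :: "real \<Rightarrow> complex^'n^'n"
  assumes V: "V absolutely_integrable_on {0..1}"
  obtains \<phi> \<phi>1 where "\<And>x. x \<notin> {0..1} \<Longrightarrow> \<phi> x = 0"
    "has_derivs \<phi> \<phi>1 (\<lambda>t. (V t - mat z) ** \<phi> t)" "\<phi> 0 = 0" "\<phi>1 0 = mat 1"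
proof -
  have "continuous_on {0..1} (\<lambda>x. x *\<^sub>R (mat 1 :: complex^'n^'n))"
    by (intro continuous_intros)
  from volterra_solution_exists[OF potential_minus_spectral_integrable[OF V, of z] this]
  obtain y where y: "continuous_on {0..1} y"
    "\<And>x. x \<in> {0..1} \<Longrightarrow> y x = x *\<^sub>R mat 1 + double_integral (\<lambda>t. (V t - mat z) ** y t) x"
    by blast
  define \<phi> where "\<phi> x = (if x \<in> {0..1} then y x else 0)" for x
  have c\<phi>: "continuous_on {0..1} \<phi>"
    by (rule continuous_on_eq[OF y(1)]) (simp add: \<phi>_def)
  let ?f = "\<lambda>t. (V t - mat z) ** \<phi> t"
  have ai: "?f absolutely_integrable_on {0..1}"
    by (rule potential_mult_integrable[OF V c\<phi>])
  have \<phi>: "\<phi> x = x *\<^sub>R mat 1 + double_integral ?f x" if "x \<in> {0..1}" for x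
  proof -
    have "double_integral (\<lambda>t. (V t - mat z) ** y t) x = double_integral ?f x"
      by (rule double_integral_cong[OF _ that]) (simp add: \<phi>_def)
    then show ?thesis using y(2)[OF that] that by (simp add: \<phi>_def)
  qed
  define \<phi>1 where "\<phi>1 x = mat 1 + integral {0..x} ?f" for x
  have "has_derivs \<phi> \<phi>1 ?f"
    unfolding has_derivs_def
  proof (intro conjI ballI ai)
    fix x :: real assume x: "x \<in> {0..1}"
    have "((\<lambda>x. x *\<^sub>R mat 1 + double_integral ?f x) has_vector_derivative (1 *\<^sub>R mat 1 + integral {0..x} ?f)) (at x within {0..1})"
      by (intro has_vector_derivative_add has_vector_derivative_double_integral[OF ai x])
         (auto intro!: derivative_eq_intros)
    then show "(\<phi> has_vector_derivative \<phi>1 x) (at x within {0..1})"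
      unfolding \<phi>1_def scaleR_one
      by (rule has_vector_derivative_transform[OF x, rotated]) (erule \<phi>)
    have "?f integrable_on {0..x}"
      using integrable_on_subinterval[of ?f "{0..1}" 0 x] ai x by (auto simp: absolutely_integrable_on_def)
    then show "(?f has_integral \<phi>1 x - \<phi>1 0) {0..x}"
      by (simp add: \<phi>1_def integrable_integral)
  qed
  moreover have "\<phi> 0 = 0"
    using \<phi>[of 0] by (simp add: double_integral_def)
  moreover have "\<phi>1 0 = mat 1"
    by (simp add: \<phi>1_def)
  moreover have "\<phi> x = 0" if "x \<notin> {0..1}" for x
    using that unfolding \<phi>_def by (rule if_not_P)
  ultimately show thesis
    using that by blast
qed

text \<open>
  The derivative of \<open>\<phi>\<close> with respect to \<open>x\<close> on \<open>[0,1]\<close>, written as an indefinite integral to have a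
  closed formula for it.
\<close>

definition phi_deriv :: "(real \<Rightarrow> complex^'n^'n) \<Rightarrow> complex \<Rightarrow> real \<Rightarrow> complex^'n^'n" where
  "phi_deriv V z x = mat 1 + integral {0..x} (\<lambda>t. (V t - mat z) ** phi V z t)"

text \<open>
  The defining conditions of \<^const>\<open>phi\<close> determine a function: a solution exists by the Neumann series,
  and the difference of two solutions has vanishing initial data.
\<close>

lemma phi_characterization:
  assumes V: "V absolutely_integrable_on {0..1}"
  shows phi_has_derivs: "has_derivs (phi V z) (phi_deriv V z) (\<lambda>t. (V t - mat z) ** phi V z t)"
    and phi_0: "phi V z 0 = 0" and phi_deriv_0: "phi_deriv V z 0 = mat 1"
    and phi_outside: "\<And>x. x \<notin> {0..1} \<Longrightarrow> phi V z x = 0"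
proof -
  let ?P = "\<lambda>\<phi>. (\<forall>x. x \<notin> {0..1} \<longrightarrow> \<phi> x = 0) \<and>
     (\<exists>\<phi>1 \<phi>2. has_derivs \<phi> \<phi>1 \<phi>2 \<and> \<phi> 0 = 0 \<and> \<phi>1 0 = mat 1 \<and>
        (AE x in lebesgue_on {0<..<1}. - \<phi>2 x + V x ** \<phi> x = mat z ** \<phi> x))"
  obtain \<phi> \<phi>1 where \<phi>: "\<And>x. x \<notin> {0..1} \<Longrightarrow> \<phi> x = 0"
    "has_derivs \<phi> \<phi>1 (\<lambda>t. (V t - mat z) ** \<phi> t)" "\<phi> 0 = 0" "\<phi>1 0 = mat 1"
    using matrix_solution_exists[OF V] by blast
  have P\<phi>: "?P \<phi>"
    using \<phi> by (intro conjI exI[of _ \<phi>1] exI[of _ "\<lambda>t. (V t - mat z) ** \<phi> t"] AE_unit_intervalI)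
      (auto simp: mat_mat.diff_left)
  have "\<psi> = \<phi>" if P\<psi>: "?P \<psi>" for \<psi>
  proof
    fix x
    obtain \<psi>1 \<psi>2 where \<psi>: "has_derivs \<psi> \<psi>1 \<psi>2" "\<psi> 0 = 0" "\<psi>1 0 = mat 1"
      "AE x in lebesgue_on {0<..<1}. - \<psi>2 x + V x ** \<psi> x = mat z ** \<psi> x"
      using P\<psi> by blast
    have "AE t in lebesgue_on {0<..<1}. norm (\<psi>2 t - (V t - mat z) ** \<phi> t) \<le> norm (V t - mat z) * norm (\<psi> t - \<phi> t)"
      using \<psi>(4)
    proof (rule AE_mp[OF _ AE_I2], intro impI)
      fix t assume "- \<psi>2 t + V t ** \<psi> t = mat z ** \<psi> t"
      then have "\<psi>2 t = (V t - mat z) ** \<psi> t"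
        by (simp add: mat_mat.diff_left algebra_simps)
      then show "norm (\<psi>2 t - (V t - mat z) ** \<phi> t) \<le> norm (V t - mat z) * norm (\<psi> t - \<phi> t)"
        by (simp add: norm_matrix_mult_le flip: mat_mat.diff_right)
    qed
    then have "\<psi> x - \<phi> x = 0" if "x \<in> {0..1}"
      using ode_unique[OF V has_derivs_diff[OF \<psi>(1) \<phi>(2)] _ _ _ that] \<psi> \<phi> by simp
    then show "\<psi> x = \<phi> x" using P\<psi> \<phi>(1) by (cases "x \<in> {0..1}") auto
  qed
  then have eq: "phi V z = \<phi>"
    unfolding phi_def using P\<phi> by (intro the_equality) blast+
  have eq1: "phi_deriv V z x = \<phi>1 x" if "x \<in> {0..1}" for x
    using has_derivsD(6)[OF \<phi>(2) that] by (simp add: phi_deriv_def eq \<phi>(4))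
  show "has_derivs (phi V z) (phi_deriv V z) (\<lambda>t. (V t - mat z) ** phi V z t)"
    using \<phi>(2) unfolding has_derivs_def eq by (simp add: eq1)
  show "phi V z 0 = 0" "phi_deriv V z 0 = mat 1" "\<And>x. x \<notin> {0..1} \<Longrightarrow> phi V z x = 0"
    using \<phi> by (auto simp: eq eq1)
qed

lemma continuous_on_phi:
  assumes "V absolutely_integrable_on {0..1}"
  shows "continuous_on {0..1} (phi V z)"
  by (rule has_derivsD(4)[OF phi_has_derivs[OF assms]])

lemma phi_eq_double_integral:
  assumes "V absolutely_integrable_on {0..1}" "x \<in> {0..1}"
  shows "phi V z x = x *\<^sub>R mat 1 + double_integral (\<lambda>t. (V t - mat z) ** phi V z t) x"
  using has_derivs_eq_double_integral[OF phi_has_derivs[OF assms(1)] assms(2), of z] phi_0[OF assms(1)] phi_deriv_0[OF assms(1)]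
  by simp

lemma phi_vec_has_derivs:
  assumes V: "V absolutely_integrable_on {0..1}"
  shows "has_derivs (\<lambda>x. phi V z x *v h) (\<lambda>x. phi_deriv V z x *v h) (\<lambda>x. (V x - mat z) *v (phi V z x *v h))"
  using has_derivs_linear[OF mat_vec.bounded_linear_left phi_has_derivs[OF V]]
  by (simp add: matrix_vector_mul_assoc)

lemma vector_solution_eq_phi:
  assumes V: "V absolutely_integrable_on {0..1}"
    and \<psi>: "has_derivs \<psi> \<psi>1 \<psi>2" "\<psi> 0 = 0"
    and ae: "AE x in lebesgue_on {0<..<1}. - \<psi>2 x + V x *v \<psi> x = z *s \<psi> x"
    and x: "x \<in> {0..1}"
  shows "\<psi> x = phi V z x *v \<psi>1 0"
proof -
  let ?\<phi> = "\<lambda>x. phi V z x *v \<psi>1 0"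
  have "AE t in lebesgue_on {0<..<1}. norm (\<psi>2 t - (V t - mat z) *v ?\<phi> t) \<le> norm (V t - mat z) * norm (\<psi> t - ?\<phi> t)"
    using ae
  proof (rule AE_mp[OF _ AE_I2], intro impI)
    fix t assume "- \<psi>2 t + V t *v \<psi> t = z *s \<psi> t"
    then have "\<psi>2 t = (V t - mat z) *v \<psi> t"
      by (simp add: matrix_vector_mult_diff_rdistrib mat_mult_vec algebra_simps)
    then show "norm (\<psi>2 t - (V t - mat z) *v ?\<phi> t) \<le> norm (V t - mat z) * norm (\<psi> t - ?\<phi> t)"
      by (metis matrix_vector_mult_diff_distrib norm_matrix_vector_mult_le)
  qed
  from ode_unique[OF V has_derivs_diff[OF \<psi>(1) phi_vec_has_derivs[OF V]] _ _ this x]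
  have "\<psi> x - ?\<phi> x = 0"
    using \<psi>(2) phi_0[OF V] phi_deriv_0[OF V] by simp
  then show ?thesis by simp
qed

text \<open>
  The derivative at \<open>0\<close> recovers \<open>h\<close>.
\<close>

lemma phi_vec_eq_0_imp:
  assumes V: "V absolutely_integrable_on {0..1}"
    and 0: "\<And>x. x \<in> {0..1} \<Longrightarrow> phi V z x *v h = 0"
  shows "h = 0"
proof -
  have "((\<lambda>x. phi V z x *v h) has_vector_derivative phi_deriv V z 0 *v h) (at 0 within {0..1})"
    by (rule has_derivsD(1)[OF phi_vec_has_derivs[OF V]]) auto
  then have "((\<lambda>x. 0) has_vector_derivative phi_deriv V z 0 *v h) (at 0 within {0..1})"
    by (rule has_vector_derivative_transform[rotated 2]) (use 0 in auto)
  moreover have "((\<lambda>x. 0) has_vector_derivative 0) (at (0::real) within {0..1})"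
    by simp
  ultimately have "phi_deriv V z 0 *v h = 0"
    by (rule vector_derivative_unique_within[rotated]) (auto simp: trivial_limit_within islimpt_Icc)
  then show ?thesis using phi_deriv_0[OF V] by simp
qed

lemma continuous_in_L2:
  fixes f :: "real \<Rightarrow> complex^'n"
  assumes f: "continuous_on {0..1} f"
  shows "f \<in> L2"
proof -
  have "f \<in> borel_measurable (lebesgue_on {0<..<1})"
    by (rule continuous_imp_measurable_on_sets_lebesgue[OF continuous_on_subset[OF f]]) auto
  moreover have "(\<lambda>x. (norm (f x))\<^sup>2) absolutely_integrable_on {0..1}"
    by (intro absolutely_integrable_continuous_real continuous_intros f)
  then have "(\<lambda>x. (norm (f x))\<^sup>2) absolutely_integrable_on {0<..<1}"
    using absolutely_integrable_on_open_interval[of 0 "1::real" "\<lambda>x. (norm (f x))\<^sup>2"] by simp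
  then have "integrable (lebesgue_on {0<..<1}) (\<lambda>x. (norm (f x))\<^sup>2)"
    by (subst integrable_restrict_space) (auto simp: set_integrable_def)
  ultimately show ?thesis by (simp add: L2_def)
qed

text \<open>
  An eigenfunction is determined by its derivative at \<open>0\<close>, and the boundary condition at \<open>1\<close> puts that
  derivative into the kernel of \<open>\<phi>(1, l)\<close>.
\<close>

lemma eigenvalues_eq:
  assumes V: "V absolutely_integrable_on {0..1}"
  shows "eigenvalues V = {l. \<exists>h. h \<noteq> 0 \<and> phi V (of_real l) 1 *v h = 0}"
proof (intro set_eqI iffI)
  fix l assume "l \<in> eigenvalues V"
  then obtain \<psi> \<psi>1 \<psi>2 where \<psi>: "\<psi> \<noteq> 0" "\<forall>x. x \<notin> {0..1} \<longrightarrow> \<psi> x = 0" "\<psi> 0 = 0" "\<psi> 1 = 0"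
    "has_derivs \<psi> \<psi>1 \<psi>2" "AE x in lebesgue_on {0<..<1}. - \<psi>2 x + V x *v \<psi> x = of_real l *s \<psi> x"
    unfolding eigenvalues_def eigenspace_def H_graph_def by blast
  have eq: "\<psi> x = phi V (of_real l) x *v \<psi>1 0" if "x \<in> {0..1}" for x
    by (rule vector_solution_eq_phi[OF V \<psi>(5,3,6) that])
  have "\<psi>1 0 \<noteq> 0"
  proof
    assume "\<psi>1 0 = 0"
    then have "\<psi> x = 0" for x
      using eq[of x] \<psi>(2) by (cases "x \<in> {0..1}") auto
    then show False using \<psi>(1) by (auto simp: fun_eq_iff)
  qed
  then show "l \<in> {l. \<exists>h. h \<noteq> 0 \<and> phi V (of_real l) 1 *v h = 0}"
    using eq[of 1] \<psi>(4) by auto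
next
  fix l assume "l \<in> {l. \<exists>h. h \<noteq> 0 \<and> phi V (of_real l) 1 *v h = 0}"
  then obtain h where h: "h \<noteq> 0" "phi V (of_real l) 1 *v h = 0" by blast
  let ?\<psi> = "\<lambda>x. phi V (of_real l) x *v h"
  have c: "continuous_on {0..1} ?\<psi>"
    by (rule has_derivsD(4)[OF phi_vec_has_derivs[OF V]])
  have c': "continuous_on {0..1} (\<lambda>x. of_real l *s ?\<psi> x)"
    by (subst mat_mult_vec[symmetric]) (intro bounded_linear.continuous_on[OF _ c] matrix_vector_mul_bounded_linear)
  have "H_graph V ?\<psi> (\<lambda>x. of_real l *s ?\<psi> x)"
    unfolding H_graph_def
    using phi_outside[OF V] phi_0[OF V] h(2) phi_vec_has_derivs[OF V, of "of_real l" h]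
    by (intro conjI exI[of _ "\<lambda>x. phi_deriv V (of_real l) x *v h"] exI[of _ "\<lambda>x. (V x - mat (of_real l)) *v (phi V (of_real l) x *v h)"]
        continuous_in_L2 c c' AE_unit_intervalI)
      (auto simp: matrix_vector_mult_diff_rdistrib mat_mult_vec)
  moreover have "?\<psi> \<noteq> 0"
    using phi_vec_eq_0_imp[OF V, of "of_real l" h] h(1) by (auto simp: fun_eq_iff)
  ultimately show "l \<in> eigenvalues V"
    unfolding eigenvalues_def eigenspace_def by blast
qed

lemma hermitian_potentialD:
  assumes "hermitian_potential V"
  shows "V absolutely_integrable_on {0..1}"
    "AE x in lebesgue_on {0<..<1}. adj (V x) = V x"
  using assms absolutely_integrable_on_open_interval[of 0 "1::real" V]
  by (auto simp: hermitian_potential_def)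

text \<open>
  Lagrange's identity. Integrating the Wronskian of two solutions by parts, the terms with \<open>V\<close> cancel
  because \<open>V\<close> is Hermitian almost everywhere, and only the difference of the spectral parameters is
  left.
\<close>

lemma wronskian_identity:
  assumes V: "hermitian_potential V"
  shows "((\<lambda>t. (cnj \<mu> - z) * cinner (phi V z t *v u) (phi V \<mu> t *v h)) has_integral
      (cinner (phi_deriv V z 1 *v u) (phi V \<mu> 1 *v h) - cinner (phi V z 1 *v u) (phi_deriv V \<mu> 1 *v h))) {0..1}"
proof -
  note Va = hermitian_potentialD(1)[OF V]
  obtain N where N: "negligible N" "\<And>t. t \<in> {0..1} - N \<Longrightarrow> adj (V t) = V t"
    using AE_unit_intervalD[OF hermitian_potentialD(2)[OF V]] by blast
  let ?f = "\<lambda>t. phi V z t *v u" and ?f1 = "\<lambda>t. phi_deriv V z t *v u" and ?f2 = "\<lambda>t. (V t - mat z) *v (phi V z t *v u)"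
  let ?p = "\<lambda>t. phi V \<mu> t *v h" and ?p1 = "\<lambda>t. phi_deriv V \<mu> t *v h" and ?p2 = "\<lambda>t. (V t - mat \<mu>) *v (phi V \<mu> t *v h)"
  note f = phi_vec_has_derivs[OF Va, of z u] and p = phi_vec_has_derivs[OF Va, of \<mu> h]
  have "((\<lambda>t. cinner (?f2 t) (?p t) + cinner (?f1 t) (?p1 t)) has_integral
      (cinner (?f1 1) (?p 1) - cinner (?f1 0) (?p 0))) {0..1}"
    by (rule integration_by_parts_indefinite[OF cinner.bounded_bilinear_axioms])
      (use has_derivsD(2,3)[OF f] has_derivsD(1,5)[OF p] in simp_all)
  moreover have "((\<lambda>t. cinner (?f t) (?p2 t) + cinner (?f1 t) (?p1 t)) has_integral
      (cinner (?f 1) (?p1 1) - cinner (?f 0) (?p1 0))) {0..1}"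
    by (rule integration_by_parts_indefinite[OF bounded_bilinear.flip[OF cinner.bounded_bilinear_axioms]])
      (use has_derivsD(2,3)[OF p] has_derivsD(1,5)[OF f] in simp_all)
  ultimately have "((\<lambda>t. (cinner (?f2 t) (?p t) + cinner (?f1 t) (?p1 t)) - (cinner (?f t) (?p2 t) + cinner (?f1 t) (?p1 t))) has_integral
      ((cinner (?f1 1) (?p 1) - cinner (?f1 0) (?p 0)) - (cinner (?f 1) (?p1 1) - cinner (?f 0) (?p1 0)))) {0..1}"
    by (rule has_integral_diff)
  then have "((\<lambda>t. (cinner (?f2 t) (?p t) + cinner (?f1 t) (?p1 t)) - (cinner (?f t) (?p2 t) + cinner (?f1 t) (?p1 t))) has_integral
      (cinner (?f1 1) (?p 1) - cinner (?f 1) (?p1 1))) {0..1}"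
    by (simp add: phi_0[OF Va] cinner.zero_left cinner.zero_right)
  then show ?thesis
  proof (rule has_integral_spike[OF N(1), rotated])
    fix t assume t: "t \<in> {0..1} - N"
    have "cinner (V t *v ?f t) (?p t) = cinner (?f t) (V t *v ?p t)"
      using cinner_mult_left[of "V t" "?f t" "?p t"] N(2)[OF t] by simp
    then show "(cnj \<mu> - z) * cinner (?f t) (?p t) =
        (cinner (?f2 t) (?p t) + cinner (?f1 t) (?p1 t)) - (cinner (?f t) (?p2 t) + cinner (?f1 t) (?p1 t))"
      by (simp add: matrix_vector_mult_diff_rdistrib mat_mult_vec cinner.diff_left cinner.diff_right
          cinner_smult_left cinner_smult_right algebra_simps)
  qed
qed

section \<open>Dependence on the spectral parameter\<close>

text \<open>
  The constant is uniform for spectral parameters in a disc; this is what allows differentiation with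
  respect to the parameter.
\<close>

lemma volterra_bound:
  fixes V :: "real \<Rightarrow> complex^'n^'n"
  assumes V: "V absolutely_integrable_on {0..1}"
  obtains C where "C > 0" "\<And>w (y :: real \<Rightarrow> complex^'n^'n) g G x. norm w \<le> r \<Longrightarrow> continuous_on {0..1} y \<Longrightarrow>
    (\<And>x. x \<in> {0..1} \<Longrightarrow> y x = g x + double_integral (\<lambda>t. (V t - mat w) ** y t) x) \<Longrightarrow>
    (\<And>x. x \<in> {0..1} \<Longrightarrow> norm (g x) \<le> G) \<Longrightarrow> x \<in> {0..1} \<Longrightarrow> norm (y x) \<le> C * G"
proof -
  define m where "m = norm (mat 1 :: complex^'n^'n)"
  define u where "u t = norm (V t) + \<bar>r\<bar> * m" for t
  have u: "u integrable_on {0..1}"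
    unfolding u_def using V by (intro integrable_add) (auto simp: absolutely_integrable_on_def)
  have u0: "u t \<ge> 0" for t by (simp add: u_def m_def)
  define I where "I = integral {0..1} u"
  have I0: "I \<ge> 0" unfolding I_def by (intro integral_nonneg u u0)
  define \<kappa> where "\<kappa> = 2 * I + 1"
  have \<kappa>: "\<kappa> > 0" using I0 by (simp add: \<kappa>_def)
  show thesis
  proof (rule that[of "2 * exp \<kappa>"])
    fix w :: complex and y g :: "real \<Rightarrow> complex^'n^'n" and G x :: real
    assume w: "norm w \<le> r" and y: "continuous_on {0..1} y"
      and eq: "\<And>x. x \<in> {0..1} \<Longrightarrow> y x = g x + double_integral (\<lambda>t. (V t - mat w) ** y t) x"
      and G: "\<And>x. x \<in> {0..1} \<Longrightarrow> norm (g x) \<le> G" and x: "x \<in> {0..1}"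
    have G0: "G \<ge> 0" by (rule order_trans[OF norm_ge_zero G[of 0]]) simp
    have Vu: "norm (V t - mat w) \<le> u t" for t
    proof -
      have "norm (mat w :: complex^'n^'n) = norm w * m"
        using norm_mat_matrix_mult[of w "mat 1"] by (simp add: m_def)
      also have "\<dots> \<le> \<bar>r\<bar> * m"
        using w by (intro mult_right_mono) (auto simp: m_def)
      finally show ?thesis
        unfolding u_def by (rule order_trans[OF norm_triangle_ineq4 add_left_mono])
    qed
    have "norm (y x) \<le> 2 * G * exp (\<kappa> * x)"
    proof (rule weighted_bound_absorb[OF y _ x])
      fix M x :: real
      assume M: "0 \<le> M" and le: "\<And>t. t \<in> {0..1} \<Longrightarrow> norm (y t) \<le> M * exp (\<kappa> * t)" and x: "x \<in> {0..1}"
      have 1: "norm (double_integral (\<lambda>t. (V t - mat w) ** y t) x) \<le> M / 2 * exp (\<kappa> * x)"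
      proof (rule norm_double_integral_le[OF potential_mult_integrable[OF V y] u])
        fix t :: real assume t: "t \<in> {0..1}"
        show "norm ((V t - mat w) ** y t) \<le> u t * (M * exp (\<kappa> * t))"
          by (rule order_trans[OF norm_matrix_mult_le mult_mono[OF Vu le[OF t] u0 norm_ge_zero]])
      qed (use M \<kappa> x u0 in \<open>auto simp: \<kappa>_def I_def\<close>)
      have "norm (g x) * 1 \<le> G * exp (\<kappa> * x)"
        using G[OF x] G0 x \<kappa> by (intro mult_mono) auto
      then have "norm (y x) \<le> G * exp (\<kappa> * x) + M / 2 * exp (\<kappa> * x)"
        unfolding eq[OF x] using norm_triangle_mono[OF _ 1] by simp
      then show "norm (y x) \<le> (G + M / 2) * exp (\<kappa> * x)"
        by (simp add: algebra_simps)
    qed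
    also have "\<dots> \<le> 2 * G * exp \<kappa>"
      using G0 x \<kappa> by (intro mult_left_mono) (auto simp: mult_left_le)
    finally show "norm (y x) \<le> 2 * exp \<kappa> * G" by (simp add: mult_ac)
  qed simp
qed

lemma norm_double_integral_le_const:
  fixes f :: "real \<Rightarrow> 'b::euclidean_space"
  assumes "continuous_on {0..1} f" "\<And>t. t \<in> {0..1} \<Longrightarrow> norm (f t) \<le> M" "x \<in> {0..1}"
  shows "norm (double_integral f x) \<le> exp 2 * M"
proof -
  have M: "M \<ge> 0" by (rule order_trans[OF norm_ge_zero assms(2)[of 0]]) simp
  have "norm (double_integral f x) \<le> M / 2 * exp (2 * x)"
  proof (rule norm_double_integral_le[where u = "\<lambda>_. 1"])
    fix t :: real assume "t \<in> {0..1}"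
    then have "norm (f t) * 1 \<le> M * exp (2 * t)"
      using assms(2) M by (intro mult_mono) auto
    then show "norm (f t) \<le> 1 * (M * exp (2 * t))" by simp
  qed (use assms M in \<open>auto intro!: absolutely_integrable_continuous_real\<close>)
  also have "\<dots> \<le> M * exp 2"
    using assms(3) M by (intro mult_mono) auto
  finally show ?thesis by (simp add: mult.commute)
qed

text \<open>
  The difference \<open>\<phi>(\<cdot>, z) - \<phi>(\<cdot>, w)\<close> solves the equation at \<open>w\<close> with an inhomogeneity of order
  \<open>z - w\<close>. Subtracting \<open>(z - w) y\<close>, where \<open>y\<close> solves the equation differentiated formally with respect
  to the parameter, leaves an inhomogeneity of order \<open>(z - w)\<^sup>2\<close>. Both estimates are then instances of
  the bound for Volterra equations.
\<close>

lemma phi_Lipschitz_and_derivative: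
  fixes V :: "real \<Rightarrow> complex^'n^'n"
  assumes V: "V absolutely_integrable_on {0..1}"
  obtains C Y where "C > 0"
    "\<And>z x. norm (z - w) \<le> 1 \<Longrightarrow> x \<in> {0..1} \<Longrightarrow> norm (phi V z x - phi V w x) \<le> C * norm (z - w)"
    "\<And>z. norm (z - w) \<le> 1 \<Longrightarrow> norm (phi V z 1 - phi V w 1 - mat (z - w) ** Y) \<le> C * (norm (z - w))\<^sup>2"
proof -
  let ?\<phi> = "phi V"
  note c\<phi> = continuous_on_phi[OF V]
  obtain C where C: "C > 0" "\<And>v (y :: real \<Rightarrow> complex^'n^'n) g G x. norm v \<le> norm w + 1 \<Longrightarrow> continuous_on {0..1} y \<Longrightarrow>
    (\<And>x. x \<in> {0..1} \<Longrightarrow> y x = g x + double_integral (\<lambda>t. (V t - mat v) ** y t) x) \<Longrightarrow>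
    (\<And>x. x \<in> {0..1} \<Longrightarrow> norm (g x) \<le> G) \<Longrightarrow> x \<in> {0..1} \<Longrightarrow> norm (y x) \<le> C * G"
    using volterra_bound[OF V] by blast
  define m where "m = norm (mat 1 :: complex^'n^'n)"
  have m0: "m \<ge> 0" by (simp add: m_def)
  have cmat: "continuous_on {0..1} (\<lambda>t. mat c ** y t)" if "continuous_on {0..1} y" for c and y :: "real \<Rightarrow> complex^'n^'n"
    by (rule bounded_linear.continuous_on[OF mat_mat.bounded_linear_right that])
  have ai: "y absolutely_integrable_on {0..1}" if "continuous_on {0..1} y" for y :: "real \<Rightarrow> complex^'n^'n"
    by (rule absolutely_integrable_continuous_real[OF that])
  have bd: "norm (?\<phi> z x) \<le> C * m" if z: "norm (z - w) \<le> 1" and x: "x \<in> {0..1}" for z x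
  proof (rule C(2)[of z "?\<phi> z" "\<lambda>x. x *\<^sub>R mat 1"])
    show "norm z \<le> norm w + 1"
      using norm_triangle_sub[of z w] z by simp
    show "?\<phi> z x = x *\<^sub>R mat 1 + double_integral (\<lambda>t. (V t - mat z) ** ?\<phi> z t) x" if "x \<in> {0..1}" for x
      by (rule phi_eq_double_integral[OF V that])
    show "norm (x *\<^sub>R mat 1 :: complex^'n^'n) \<le> m" if "x \<in> {0..1}" for x
      using that m0 by (simp add: m_def[symmetric] mult_left_le_one_le)
  qed (use c\<phi> x in auto)
  have key: "norm (E x) \<le> C * (exp 2 * F)"
    if E: "continuous_on {0..1} E" and f: "continuous_on {0..1} f" and F: "\<And>t. t \<in> {0..1} \<Longrightarrow> norm (f t) \<le> F"
      and eq: "\<And>x. x \<in> {0..1} \<Longrightarrow> E x = double_integral f x + double_integral (\<lambda>t. (V t - mat w) ** E t) x"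
      and x: "x \<in> {0..1}" for E f :: "real \<Rightarrow> complex^'n^'n" and F x
  proof (rule C(2)[of w E "double_integral f"])
    show "norm (double_integral f x) \<le> exp 2 * F" if "x \<in> {0..1}" for x
      by (rule norm_double_integral_le_const[OF f F that])
  qed (use E eq x in auto)
  \<comment> \<open>The term with \<open>mat (w - z)\<close> comes from rewriting \<open>V - z\<close> as \<open>(V - w) + (w - z)\<close>.\<close>
  have diff_eq: "?\<phi> z x - ?\<phi> w x = double_integral (\<lambda>t. mat (w - z) ** ?\<phi> z t) x
      + double_integral (\<lambda>t. (V t - mat w) ** (?\<phi> z t - ?\<phi> w t)) x" if x: "x \<in> {0..1}" for z x
  proof -
    have "?\<phi> z x - ?\<phi> w x = double_integral (\<lambda>t. (V t - mat z) ** ?\<phi> z t - (V t - mat w) ** ?\<phi> w t) x"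
      by (simp add: phi_eq_double_integral[OF V x] double_integral_diff[OF potential_mult_integrable[OF V c\<phi>] potential_mult_integrable[OF V c\<phi>] x])
    also have "\<dots> = double_integral (\<lambda>t. mat (w - z) ** ?\<phi> z t + (V t - mat w) ** (?\<phi> z t - ?\<phi> w t)) x"
    proof (rule double_integral_cong[OF _ x])
      fix t
      have "mat (w - z) = mat w - (mat z :: complex^'n^'n)"
        by (simp add: mat_def vec_eq_iff)
      then show "(V t - mat z) ** ?\<phi> z t - (V t - mat w) ** ?\<phi> w t = mat (w - z) ** ?\<phi> z t + (V t - mat w) ** (?\<phi> z t - ?\<phi> w t)"
        by (simp add: mat_mat.diff_left mat_mat.diff_right)
    qed
    also have "\<dots> = double_integral (\<lambda>t. mat (w - z) ** ?\<phi> z t) x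
      + double_integral (\<lambda>t. (V t - mat w) ** (?\<phi> z t - ?\<phi> w t)) x"
      by (intro double_integral_add[OF ai potential_mult_integrable[OF V] x] cmat c\<phi> continuous_on_diff)
    finally show ?thesis .
  qed
  have lip: "norm (?\<phi> z x - ?\<phi> w x) \<le> C * (exp 2 * (norm (z - w) * (C * m)))"
    if z: "norm (z - w) \<le> 1" and x: "x \<in> {0..1}" for z x
  proof (rule key[where E = "\<lambda>x. ?\<phi> z x - ?\<phi> w x" and f = "\<lambda>t. mat (w - z) ** ?\<phi> z t"])
    show "norm (mat (w - z) ** ?\<phi> z t) \<le> norm (z - w) * (C * m)" if "t \<in> {0..1}" for t
      using bd[OF z that] by (simp add: norm_mat_matrix_mult norm_minus_commute mult_left_mono)
  qed (use x in \<open>auto intro: continuous_on_diff c\<phi> cmat diff_eq\<close>)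
  have cg: "continuous_on {0..1} (double_integral (\<lambda>t. mat (- 1) ** ?\<phi> w t))"
    by (intro continuous_on_double_integral ai cmat c\<phi>)
  \<comment> \<open>The derivative with respect to the parameter solves \<open>y'' = (V - w) y - \<phi>(\<cdot>, w)\<close>.\<close>
  obtain y where y: "continuous_on {0..1} y"
    "\<And>x. x \<in> {0..1} \<Longrightarrow> y x = double_integral (\<lambda>t. mat (- 1) ** ?\<phi> w t) x + double_integral (\<lambda>t. (V t - mat w) ** y t) x"
    using volterra_solution_exists[OF potential_minus_spectral_integrable[OF V] cg] by blast
  have scale: "double_integral (\<lambda>t. mat c ** f t) x = mat c ** double_integral f x"
    if f: "f absolutely_integrable_on {0..1}" and x: "x \<in> {0..1}" for c and f :: "real \<Rightarrow> complex^'n^'n" and x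
  proof -
    have bl: "bounded_linear (\<lambda>A :: complex^'n^'n. mat c ** A)"
      by (rule mat_mat.bounded_linear_right)
    have "double_integral (\<lambda>t. mat c ** f t) x = integral {0..x} (\<lambda>s. mat c ** integral {0..s} f)"
      unfolding double_integral_def
    proof (rule integral_cong)
      fix s assume "s \<in> {0..x}"
      then have "f integrable_on {0..s}"
        using integrable_on_subinterval[of f "{0..1}" 0 s] f x by (auto simp: absolutely_integrable_on_def)
      from integral_linear[OF this bl] show "integral {0..s} (\<lambda>t. mat c ** f t) = mat c ** integral {0..s} f"
        by (simp add: o_def)
    qed
    also have "\<dots> = mat c ** double_integral f x"
    proof -
      have "(\<lambda>s. integral {0..s} f) integrable_on {0..x}"
        using continuous_on_subset[OF continuous_on_indefinite_integral[OF f], of "{0..x}"] x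
        by (intro integrable_continuous_real) auto
      from integral_linear[OF this bl] show ?thesis
        by (simp add: o_def double_integral_def)
    qed
    finally show ?thesis .
  qed
  have quad: "norm (?\<phi> z 1 - ?\<phi> w 1 - mat (z - w) ** y 1) \<le> C * (exp 2 * (norm (z - w) * (C * (exp 2 * (norm (z - w) * (C * m))))))"
    if z: "norm (z - w) \<le> 1" for z
  proof (rule key[where E = "\<lambda>x. ?\<phi> z x - ?\<phi> w x - mat (z - w) ** y x" and f = "\<lambda>t. mat (w - z) ** (?\<phi> z t - ?\<phi> w t)"])
    show "continuous_on {0..1} (\<lambda>x. ?\<phi> z x - ?\<phi> w x - mat (z - w) ** y x)"
      "continuous_on {0..1} (\<lambda>t. mat (w - z) ** (?\<phi> z t - ?\<phi> w t))"
      by (intro continuous_on_diff c\<phi> cmat y)+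
    show "norm (mat (w - z) ** (?\<phi> z t - ?\<phi> w t)) \<le> norm (z - w) * (C * (exp 2 * (norm (z - w) * (C * m))))"
      if "t \<in> {0..1}" for t
      using lip[OF z that] by (simp add: norm_mat_matrix_mult norm_minus_commute mult_left_mono)
  next
    fix x :: real assume x: "x \<in> {0..1}"
    let ?U = "\<lambda>t. V t - mat w"
    have "mat (z - w) ** y x = double_integral (\<lambda>t. mat (z - w) ** (mat (-1) ** ?\<phi> w t)) x
        + double_integral (\<lambda>t. mat (z - w) ** (?U t ** y t)) x"
      by (simp add: y(2)[OF x] matrix_add_ldistrib scale[OF _ x] ai cmat c\<phi> potential_mult_integrable[OF V y(1)])
    also have "(\<lambda>t. mat (z - w) ** (mat (-1) ** ?\<phi> w t)) = (\<lambda>t. mat (w - z) ** ?\<phi> w t)"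
      by (simp add: fun_eq_iff vec_eq_iff mat_matrix_mult_nth algebra_simps)
    also have "(\<lambda>t. mat (z - w) ** (?U t ** y t)) = (\<lambda>t. ?U t ** (mat (z - w) ** y t))"
      by (simp only: mat_mult_left_commute)
    finally have e: "mat (z - w) ** y x = double_integral (\<lambda>t. mat (w - z) ** ?\<phi> w t) x
        + double_integral (\<lambda>t. ?U t ** (mat (z - w) ** y t)) x" .
    have d1: "double_integral (\<lambda>t. mat (w - z) ** (?\<phi> z t - ?\<phi> w t)) x =
      double_integral (\<lambda>t. mat (w - z) ** ?\<phi> z t) x - double_integral (\<lambda>t. mat (w - z) ** ?\<phi> w t) x"
      unfolding mat_mat.diff_right by (intro double_integral_diff ai cmat c\<phi> x)
    have d2: "double_integral (\<lambda>t. ?U t ** ((?\<phi> z t - ?\<phi> w t) - mat (z - w) ** y t)) x =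
      double_integral (\<lambda>t. ?U t ** (?\<phi> z t - ?\<phi> w t)) x - double_integral (\<lambda>t. ?U t ** (mat (z - w) ** y t)) x"
      unfolding mat_mat.diff_right[of _ "?\<phi> z _ - ?\<phi> w _"]
      by (intro double_integral_diff potential_mult_integrable[OF V] cmat c\<phi> y x continuous_on_diff)
    show "?\<phi> z x - ?\<phi> w x - mat (z - w) ** y x =
        double_integral (\<lambda>t. mat (w - z) ** (?\<phi> z t - ?\<phi> w t)) x +
        double_integral (\<lambda>t. ?U t ** (?\<phi> z t - ?\<phi> w t - mat (z - w) ** y t)) x"
      unfolding d1 d2 diff_eq[OF x] e by (simp add: algebra_simps)
  qed simp
  define K where "K = C * exp 2 * (C * m) + C * exp 2 * (C * exp 2 * (C * m)) + 1"
  show thesis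
  proof (rule that[of K "y 1"])
    show "K > 0" using C(1) m0 by (auto simp: K_def intro!: add_nonneg_pos add_nonneg_nonneg)
    fix z assume z: "norm (z - w) \<le> 1"
    show "norm (?\<phi> z x - ?\<phi> w x) \<le> K * norm (z - w)" if "x \<in> {0..1}" for x
    proof -
      have "C * (exp 2 * (norm (z - w) * (C * m))) = (C * exp 2 * (C * m)) * norm (z - w)" by simp
      also have "\<dots> \<le> K * norm (z - w)"
        using C(1) m0 by (intro mult_right_mono) (auto simp: K_def)
      finally show ?thesis using lip[OF z that] by simp
    qed
    have "C * (exp 2 * (norm (z - w) * (C * (exp 2 * (norm (z - w) * (C * m))))))
        = C * exp 2 * (C * exp 2 * (C * m)) * (norm (z - w))\<^sup>2" by (simp add: power2_eq_square)
    also have "\<dots> \<le> K * (norm (z - w))\<^sup>2"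
      using C(1) m0 by (intro mult_right_mono) (auto simp: K_def)
    finally show "norm (?\<phi> z 1 - ?\<phi> w 1 - mat (z - w) ** y 1) \<le> K * (norm (z - w))\<^sup>2"
      using quad[OF z] by simp
  qed
qed

definition entire_matrix :: "(complex \<Rightarrow> complex^'n^'n) \<Rightarrow> bool" where
  "entire_matrix A \<longleftrightarrow> (\<forall>i j. (\<lambda>z. A z $ i $ j) holomorphic_on UNIV)"

definition matrix_deriv :: "(complex \<Rightarrow> complex^'n^'n) \<Rightarrow> complex \<Rightarrow> complex^'n^'n" where
  "matrix_deriv A z = (\<chi> i j. deriv (\<lambda>w. A w $ i $ j) z)"

lemma entire_matrix_phi:
  fixes V :: "real \<Rightarrow> complex^'n^'n"
  assumes V: "V absolutely_integrable_on {0..1}"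
  shows "entire_matrix (\<lambda>z. phi V z 1)"
  unfolding entire_matrix_def
proof (intro allI)
  fix i j :: 'n
  have "(\<lambda>z. phi V z 1 $ i $ j) field_differentiable at w" for w
  proof -
    obtain C Y where C: "C > 0"
      "\<And>z. norm (z - w) \<le> 1 \<Longrightarrow> norm (phi V z 1 - phi V w 1 - mat (z - w) ** Y) \<le> C * (norm (z - w))\<^sup>2"
      using phi_Lipschitz_and_derivative[OF V, of w] by metis
    have "((\<lambda>z. phi V z 1 $ i $ j) has_derivative (\<lambda>h. Y $ i $ j * h)) (at w)"
      unfolding has_derivative_at_alt
    proof (intro conjI allI impI bounded_linear_mult_right)
      fix e :: real assume e: "e > 0"
      have "norm (phi V z 1 $ i $ j - phi V w 1 $ i $ j - Y $ i $ j * (z - w)) \<le> e * norm (z - w)"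
        if z: "norm (z - w) < min 1 (e / C)" for z
      proof -
        have "norm ((phi V z 1 - phi V w 1 - mat (z - w) ** Y) $ i $ j) \<le> norm (phi V z 1 - phi V w 1 - mat (z - w) ** Y)"
          by (rule order_trans[OF Finite_Cartesian_Product.norm_nth_le Finite_Cartesian_Product.norm_nth_le])
        also have "\<dots> \<le> C * (norm (z - w))\<^sup>2" using C(2) z by simp
        also have "\<dots> = (C * norm (z - w)) * norm (z - w)" by (simp add: power2_eq_square)
        also have "\<dots> \<le> e * norm (z - w)"
          using z C(1) by (intro mult_right_mono) (auto simp: field_simps)
        finally show ?thesis by (simp add: mat_matrix_mult_nth mult.commute)
      qed
      then show "\<exists>d>0. \<forall>y. norm (y - w) < d \<longrightarrow> norm (phi V y 1 $ i $ j - phi V w 1 $ i $ j - Y $ i $ j * (y - w)) \<le> e * norm (y - w)"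
        using e C(1) by (intro exI[of _ "min 1 (e / C)"]) auto
    qed
    then show ?thesis
      by (auto simp: field_differentiable_def has_field_derivative_def)
  qed
  then show "(\<lambda>z. phi V z 1 $ i $ j) holomorphic_on UNIV"
    by (simp add: holomorphic_on_def)
qed

lemma tendsto_entire_matrix:
  assumes "entire_matrix A"
  shows "(A \<longlongrightarrow> A a) (at a)"
proof (intro vec_tendstoI)
  fix i j
  have "continuous_on UNIV (\<lambda>z. A z $ i $ j)"
    using assms by (intro holomorphic_on_imp_continuous_on) (auto simp: entire_matrix_def)
  then show "((\<lambda>z. A z $ i $ j) \<longlongrightarrow> A a $ i $ j) (at a)"
    by (auto simp: continuous_on_def)
qed

lemma tendsto_matrix_deriv:
  assumes "entire_matrix A"
  shows "((\<lambda>z. mat (1 / (z - a)) ** (A z - A a)) \<longlongrightarrow> matrix_deriv A a) (at a)"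
proof (intro vec_tendstoI)
  fix i j
  have "(\<lambda>z. A z $ i $ j) holomorphic_on UNIV"
    using assms by (auto simp: entire_matrix_def)
  then have "((\<lambda>z. A z $ i $ j) has_field_derivative deriv (\<lambda>z. A z $ i $ j) a) (at a)"
    by (intro holomorphic_derivI) auto
  then show "((\<lambda>z. (mat (1 / (z - a)) ** (A z - A a)) $ i $ j) \<longlongrightarrow> matrix_deriv A a $ i $ j) (at a)"
    by (simp add: has_field_derivative_iff matrix_deriv_def mat_matrix_mult_nth)
qed

lemma cinner_phi_integrable:
  assumes "V absolutely_integrable_on {0..1}"
  shows "continuous_on {0..1} (\<lambda>t. cinner (phi V z t *v u) (phi V w t *v h))"
  by (intro cinner.continuous_on has_derivsD(4)[OF phi_vec_has_derivs[OF assms]])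

text \<open>
  The matrix \<open>S\<^sub>\<alpha>\<close> is the Gram matrix of the columns of \<open>\<phi>\<close> in \<open>L\<^sup>2\<close>.
\<close>

lemma S_mat_cinner:
  fixes V :: "real \<Rightarrow> complex^'n^'n"
  assumes V: "V absolutely_integrable_on {0..1}"
  shows "cinner (integral {0..1} (\<lambda>t. adj (phi V z t) ** phi V z t) *v u) h =
     integral {0..1} (\<lambda>t. cinner (phi V z t *v u) (phi V z t *v h))"
proof -
  have bl: "bounded_linear (\<lambda>A :: complex^'n^'n. cinner (A *v u) h)"
    by (intro bounded_linear_compose[OF cinner.bounded_linear_left]
        mat_vec.bounded_linear_left)
  have "continuous_on {0..1} (\<lambda>t. adj (phi V z t))"
    unfolding adj_def map_matrix_def transpose_def
    using continuous_on_phi[OF V, of z] by (auto intro!: continuous_intros)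
  then have "continuous_on {0..1} (\<lambda>t. adj (phi V z t) ** phi V z t)"
    by (intro mat_mat.continuous_on continuous_on_phi[OF V])
  then have "(\<lambda>t. adj (phi V z t) ** phi V z t) integrable_on {0..1}"
    by (rule integrable_continuous_real)
  from integral_linear[OF this bl] show ?thesis
    by (simp add: o_def cinner_adj_left flip: matrix_vector_mul_assoc)
qed

lemma phi_gram_zero_imp:
  assumes V: "V absolutely_integrable_on {0..1}"
    and 0: "integral {0..1} (\<lambda>t. cinner (phi V z t *v u) (phi V z t *v u)) = 0"
  shows "u = 0"
proof (rule phi_vec_eq_0_imp[OF V])
  let ?f = "\<lambda>t. (norm (phi V z t *v u))\<^sup>2"
  have c: "continuous_on {0..1} ?f"
    by (intro continuous_intros has_derivsD(4)[OF phi_vec_has_derivs[OF V]])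
  then have i: "?f integrable_on {0..1}" by (rule integrable_continuous_real)
  have "complex_of_real (integral {0..1} ?f) = integral {0..1} (\<lambda>t. complex_of_real (?f t))"
    using integral_linear[OF i, of complex_of_real] by (simp only: o_def bounded_linear_of_real)
  then have "integral {0..1} ?f = 0"
    using 0 by (simp add: cinner_self)
  with i have "(?f has_integral 0) {0..1}"
    by (metis integrable_integral)
  then have "?f x = 0" if "x \<in> {0..1}" for x
    using has_integral_0_cbox_imp_0[of 0 1 ?f x] c that by simp
  then show "phi V z x *v u = 0" if "x \<in> {0..1}" for x
    using that by simp
qed

text \<open>
  The boundary terms in Lagrange's identity with both parameters equal to \<open>z\<close> vanish, and
  \<open>cnj z - z \<noteq> 0\<close>: self-adjointness forces the singular points to be real.
\<close>

lemma phi_injective_nonreal: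
  assumes V: "hermitian_potential V" and z: "Im z \<noteq> 0" and h: "phi V z 1 *v h = 0"
  shows "h = 0"
proof -
  note Va = hermitian_potentialD(1)[OF V]
  have ne: "cnj z - z \<noteq> 0" using z by (simp add: complex_eq_iff)
  have "((\<lambda>t. (cnj z - z) * cinner (phi V z t *v h) (phi V z t *v h)) has_integral 0) {0..1}"
    using wronskian_identity[OF V, of z z h h] h by (simp add: cinner.zero_left cinner.zero_right)
  from integral_unique[OF this]
  have "(cnj z - z) * integral {0..1} (\<lambda>t. cinner (phi V z t *v h) (phi V z t *v h)) = 0"
    by (simp only: integral_mult_right)
  then show ?thesis
    using phi_gram_zero_imp[OF Va] ne by simp
qed

text \<open>
  Lagrange's identity with both parameters equal to the real number \<open>a\<close>.
\<close>

lemma phi_range_orthogonal: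
  assumes V: "hermitian_potential V" and a: "a \<in> \<real>" and h: "phi V a 1 *v h = 0"
  shows "cinner (phi V a 1 *v u) (phi_deriv V a 1 *v h) = 0"
proof -
  have "((\<lambda>t. 0) has_integral (- cinner (phi V a 1 *v u) (phi_deriv V a 1 *v h))) {0..1::real}"
    using wronskian_identity[OF V, of a a u h] h a by (simp add: cinner.zero_right Reals_cnj_iff)
  then show ?thesis
    by (metis has_integral_0 has_integral_unique neg_equal_0_iff_equal)
qed

text \<open>
  Lagrange's identity with parameters \<open>z\<close> and \<open>a\<close>, divided by \<open>z - a\<close>, in the limit \<open>z \<rightarrow> a\<close>. This is
  the link between the Gram matrix \<open>S\<^sub>\<alpha>\<close> and the entire function \<open>z \<mapsto> \<phi>(1, z)\<close>.
\<close>

lemma phi_derivative_gram: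
  fixes V :: "real \<Rightarrow> complex^'n^'n"
  assumes V: "hermitian_potential V" and a: "a \<in> \<real>" and h: "phi V a 1 *v h = 0"
  shows "cinner (matrix_deriv (\<lambda>z. phi V z 1) a *v u) (phi_deriv V a 1 *v h)
     = integral {0..1} (\<lambda>t. cinner (phi V a t *v u) (phi V a t *v h))"
proof -
  note Va = hermitian_potentialD(1)[OF V]
  let ?k = "phi_deriv V a 1 *v h"
  define J where "J z = integral {0..1} (\<lambda>t. cinner (phi V z t *v u) (phi V a t *v h))" for z
  have quot: "cinner ((mat (1 / (z - a)) ** (phi V z 1 - phi V a 1)) *v u) ?k = J z" if z: "z \<noteq> a" for z
  proof -
    have "((\<lambda>t. (a - z) * cinner (phi V z t *v u) (phi V a t *v h)) has_integral (- cinner (phi V z 1 *v u) ?k)) {0..1}"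
      using wronskian_identity[OF V, of a z u h] h a by (simp add: cinner.zero_right Reals_cnj_iff)
    from integral_unique[OF this]
    have "(a - z) * J z = - cinner (phi V z 1 *v u) ?k"
      unfolding J_def by (simp only: integral_mult_right)
    then have "cinner (phi V z 1 *v u) ?k = (z - a) * J z"
      by (simp add: algebra_simps)
    then show ?thesis
      using z by (simp add: mat_mult_matrix_vec matrix_vector_mult_diff_rdistrib cinner_smult_left cinner.diff_left phi_range_orthogonal[OF V a h])
  qed
  have lim1: "((\<lambda>z. cinner ((mat (1 / (z - a)) ** (phi V z 1 - phi V a 1)) *v u) ?k) \<longlongrightarrow>
      cinner (matrix_deriv (\<lambda>z. phi V z 1) a *v u) ?k) (at a)"
    by (intro bounded_linear.tendsto[OF cinner.bounded_linear_left]
        bounded_linear.tendsto[OF mat_vec.bounded_linear_left]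
        tendsto_matrix_deriv[OF entire_matrix_phi[OF Va]])
  have lim2: "(J \<longlongrightarrow> J a) (at a)"
  proof -
    obtain C Y where C: "C > 0"
      "\<And>z x. norm (z - a) \<le> 1 \<Longrightarrow> x \<in> {0..1} \<Longrightarrow> norm (phi V z x - phi V a x) \<le> C * norm (z - a)"
      using phi_Lipschitz_and_derivative[OF Va, of a] by metis
    obtain K where K: "\<And>(x::complex^'n) y. norm (cinner x y) \<le> norm x * norm y * K" "K > 0"
      using cinner.pos_bounded by blast
    obtain B where B: "B > 0" "\<And>t. t \<in> {0..1} \<Longrightarrow> norm (phi V a t *v h) \<le> B"
      using compact_imp_bounded[OF compact_continuous_image[OF has_derivsD(4)[OF phi_vec_has_derivs[OF Va]]]]
      by (force simp: bounded_pos)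
    have int: "(\<lambda>t. cinner (phi V z t *v u) (phi V a t *v h)) integrable_on {0..1}" for z
      by (rule integrable_continuous_real[OF cinner_phi_integrable[OF Va]])
    have "norm (J z - J a) \<le> norm (z - a) * (C * norm u * B * K)" if z: "norm (z - a) \<le> 1" for z
    proof -
      have "J z - J a = integral {0..1} (\<lambda>t. cinner ((phi V z t - phi V a t) *v u) (phi V a t *v h))"
        unfolding J_def matrix_vector_mult_diff_rdistrib cinner.diff_left
        by (rule Henstock_Kurzweil_Integration.integral_diff[symmetric, OF int int])
      also have "norm \<dots> \<le> integral {0..1} (\<lambda>t::real. norm (z - a) * (C * norm u * B * K))"
      proof (rule integral_norm_bound_integral)
        show "(\<lambda>t. cinner ((phi V z t - phi V a t) *v u) (phi V a t *v h)) integrable_on {0..1}"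
          unfolding matrix_vector_mult_diff_rdistrib cinner.diff_left
          by (intro Henstock_Kurzweil_Integration.integrable_diff int)
        fix t :: real assume t: "t \<in> {0..1}"
        have "norm (cinner ((phi V z t - phi V a t) *v u) (phi V a t *v h)) \<le>
            norm ((phi V z t - phi V a t) *v u) * norm (phi V a t *v h) * K" by (rule K)
        also have "\<dots> \<le> ((C * norm (z - a)) * norm u) * B * K"
        proof (intro mult_right_mono mult_mono B(2)[OF t])
          show "norm ((phi V z t - phi V a t) *v u) \<le> (C * norm (z - a)) * norm u"
            by (rule order_trans[OF norm_matrix_vector_mult_le mult_right_mono[OF C(2)[OF z t]]]) simp
        qed (use K(2) C(1) in auto)
        finally show "norm (cinner ((phi V z t - phi V a t) *v u) (phi V a t *v h)) \<le> norm (z - a) * (C * norm u * B * K)"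
          by (simp add: mult_ac)
      qed auto
      finally show ?thesis by simp
    qed
    then have "eventually (\<lambda>z. norm (J z - J a) \<le> norm (z - a) * (C * norm u * B * K)) (at a)"
      unfolding eventually_at by (intro exI[of _ 1]) (auto simp: dist_norm)
    moreover have "((\<lambda>z. z - a) \<longlongrightarrow> 0) (at a)"
      by (rule LIM_zero) auto
    ultimately have "((\<lambda>z. J z - J a) \<longlongrightarrow> 0) (at a)"
      by (rule tendsto_0_le[rotated])
    then show ?thesis by (rule LIM_zero_cancel)
  qed
  have "((\<lambda>z. cinner ((mat (1 / (z - a)) ** (phi V z 1 - phi V a 1)) *v u) ?k) \<longlongrightarrow> J a) (at a)"
    by (rule Lim_transform_eventually[OF lim2]) (auto simp: eventually_at_filter quot)
  from LIM_unique[OF lim1 this] show ?thesis by (simp add: J_def)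
qed

lemma norm_sin_squared_exp:
  "4 * (norm (sin w))\<^sup>2 = exp (2 * \<bar>Im w\<bar>) + exp (- (2 * \<bar>Im w\<bar>)) - 2 * cos (2 * Re w)"
  unfolding norm_sin_squared by (cases "Im w \<ge> 0") (auto simp: exp_minus)

lemma exp_le_norm_sin_off_axis:
  assumes "\<bar>Im w\<bar> \<ge> 1"
  shows "exp \<bar>Im w\<bar> \<le> 8 * norm (sin w)"
proof -
  have "(3::real) \<le> exp (2 * 1)"
    using exp_ge_add_one_self[of "2::real"] by simp
  also have "\<dots> \<le> exp (2 * \<bar>Im w\<bar>)" using assms by simp
  finally have "exp (2 * \<bar>Im w\<bar>) \<ge> 3" .
  moreover have "0 < exp (- (2 * \<bar>Im w\<bar>))" by simp
  ultimately have "exp (2 * \<bar>Im w\<bar>) \<le> 64 * (norm (sin w))\<^sup>2"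
    using norm_sin_squared_exp[of w] cos_le_one[of "2 * Re w"] by linarith
  then have "(exp \<bar>Im w\<bar>)\<^sup>2 \<le> (8 * norm (sin w))\<^sup>2"
    by (simp add: power_mult_distrib exp_double)
  then show ?thesis
    by (rule power2_le_imp_le) simp
qed

text \<open>
  Near the real axis the circle passes close to the points \<open>\<plusminus>\<pi> (n + 1/2)\<close>, where the sine has modulus
  one: for \<open>|Im w| < 1\<close> the real part is within \<open>1/4\<close> of such a point.
\<close>

lemma exp_le_norm_sin_on_circle:
  fixes w :: complex and n :: nat
  assumes n: "n \<ge> 1" and w: "norm w = pi * (n + 1 / 2)"
  shows "exp \<bar>Im w\<bar> \<le> 8 * norm (sin w)"
proof (cases "\<bar>Im w\<bar> \<ge> 1")
  case True
  then show ?thesis by (rule exp_le_norm_sin_off_axis)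
next
  case False
  define r where "r = norm w"
  \<comment> \<open>Up to sign, \<open>2 Re w\<close> differs from an odd multiple of \<open>\<pi>\<close> by \<open>2 d\<close>; so its cosine is not positive.\<close>
  define d where "d = r - \<bar>Re w\<bar>"
  have r: "r \<ge> pi * (3/2)" unfolding r_def w using n pi_gt_zero by (intro mult_left_mono) auto
  have r3: "r > 4" using r pi_gt3 by simp
  have d0: "d \<ge> 0" unfolding d_def r_def using abs_Re_le_cmod[of w] by simp
  have "d * r \<le> d * (r + \<bar>Re w\<bar>)" using d0 by (intro mult_left_mono) auto
  also have "\<dots> = r\<^sup>2 - (Re w)\<^sup>2" by (simp add: d_def power2_eq_square algebra_simps abs_mult_self_eq)
  also have "\<dots> = (Im w)\<^sup>2" unfolding r_def by (simp add: cmod_def)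
  also have "\<dots> \<le> 1" using False by (simp add: abs_square_le_1)
  finally have "d * r \<le> 1" .
  moreover have "d * 4 \<le> d * r" using d0 r3 by (intro mult_left_mono) auto
  ultimately have d: "d \<le> 1 / 4" by simp
  have "cos (2 * Re w) = cos (2 * \<bar>Re w\<bar>)"
    by (simp add: abs_real_def)
  also have "2 * \<bar>Re w\<bar> = (pi - 2 * d) + 2 * real n * pi"
    using w by (simp add: d_def r_def algebra_simps)
  also have "cos \<dots> = cos (pi - 2 * d)"
    by (simp add: cos_add[of "pi - 2 * d" "2 * real n * pi"])
  also have "\<dots> = - cos (2 * d)" by (simp add: cos_diff)
  also have "\<dots> \<le> 0"
    using d d0 pi_gt3 by (simp add: cos_ge_zero)
  finally have "cos (2 * Re w) \<le> 0" .
  moreover have "0 < exp (- (2 * \<bar>Im w\<bar>))" by simp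
  ultimately have "exp (2 * \<bar>Im w\<bar>) \<le> 4 * (norm (sin w))\<^sup>2"
    using norm_sin_squared_exp[of w] by linarith
  also have "\<dots> \<le> 64 * (norm (sin w))\<^sup>2" by simp
  finally have "(exp \<bar>Im w\<bar>)\<^sup>2 \<le> (8 * norm (sin w))\<^sup>2"
    by (simp add: power_mult_distrib exp_double)
  then show ?thesis
    by (rule power2_le_imp_le) simp
qed

text \<open>
  The potential is treated as a perturbation of \<open>- d\<^sup>2/dx\<^sup>2 - w\<^sup>2\<close>, whose solution with the same initial
  data is \<open>sin (w x) / w\<close>.
\<close>

lemma phi_variation_of_constants:
  fixes V :: "real \<Rightarrow> complex^'n^'n"
  assumes V: "V absolutely_integrable_on {0..1}" and w: "w \<noteq> 0" and x: "x \<in> {0..1}"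
  shows "((\<lambda>t. mat (sin (w * of_real (x - t)) / w) ** (V t ** phi V (w\<^sup>2) t)) has_integral
     (phi V (w\<^sup>2) x - mat (sin (w * of_real x) / w))) {0..x}"
proof -
  note P = phi_has_derivs[OF V, of "w\<^sup>2"]
  let ?\<phi> = "phi V (w\<^sup>2)" and ?\<phi>1 = "phi_deriv V (w\<^sup>2)" and ?\<phi>2 = "\<lambda>t. (V t - mat (w\<^sup>2)) ** phi V (w\<^sup>2) t"
  let ?s = "\<lambda>t. sin (w * of_real (x - t)) / w" and ?c = "\<lambda>t. cos (w * of_real (x - t))"
  have x0: "0 \<le> x" and sub: "{0..x} \<subseteq> {0..1}" using x by auto
  have ds: "(?s has_vector_derivative - ?c t) (at t within T)" for t T
  proof (rule has_vector_derivative_at_within)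
    have "((\<lambda>z. sin (w * (of_real x - z)) / w) has_field_derivative - ?c t) (at (of_real t))"
      using w by (auto intro!: derivative_eq_intros simp: field_simps)
    from has_vector_derivative_real_field[OF this] show "(?s has_vector_derivative - ?c t) (at t)"
      by simp
  qed
  have dc: "(?c has_vector_derivative w\<^sup>2 * ?s t) (at t within T)" for t T
  proof (rule has_vector_derivative_at_within)
    have "((\<lambda>z. cos (w * (of_real x - z))) has_field_derivative w\<^sup>2 * ?s t) (at (of_real t))"
      using w by (auto intro!: derivative_eq_intros simp: field_simps power2_eq_square)
    from has_vector_derivative_real_field[OF this] show "(?c has_vector_derivative w\<^sup>2 * ?s t) (at t)"
      by simp
  qed
  \<comment> \<open>The two integrands add up to the derivative of
    \<open>cos (w (x - t)) \<phi> + w\<^sup>-\<^sup>1 sin (w (x - t)) \<phi>'\<close>, in which only the term with \<open>V\<close> remains.\<close>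
  have i1: "((\<lambda>t. mat (?s t) ** ?\<phi>2 t + mat (- ?c t) ** ?\<phi>1 t) has_integral
      (mat (?s x) ** ?\<phi>1 x - mat (?s 0) ** ?\<phi>1 0)) {0..x}"
  proof (rule integration_by_parts_indefinite[OF mat_scale.bounded_bilinear_axioms x0])
    show "?\<phi>2 absolutely_integrable_on {0..x}"
      by (rule set_integrable_subset[OF has_derivsD(2)[OF P] _ sub]) auto
    show "(?\<phi>2 has_integral ?\<phi>1 t - ?\<phi>1 0) {0..t}" if "t \<in> {0..x}" for t
      by (rule has_derivsD(3)[OF P]) (use that x in auto)
    show "continuous_on {0..x} (\<lambda>t. - ?c t)"
      by (intro continuous_intros)
  qed (rule ds)
  have i2: "((\<lambda>t. mat (w\<^sup>2 * ?s t) ** ?\<phi> t + mat (?c t) ** ?\<phi>1 t) has_integral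
      (mat (?c x) ** ?\<phi> x - mat (?c 0) ** ?\<phi> 0)) {0..x}"
  proof (rule fundamental_theorem_of_calculus[OF x0])
    fix t assume t: "t \<in> {0..x}"
    have d: "(?\<phi> has_vector_derivative ?\<phi>1 t) (at t within {0..x})"
      by (rule has_vector_derivative_within_subset[OF has_derivsD(1)[OF P] sub]) (use t x in auto)
    have "((\<lambda>t. mat (?c t) ** ?\<phi> t) has_vector_derivative (mat (?c t) ** ?\<phi>1 t + mat (w\<^sup>2 * ?s t) ** ?\<phi> t)) (at t within {0..x})"
      using mat_scale.has_vector_derivative[OF d dc] by (simp add: add.commute)
    then show "((\<lambda>t. mat (?c t) ** ?\<phi> t) has_vector_derivative (mat (w\<^sup>2 * ?s t) ** ?\<phi> t + mat (?c t) ** ?\<phi>1 t)) (at t within {0..x})"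
      by (simp add: add.commute)
  qed
  have z: "mat 0 = (0 :: complex^'n^'n)" by (simp add: mat_def vec_eq_iff)
  have "((\<lambda>t. (mat (?s t) ** ?\<phi>2 t + mat (- ?c t) ** ?\<phi>1 t) + (mat (w\<^sup>2 * ?s t) ** ?\<phi> t + mat (?c t) ** ?\<phi>1 t)) has_integral
      (mat (?s x) ** ?\<phi>1 x - mat (?s 0) ** ?\<phi>1 0) + (mat (?c x) ** ?\<phi> x - mat (?c 0) ** ?\<phi> 0)) {0..x}"
    by (rule has_integral_add[OF i1 i2])
  also have "(mat (?s x) ** ?\<phi>1 x - mat (?s 0) ** ?\<phi>1 0) + (mat (?c x) ** ?\<phi> x - mat (?c 0) ** ?\<phi> 0)
      = ?\<phi> x - mat (sin (w * of_real x) / w)"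
    by (simp add: phi_0[OF V] phi_deriv_0[OF V] z)
  also have "(\<lambda>t. (mat (?s t) ** ?\<phi>2 t + mat (- ?c t) ** ?\<phi>1 t) + (mat (w\<^sup>2 * ?s t) ** ?\<phi> t + mat (?c t) ** ?\<phi>1 t))
      = (\<lambda>t. mat (?s t) ** (V t ** ?\<phi> t))"
    by (simp add: fun_eq_iff vec_eq_iff mat_matrix_mult_nth mat_mat.diff_left algebra_simps)
  finally show ?thesis .
qed

text \<open>
  The kernel of the perturbed equation is bounded by \<open>exp (|Im w| (x - t)) / |w|\<close>. In the norm weighted
  by \<open>exp (|Im w| x)\<close> the perturbation therefore has norm at most \<open>1/2\<close> as soon as \<open>|w|\<close> exceeds twice
  the integral of \<open>|V|\<close>; the a priori bound for \<open>\<phi>\<close>, inserted once more, gives the second order term.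
\<close>

lemma phi_asymptotics:
  fixes V :: "real \<Rightarrow> complex^'n^'n"
  assumes V: "V absolutely_integrable_on {0..1}"
  obtains C where "C > 0" "\<And>w. norm w \<ge> C \<Longrightarrow>
    norm (phi V (w\<^sup>2) 1 - mat (sin w / w)) \<le> C * exp \<bar>Im w\<bar> / (norm w)\<^sup>2"
proof -
  define m where "m = norm (mat 1 :: complex^'n^'n)"
  have m0: "m \<ge> 0" by (simp add: m_def)
  define I where "I = integral {0..1} (\<lambda>t. norm (V t))"
  have nV: "(\<lambda>t. norm (V t)) integrable_on {0..1}"
    using V by (simp add: absolutely_integrable_on_def)
  have I0: "I \<ge> 0" unfolding I_def by (intro integral_nonneg nV) auto
  define C where "C = 2 * I + 2 * m * I + 1"
  have "norm (phi V (w\<^sup>2) 1 - mat (sin w / w)) \<le> C * exp \<bar>Im w\<bar> / (norm w)\<^sup>2" if wC: "norm w \<ge> C" for w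
  proof -
    define \<kappa> where "\<kappa> = \<bar>Im w\<bar>"
    have Im: "\<bar>Im (w * of_real y)\<bar> = \<kappa> * y" if "y \<ge> 0" for y
      using that by (simp add: \<kappa>_def abs_mult)
    have w1: "norm w \<ge> 1" and w2: "norm w \<ge> 2 * I"
      using wC I0 m0 by (auto simp: C_def intro: order_trans[rotated])
    then have w0: "w \<noteq> 0" and wn: "norm w > 0" by auto
    let ?\<phi> = "phi V (w\<^sup>2)"
    have diff: "norm (?\<phi> x - mat (sin (w * of_real x) / w)) \<le> M * I / norm w * exp (\<kappa> * x)"
      if M: "0 \<le> M" and le: "\<And>t. t \<in> {0..1} \<Longrightarrow> norm (?\<phi> t) \<le> M * exp (\<kappa> * t)" and x: "x \<in> {0..1}" for M x
    proof -
      note J = phi_variation_of_constants[OF V w0 x]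
      have nVx: "(\<lambda>t. norm (V t)) integrable_on {0..x}"
        using integrable_on_subinterval[OF nV, of 0 x] x by auto
      have "norm (?\<phi> x - mat (sin (w * of_real x) / w)) \<le> integral {0..x} (\<lambda>t. norm (V t) * (M * exp (\<kappa> * x) / norm w))"
        unfolding integral_unique[OF J, symmetric]
      proof (rule integral_norm_bound_integral)
        show "(\<lambda>t. mat (sin (w * of_real (x - t)) / w) ** (V t ** ?\<phi> t)) integrable_on {0..x}"
          by (rule has_integral_integrable[OF J])
        show "(\<lambda>t. norm (V t) * (M * exp (\<kappa> * x) / norm w)) integrable_on {0..x}"
          by (rule integrable_on_mult_left[OF nVx])
        fix t assume t: "t \<in> {0..x}"
        have "norm (sin (w * of_real (x - t))) \<le> exp (\<kappa> * (x - t))"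
          using cmod_sin_le_exp[of 1 "w * of_real (x - t)"] Im[of "x - t"] t by simp
        then have "norm (mat (sin (w * of_real (x - t)) / w) ** (V t ** ?\<phi> t)) \<le>
            exp (\<kappa> * (x - t)) / norm w * (norm (V t) * (M * exp (\<kappa> * t)))"
          unfolding norm_mat_matrix_mult norm_divide
          using le[of t] t x wn
          by (intro mult_mono divide_right_mono order_trans[OF norm_matrix_mult_le] mult_left_mono) auto
        also have "\<dots> = norm (V t) * (M * (exp (\<kappa> * (x - t)) * exp (\<kappa> * t)) / norm w)" by simp
        also have "exp (\<kappa> * (x - t)) * exp (\<kappa> * t) = exp (\<kappa> * x)"
          by (simp add: algebra_simps flip: exp_add)
        finally show "norm (mat (sin (w * of_real (x - t)) / w) ** (V t ** ?\<phi> t)) \<le> norm (V t) * (M * exp (\<kappa> * x) / norm w)" .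
      qed
      also have "\<dots> = integral {0..x} (\<lambda>t. norm (V t)) * (M * exp (\<kappa> * x) / norm w)" by simp
      also have "\<dots> \<le> I * (M * exp (\<kappa> * x) / norm w)"
        unfolding I_def using x M wn
        by (intro mult_right_mono integral_subset_le nVx nV) auto
      finally show ?thesis by (simp add: mult_ac)
    qed
    have bd: "norm (?\<phi> x) \<le> 2 * (m / norm w) * exp (\<kappa> * x)" if x: "x \<in> {0..1}" for x
    proof (rule weighted_bound_absorb[OF continuous_on_phi[OF V] _ x])
      fix M x assume M: "(0::real) \<le> M" and le: "\<And>t. t \<in> {0..1} \<Longrightarrow> norm (?\<phi> t) \<le> M * exp (\<kappa> * t)" and x: "x \<in> {0..1::real}"
      have "norm (mat (sin (w * of_real x) / w) :: complex^'n^'n) = norm (sin (w * of_real x)) / norm w * m"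
        using norm_mat_matrix_mult[of "sin (w * of_real x) / w" "mat 1 :: complex^'n^'n"]
        by (simp add: m_def norm_divide)
      also have "\<dots> \<le> exp (\<kappa> * x) / norm w * m"
        using cmod_sin_le_exp[of 1 "w * of_real x"] Im[of x] x m0 wn
        by (intro mult_right_mono divide_right_mono) auto
      finally have 1: "norm (mat (sin (w * of_real x) / w) :: complex^'n^'n) \<le> m / norm w * exp (\<kappa> * x)" by (simp add: mult_ac)
      have "M * I / norm w = M * (I / norm w)" by simp
      also have "\<dots> \<le> M * (1 / 2)" using w2 wn M by (intro mult_left_mono) (auto simp: field_simps)
      finally have "M * I / norm w * exp (\<kappa> * x) \<le> M / 2 * exp (\<kappa> * x)" by (intro mult_right_mono) auto
      with diff[OF M le x] have 2: "norm (?\<phi> x - mat (sin (w * of_real x) / w)) \<le> M / 2 * exp (\<kappa> * x)" by (rule order_trans)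
      have "norm (?\<phi> x) \<le> m / norm w * exp (\<kappa> * x) + M / 2 * exp (\<kappa> * x)"
        using norm_triangle_mono[OF 1 2] by simp
      then show "norm (?\<phi> x) \<le> (m / norm w + M / 2) * exp (\<kappa> * x)" by (simp add: algebra_simps)
    qed
    have "norm (?\<phi> 1 - mat (sin (w * of_real 1) / w)) \<le> 2 * (m / norm w) * I / norm w * exp (\<kappa> * 1)"
      by (rule diff[OF _ bd]) (use m0 in auto)
    also have "\<dots> = 2 * m * I * exp \<kappa> / (norm w)\<^sup>2" by (simp add: power2_eq_square)
    also have "\<dots> \<le> C * exp \<kappa> / (norm w)\<^sup>2"
      using I0 by (intro divide_right_mono mult_right_mono) (auto simp: C_def)
    finally show ?thesis by (simp add: \<kappa>_def)
  qed
  moreover have "C > 0" using I0 m0 by (auto simp: C_def intro!: add_nonneg_pos add_nonneg_nonneg)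
  ultimately show thesis using that by blast
qed

text \<open>
  Circles in the \<open>w\<close>-plane halfway between the zeros of \<open>sin w / w\<close>, the characteristic function of the
  unperturbed problem.
\<close>

definition dirichlet_radius :: "nat \<Rightarrow> real" where
  "dirichlet_radius n = pi * (n + 1 / 2)"

lemma filterlim_dirichlet_radius: "filterlim dirichlet_radius at_top sequentially"
  unfolding dirichlet_radius_def by real_asymp

lemma dirichlet_radius_pos: "dirichlet_radius n > 0"
  by (simp add: dirichlet_radius_def add_nonneg_pos)

lemma phi_on_circles:
  fixes V :: "real \<Rightarrow> complex^'n^'n"
  assumes V: "V absolutely_integrable_on {0..1}"
  obtains C n0 where "C > 0" "\<And>n w. n \<ge> n0 \<Longrightarrow> norm w = dirichlet_radius n \<Longrightarrow>
     norm (phi V (w\<^sup>2) 1 - mat (sin w / w)) \<le> C / dirichlet_radius n * norm (sin w / w)"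
    "\<And>n w v. n \<ge> n0 \<Longrightarrow> norm w = dirichlet_radius n \<Longrightarrow>
     norm (sin w / w) * norm v \<le> 2 * norm (phi V (w\<^sup>2) 1 *v v)"
    "\<And>n w. n \<ge> n0 \<Longrightarrow> norm w = dirichlet_radius n \<Longrightarrow>
     exp \<bar>Im w\<bar> \<le> 8 * dirichlet_radius n * norm (sin w / w)"
proof -
  obtain C where C: "C > 0" "\<And>w. norm w \<ge> C \<Longrightarrow>
    norm (phi V (w\<^sup>2) 1 - mat (sin w / w)) \<le> C * exp \<bar>Im w\<bar> / (norm w)\<^sup>2"
    using phi_asymptotics[OF V] by blast
  \<comment> \<open>Radii of at least \<open>16 C\<close> make the relative error at most \<open>1/2\<close>.\<close>
  obtain n0 :: nat where n0: "real n0 \<ge> 16 * C + 1"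
    using real_arch_simple by blast
  have big: "dirichlet_radius n \<ge> 16 * C" "n \<ge> 1" "dirichlet_radius n > 0" if "n \<ge> n0" for n
  proof -
    have n: "real n \<ge> 16 * C + 1" using n0 that by simp
    then show "n \<ge> 1" using C(1) by linarith
    have "1 * real n \<le> pi * (real n + 1 / 2)"
      using pi_gt3 by (intro mult_mono) auto
    then show "dirichlet_radius n \<ge> 16 * C" using n by (simp add: dirichlet_radius_def)
    then show "dirichlet_radius n > 0" using C(1) by linarith
  qed
  have sinb: "exp \<bar>Im w\<bar> \<le> 8 * dirichlet_radius n * norm (sin w / w)"
    if "n \<ge> n0" and w: "norm w = dirichlet_radius n" for n w
    using exp_le_norm_sin_on_circle[of n w] big[OF that(1)] w
    by (simp add: norm_divide dirichlet_radius_def)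
  have close: "norm (phi V (w\<^sup>2) 1 - mat (sin w / w)) \<le> (8 * C) / dirichlet_radius n * norm (sin w / w)"
    if n: "n \<ge> n0" and w: "norm w = dirichlet_radius n" for n w
  proof -
    have "norm (phi V (w\<^sup>2) 1 - mat (sin w / w)) \<le> C * exp \<bar>Im w\<bar> / (norm w)\<^sup>2"
      using big(1)[OF n] C(1) w by (intro C(2)) auto
    also have "\<dots> \<le> C * (8 * dirichlet_radius n * norm (sin w / w)) / (norm w)\<^sup>2"
      using sinb[OF n w] C(1) by (intro divide_right_mono mult_left_mono) auto
    also have "\<dots> = (8 * C) / dirichlet_radius n * norm (sin w / w)"
      using big(3)[OF n] w by (simp add: power2_eq_square)
    finally show ?thesis .
  qed
  show thesis
  proof (rule that[of "8 * C" n0, OF _ close _ sinb])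
    fix n and w :: complex and v :: "complex^'n"
    assume n: "n \<ge> n0" and w: "norm w = dirichlet_radius n"
    let ?s = "sin w / w"
    have "norm (?s *s v) \<le> norm (phi V (w\<^sup>2) 1 *v v) + norm ((phi V (w\<^sup>2) 1 - mat ?s) *v v)"
      by (metis (no_types) mat_mult_vec matrix_vector_mult_diff_rdistrib norm_triangle_sub norm_minus_commute)
    also have "norm ((phi V (w\<^sup>2) 1 - mat ?s) *v v) \<le> ((8 * C) / dirichlet_radius n * norm ?s) * norm v"
      by (rule order_trans[OF norm_matrix_vector_mult_le mult_right_mono[OF close[OF n w]]]) simp
    also have "\<dots> \<le> (1 / 2 * norm ?s) * norm v"
      using big[OF n] C(1) by (intro mult_right_mono) (auto simp: field_simps)
    finally show "norm ?s * norm v \<le> 2 * norm (phi V (w\<^sup>2) 1 *v v)"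
      by (simp add: norm_smult_vec)
  qed (use C(1) in auto)
qed

section \<open>Matrix functions with simple poles of the inverse\<close>

definition singular_points :: "(complex \<Rightarrow> complex^'n^'n) \<Rightarrow> complex set" where
  "singular_points A = {z. \<exists>v. v \<noteq> 0 \<and> A z *v v = 0}"

lemma invertible_off_singular_points:
  "z \<notin> singular_points A \<longleftrightarrow> invertible (A z)"
  unfolding singular_points_def invertible_left_inverse matrix_left_invertible_ker by blast

lemma matrix_inv_mult:
  fixes M :: "complex^'n^'n"
  assumes "invertible M"
  shows "M *v (matrix_inv M *v x) = x" "M ** matrix_inv M = mat 1" "matrix_inv M ** M = mat 1"
proof -
  have "M ** matrix_inv M = mat 1 \<and> matrix_inv M ** M = mat 1"
    using assms unfolding matrix_inv_def invertible_def by (rule someI_ex)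
  then show "M *v (matrix_inv M *v x) = x" "M ** matrix_inv M = mat 1" "matrix_inv M ** M = mat 1"
    by (simp_all add: matrix_vector_mul_assoc)
qed

lemma det_holomorphic:
  assumes "\<And>i j. (\<lambda>z. (A z :: complex^'n^'n) $ i $ j) holomorphic_on T"
  shows "(\<lambda>z. det (A z)) holomorphic_on T"
  unfolding det_def by (intro holomorphic_intros assms)

lemma open_nonsingular_points:
  assumes "entire_matrix A"
  shows "open (- singular_points A)"
proof -
  have "(\<lambda>z. det (A z)) holomorphic_on UNIV"
    by (rule det_holomorphic) (use assms in \<open>auto simp: entire_matrix_def\<close>)
  then have c: "continuous_on UNIV (\<lambda>z. det (A z))"
    by (rule holomorphic_on_imp_continuous_on)
  have "- singular_points A = {z. det (A z) \<noteq> 0}"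
    using invertible_off_singular_points[of _ A] by (auto simp: invertible_det_nz)
  then show ?thesis
    using open_Collect_neq[OF c continuous_on_const[of _ 0]] by simp
qed

lemma matrix_entry_eq_axis: "(M :: complex^'n^'m) $ i $ j = (M *v axis j 1) $ i"
  by (simp add: matrix_vector_mult_def axis_def if_distrib[of "\<lambda>x. _ * x"] cong: if_cong)

text \<open>
  By Cramer's rule the entries of the inverse are quotients of determinants.
\<close>

lemma matrix_inv_holomorphic:
  assumes A: "entire_matrix A"
  shows "(\<lambda>z. matrix_inv (A z) $ i $ j) holomorphic_on - singular_points A"
proof -
  have hol: "(\<lambda>z. A z $ r $ c) holomorphic_on T" for r c T
    using A holomorphic_on_subset[of _ UNIV T] by (auto simp: entire_matrix_def)
  have "(\<lambda>z. det (\<chi> r c. if c = i then axis j 1 $ r else A z $ r $ c) / det (A z)) holomorphic_on - singular_points A"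
  proof (intro holomorphic_on_divide det_holomorphic hol)
    show "(\<lambda>z. (\<chi> r c. if c = i then axis j 1 $ r else A z $ r $ c) $ r $ c) holomorphic_on - singular_points A" for r c
      by (cases "c = i") (auto intro: hol)
    show "det (A z) \<noteq> 0" if "z \<in> - singular_points A" for z
      using that invertible_off_singular_points[of z A] by (simp add: invertible_det_nz)
  qed
  then show ?thesis
  proof (rule holomorphic_transform)
    fix z assume "z \<in> - singular_points A"
    then have inv: "invertible (A z)" and d: "det (A z) \<noteq> 0"
      using invertible_off_singular_points[of z A] by (auto simp: invertible_det_nz)
    have "A z *v (matrix_inv (A z) *v axis j 1) = axis j 1"
      by (rule matrix_inv_mult(1)[OF inv])
    then have "matrix_inv (A z) *v axis j 1 = (\<chi> k. det (\<chi> r c. if c = k then axis j 1 $ r else A z $ r $ c) / det (A z))"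
      using cramer[OF d] by blast
    then show "det (\<chi> r c. if c = i then axis j 1 $ r else A z $ r $ c) / det (A z) = matrix_inv (A z) $ i $ j"
      unfolding matrix_entry_eq_axis[of "matrix_inv (A z)"] by simp
  qed
qed

text \<open>
  The inverse of \<open>A(z)\<close> exists near \<open>a\<close> and is \<open>O(1 / |z - a|)\<close>, stated without mention of the inverse.
\<close>

definition simple_pole_bound :: "(complex \<Rightarrow> complex^'n^'n) \<Rightarrow> complex \<Rightarrow> bool" where
  "simple_pole_bound A a \<longleftrightarrow>
     (\<exists>c>0. \<forall>\<^sub>F z in at a. \<forall>v. c * norm (z - a) * norm v \<le> norm (A z *v v))"

lemma range_mult_closed: "closed (range ((*v) (M :: complex^'n^'m)))"
  by (intro closed_subspace linear_subspace_image subspace_UNIV bounded_linear.linear matrix_vector_mul_bounded_linear)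

text \<open>
  If the bound failed, there would be unit vectors \<open>v\<^sub>n\<close> and points \<open>z\<^sub>n \<rightarrow> a\<close> with
  \<open>A(z\<^sub>n) v\<^sub>n = o(z\<^sub>n - a)\<close>. A limit point \<open>u\<close> of the \<open>v\<^sub>n\<close> lies in \<open>Ker A(a)\<close>, and dividing by
  \<open>z\<^sub>n - a\<close> puts \<open>A'(a) u\<close> into the closed subspace \<open>Ran A(a)\<close>.
\<close>

lemma simple_pole_boundI:
  fixes A :: "complex \<Rightarrow> complex^'n^'n"
  assumes A: "entire_matrix A"
    and tr: "\<And>u w. A a *v u = 0 \<Longrightarrow> matrix_deriv A a *v u = A a *v w \<Longrightarrow> u = 0"
  shows "simple_pole_bound A a"
proof (rule ccontr)
  assume neg: "\<not> simple_pole_bound A a"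
  have "\<exists>z v. z \<noteq> a \<and> norm (z - a) < 1 / Suc n \<and> norm v = 1 \<and> norm (A z *v v) < 1 / Suc n * norm (z - a)" for n
  proof -
    have "\<not> (\<forall>\<^sub>F z in at a. \<forall>v. 1 / Suc n * norm (z - a) * norm v \<le> norm (A z *v v))"
    proof
      assume "\<forall>\<^sub>F z in at a. \<forall>v. 1 / Suc n * norm (z - a) * norm v \<le> norm (A z *v v)"
      then have "simple_pole_bound A a"
        unfolding simple_pole_bound_def by (intro exI[of _ "1 / Suc n"]) simp
      then show False using neg by blast
    qed
    moreover have "0 < 1 / real (Suc n)" by simp
    ultimately have "\<not> (\<forall>z\<in>UNIV. z \<noteq> a \<and> dist z a < 1 / Suc n \<longrightarrow> (\<forall>v. 1 / Suc n * norm (z - a) * norm v \<le> norm (A z *v v)))"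
      unfolding eventually_at by blast
    then obtain z where z: "z \<noteq> a" "norm (z - a) < 1 / Suc n"
      "\<not> (\<forall>v. 1 / Suc n * norm (z - a) * norm v \<le> norm (A z *v v))"
      unfolding dist_norm by blast
    then obtain v where v: "norm (A z *v v) < 1 / Suc n * norm (z - a) * norm v"
      by (auto simp: not_le)
    then have v0: "norm v > 0" by (cases "v = 0") auto
    define u where "u = (1 / norm v) *\<^sub>R v"
    have "A z *v u = (1 / norm v) *\<^sub>R (A z *v v)"
      unfolding u_def by (rule mat_vec.scaleR_right)
    then have "norm (A z *v u) = norm (A z *v v) / norm v" using v0 by simp
    also have "\<dots> < 1 / Suc n * norm (z - a)" using v v0 by (simp add: field_simps)
    finally have "norm (A z *v u) < 1 / Suc n * norm (z - a)" .
    moreover have "norm u = 1" using v0 by (simp add: u_def)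
    ultimately show ?thesis using z by blast
  qed
  then obtain z v where zv: "\<And>n. z n \<noteq> a" "\<And>n. norm (z n - a) < 1 / Suc n" "\<And>n. norm (v n) = 1"
    "\<And>n. norm (A (z n) *v v n) < 1 / Suc n * norm (z n - a)"
    by metis
  have inv0: "(\<lambda>n. 1 / real (Suc n)) \<longlonglongrightarrow> 0" by (rule LIMSEQ_Suc[OF lim_1_over_n])
  have "compact (sphere (0::complex^'n) 1)" by simp
  then obtain u r where u: "u \<in> sphere 0 1" and r: "strict_mono r" "(v \<circ> r) \<longlonglongrightarrow> u"
    using zv(3) unfolding compact_def by (metis dist_0_norm mem_sphere)
  have "(\<lambda>n. z n - a) \<longlonglongrightarrow> 0"
    by (rule Lim_null_comparison[OF _ inv0]) (use zv(2) in \<open>auto intro!: always_eventually less_imp_le\<close>)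
  then have "z \<longlonglongrightarrow> a" by (rule LIM_zero_cancel)
  then have za: "filterlim (z \<circ> r) (at a) sequentially"
    using zv(1) by (auto simp: filterlim_at intro!: LIMSEQ_subseq_LIMSEQ[OF _ r(1)])
  have inv0r: "(\<lambda>n. 1 / real (Suc (r n))) \<longlonglongrightarrow> 0"
    using LIMSEQ_subseq_LIMSEQ[OF inv0 r(1)] by (simp add: o_def)
  have D: "(\<lambda>n. (mat (1 / (z (r n) - a)) ** (A (z (r n)) - A a)) *v v (r n)) \<longlonglongrightarrow> matrix_deriv A a *v u"
    using mat_vec.tendsto[OF filterlim_compose[OF tendsto_matrix_deriv[OF A] za] r(2)]
    by (simp add: o_def)
  have "(\<lambda>n. A (z (r n)) *v v (r n)) \<longlonglongrightarrow> A a *v u"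
    using mat_vec.tendsto[OF filterlim_compose[OF tendsto_entire_matrix[OF A] za] r(2)]
    by (simp add: o_def)
  moreover have "(\<lambda>n. A (z (r n)) *v v (r n)) \<longlonglongrightarrow> 0"
  proof (rule Lim_null_comparison[OF always_eventually inv0r], rule allI)
    fix n
    have "norm (A (z (r n)) *v v (r n)) \<le> 1 / Suc (r n) * norm (z (r n) - a)"
      by (rule less_imp_le[OF zv(4)])
    also have "\<dots> \<le> 1 / Suc (r n) * 1"
    proof (rule mult_left_mono)
      show "norm (z (r n) - a) \<le> 1"
        using zv(2)[of "r n"] by (rule order_trans[OF less_imp_le]) simp
    qed simp
    finally show "norm (A (z (r n)) *v v (r n)) \<le> 1 / Suc (r n)" by simp
  qed
  ultimately have Au: "A a *v u = 0" by (rule LIMSEQ_unique)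
  have Q: "(\<lambda>n. (1 / (z (r n) - a)) *s (A (z (r n)) *v v (r n))) \<longlonglongrightarrow> 0"
  proof (rule Lim_null_comparison[OF always_eventually inv0r], rule allI)
    fix n
    show "norm ((1 / (z (r n) - a)) *s (A (z (r n)) *v v (r n))) \<le> 1 / Suc (r n)"
      using zv(4)[of "r n"] zv(1)[of "r n"] by (simp add: norm_smult_vec norm_divide field_simps)
  qed
  have "A a *v ((- 1 / (z (r n) - a)) *s v (r n)) = (mat (1 / (z (r n) - a)) ** (A (z (r n)) - A a)) *v v (r n)
      - (1 / (z (r n) - a)) *s (A (z (r n)) *v v (r n))" for n
    by (simp add: mat_mult_matrix_vec matrix_vector_mult_diff_rdistrib matrix_vector_smult
        mat_vec.minus_right)
  then have "(\<lambda>n. A a *v ((- 1 / (z (r n) - a)) *s v (r n))) \<longlonglongrightarrow> matrix_deriv A a *v u"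
    using tendsto_diff[OF D Q] by simp
  then have "matrix_deriv A a *v u \<in> range ((*v) (A a))"
    by (rule Lim_in_closed_set[OF range_mult_closed, rotated 2]) auto
  then obtain w where "matrix_deriv A a *v u = A a *v w" by blast
  from tr[OF Au this] u show False by simp
qed

lemma simple_pole_bound_isolated:
  assumes "simple_pole_bound A a"
  shows "\<forall>\<^sub>F z in at a. z \<notin> singular_points A"
proof -
  obtain c where c: "c > 0" "\<forall>\<^sub>F z in at a. \<forall>v. c * norm (z - a) * norm v \<le> norm (A z *v v)"
    using assms by (auto simp: simple_pole_bound_def)
  have "\<forall>\<^sub>F z in at a. z \<noteq> a" by (simp add: eventually_at_filter)
  with c(2) show ?thesis
  proof eventually_elim
    case (elim z)
    show ?case
    proof
      assume "z \<in> singular_points A"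
      then obtain v where v: "v \<noteq> 0" "A z *v v = 0" by (auto simp: singular_points_def)
      then have "c * norm (z - a) * norm v \<le> 0" using elim(1) by (metis norm_zero)
      moreover have "c * norm (z - a) * norm v > 0" using c(1) elim(2) v(1) by simp
      ultimately show False by simp
    qed
  qed
qed

text \<open>
  \<open>A\<close> is bounded below on the orthogonal complement of its kernel, and \<open>B\<close> does not see the kernel.
\<close>

lemma kernel_inclusion_bound:
  fixes A B :: "complex^'n^'n"
  assumes ker: "\<And>v. A *v v = 0 \<Longrightarrow> B *v v = 0"
  obtains K where "K > 0" "\<And>v. norm (B *v v) \<le> K * norm (A *v v)"
proof -
  let ?N = "{v. A *v v = 0}"
  have sN: "subspace ?N"
    by (auto simp: subspace_def matrix_vector_right_distrib mat_vec.scaleR_right)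
  have "\<exists>e>0. \<forall>x\<in>?N\<^sup>\<bottom>. norm (A *v x) \<ge> e * norm x"
  proof (rule injective_imp_isometric[OF closed_subspace[OF subspace_orthogonal_comp] subspace_orthogonal_comp])
    show "\<forall>x\<in>?N\<^sup>\<bottom>. A *v x = 0 \<longrightarrow> x = 0"
      using orthogonal_Int_0[OF sN] by blast
  qed (rule matrix_vector_mul_bounded_linear)
  then obtain e where e: "e > 0" "\<And>x. x \<in> ?N\<^sup>\<bottom> \<Longrightarrow> e * norm x \<le> norm (A *v x)" by blast
  show thesis
  proof (rule that[of "(norm B + 1) / e"])
    show "(norm B + 1) / e > 0" using e(1) by (simp add: add_nonneg_pos)
    fix v
    obtain p q where pq: "v = p + q" "p \<in> ?N" "q \<in> ?N\<^sup>\<bottom>"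
      using subspace_sum_orthogonal_comp[OF sN] by (metis UNIV_I set_plus_elim)
    have "norm (B *v v) = norm (B *v q)"
      using pq ker by (simp add: matrix_vector_right_distrib)
    also have "\<dots> \<le> (norm B + 1) * norm q"
      by (rule order_trans[OF norm_matrix_vector_mult_le mult_right_mono]) auto
    also have "\<dots> \<le> (norm B + 1) * (norm (A *v q) / e)"
      using e(2)[OF pq(3)] e(1) by (intro mult_left_mono) (auto simp: field_simps)
    also have "A *v q = A *v v"
      using pq by (simp add: matrix_vector_right_distrib)
    finally show "norm (B *v v) \<le> (norm B + 1) / e * norm (A *v v)" by simp
  qed
qed

lemma entire_matrix_locally_Lipschitz:
  assumes "entire_matrix A"
  obtains L where "L > 0" "\<forall>\<^sub>F z in at a. norm (A z - A a) \<le> L * norm (z - a)"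
proof -
  define L where "L = norm (matrix_deriv A a) + 1"
  have "((\<lambda>z. norm (mat (1 / (z - a)) ** (A z - A a))) \<longlongrightarrow> norm (matrix_deriv A a)) (at a)"
    by (intro tendsto_norm tendsto_matrix_deriv assms)
  then have "\<forall>\<^sub>F z in at a. norm (mat (1 / (z - a)) ** (A z - A a)) < L"
    by (rule order_tendstoD) (simp add: L_def)
  moreover have "\<forall>\<^sub>F z in at a. z \<noteq> a" by (simp add: eventually_at_filter)
  ultimately have "\<forall>\<^sub>F z in at a. norm (A z - A a) \<le> L * norm (z - a)"
    by eventually_elim (simp add: norm_mat_matrix_mult norm_divide field_simps)
  then show thesis using that[of L] by (simp add: L_def add_nonneg_pos)
qed

lemma bounded_singularities_extend:
  assumes hol: "h holomorphic_on - S" and op: "open (- S)"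
    and bd: "\<And>s. s \<in> S \<Longrightarrow> \<exists>K. \<forall>\<^sub>F z in at s. z \<notin> S \<and> norm (h z) \<le> K"
  obtains F where "F holomorphic_on UNIV" "\<And>z. z \<notin> S \<Longrightarrow> F z = (h z :: complex)"
proof -
  define F where "F z = (if z \<in> S then Lim (at z) h else h z)" for z
  have "F field_differentiable at z" for z
  proof (cases "z \<in> S")
    case False
    have "F holomorphic_on - S"
      by (rule holomorphic_transform[OF hol]) (simp add: F_def)
    then show ?thesis
      using op False by (simp add: holomorphic_on_open field_differentiable_def)
  next
    case True
    obtain K where "\<forall>\<^sub>F y in at z. y \<notin> S \<and> norm (h y) \<le> K" using bd[OF True] by blast
    then obtain d where d: "d > 0" "\<And>y. y \<noteq> z \<Longrightarrow> dist y z < d \<Longrightarrow> y \<notin> S \<and> norm (h y) \<le> K"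
      unfolding eventually_at by auto
    have "h holomorphic_on (ball z d - {z})"
      by (rule holomorphic_on_subset[OF hol]) (use d in \<open>auto simp: dist_commute\<close>)
    moreover have "z \<in> interior (ball z d)" using d by simp
    moreover have "\<exists>B. \<forall>\<^sub>F y in at z. norm (h y) \<le> B"
      unfolding eventually_at using d by (intro exI[of _ K] exI[of _ d]) auto
    ultimately obtain g where g: "g holomorphic_on ball z d" "\<forall>y\<in>ball z d - {z}. g y = h y"
      using holomorphic_on_extend_bounded[of h "ball z d" z] by blast
    have gd: "g field_differentiable at z"
      using g(1) d(1) by (simp add: holomorphic_on_open field_differentiable_def)
    have "(g \<longlongrightarrow> g z) (at z)"
      using field_differentiable_imp_continuous_at[OF gd] by (simp add: isCont_def)
    then have "(h \<longlongrightarrow> g z) (at z)"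
      by (rule Lim_transform_within[OF _ d(1)]) (use g(2) in \<open>auto simp: dist_commute\<close>)
    then have "Lim (at z) h = g z" by (intro tendsto_Lim) auto
    then have Fg: "F y = g y" if "y \<in> ball z d" for y
      using g(2) d(2)[of y] that True by (cases "y = z") (auto simp: F_def dist_commute)
    have "F holomorphic_on ball z d"
      by (rule holomorphic_transform[OF g(1)]) (simp add: Fg)
    then show ?thesis
      using d(1) by (simp add: holomorphic_on_open field_differentiable_def)
  qed
  then have "F holomorphic_on UNIV" by (simp add: holomorphic_on_def)
  then show thesis using that by (simp add: F_def)
qed

text \<open>
  Growth is controlled only on a sequence of circles around \<open>0\<close>, so Cauchy's inequality is applied to the
  Taylor coefficients at \<open>0\<close>.
\<close>

lemma Liouville_on_circles:
  fixes R b :: "nat \<Rightarrow> real"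
  assumes f: "f holomorphic_on UNIV" and R: "filterlim R at_top sequentially"
    and le: "\<And>n z. n \<ge> n0 \<Longrightarrow> norm z = R n \<Longrightarrow> norm (f z) \<le> b n"
    and lim: "(\<lambda>n. b n / R n ^ m) \<longlonglongrightarrow> 0"
  shows "f z = (\<Sum>k<m. (deriv ^^ k) f 0 / fact k * z ^ k)"
proof -
  have zero: "(deriv ^^ k) f 0 = 0" if k: "k \<ge> m" for k
  proof -
    have "(\<lambda>n. fact k * (b n / R n ^ m)) \<longlonglongrightarrow> fact k * 0"
      by (intro tendsto_intros lim)
    moreover have "\<forall>\<^sub>F n in sequentially. norm ((deriv ^^ k) f 0) \<le> fact k * (b n / R n ^ m)"
      using filterlim_at_top[THEN iffD1, OF R, rule_format, of 1] eventually_ge_at_top[of n0]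
    proof eventually_elim
      case (elim n)
      have b0: "b n \<ge> 0"
        by (rule order_trans[OF norm_ge_zero le[of n "of_real (R n)"]]) (use elim in auto)
      have "norm ((deriv ^^ k) f 0) \<le> fact k * b n / R n ^ k"
        using elim le[of n] f
        by (intro Cauchy_inequality) (auto intro: holomorphic_on_subset holomorphic_on_imp_continuous_on continuous_on_subset)
      also have "\<dots> \<le> fact k * b n / R n ^ m"
        using elim b0 k by (intro divide_left_mono power_increasing mult_pos_pos) auto
      finally show ?case by simp
    qed
    ultimately have "norm ((deriv ^^ k) f 0) \<le> fact k * 0"
      by (intro tendsto_lowerbound[of _ _ sequentially]) auto
    then show ?thesis by simp
  qed
  have "(\<lambda>k. (deriv ^^ k) f 0 / fact k * (z - 0) ^ k) sums f z"
    by (rule holomorphic_power_series[of f 0 "norm z + 1"]) (use f holomorphic_on_subset in auto)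
  moreover have "(\<lambda>k. (deriv ^^ k) f 0 / fact k * (z - 0) ^ k) sums (\<Sum>k<m. (deriv ^^ k) f 0 / fact k * (z - 0) ^ k)"
    by (rule sums_finite) (auto simp: zero)
  ultimately show ?thesis using sums_unique2 by fastforce
qed

text \<open>
  The function \<open>(z - a) (B - A) A\<^sup>-\<^sup>1\<close> is bounded near every singular point of \<open>A\<close>: at \<open>a\<close> the factor
  \<open>z - a\<close> removes the pole; at the other points \<open>s\<close> the kernel condition bounds \<open>B(s) v\<close> by \<open>A(s) v\<close>, and
  for \<open>v = A(z)\<^sup>-\<^sup>1 e\<^sub>j\<close> both \<open>A(z) - A(s)\<close> and \<open>B(z) - B(s)\<close> are small enough to cancel the pole of
  \<open>v\<close>. So it extends to an entire function, and the bound on the circles makes that constant.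
\<close>

lemma quotient_single_pole:
  fixes A B :: "complex \<Rightarrow> complex^'n^'n" and \<rho> :: "nat \<Rightarrow> real"
  assumes A: "entire_matrix A" and B: "entire_matrix B"
    and poles: "\<And>s. s \<in> singular_points A \<Longrightarrow> simple_pole_bound A s"
    and ker: "\<And>s v. s \<in> singular_points A \<Longrightarrow> s \<noteq> a \<Longrightarrow> A s *v v = 0 \<Longrightarrow> B s *v v = 0"
    and \<rho>: "filterlim \<rho> at_top sequentially"
    and circ: "\<And>n z. n \<ge> n0 \<Longrightarrow> norm z = (\<rho> n)\<^sup>2 \<Longrightarrow> z \<notin> singular_points A"
      "\<And>n z v. n \<ge> n0 \<Longrightarrow> norm z = (\<rho> n)\<^sup>2 \<Longrightarrow> norm ((B z - A z) *v v) \<le> C / \<rho> n * norm (A z *v v)"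
  obtains R where "\<And>z. mat (z - a) ** (B z - A z) = R ** A z"
proof -
  let ?S = "singular_points A"
  define h where "h i j z = (z - a) * ((B z - A z) ** matrix_inv (A z)) $ i $ j" for i j z
  have op: "open (- ?S)" by (rule open_nonsingular_points[OF A])
  have ent: "(\<lambda>z. M z $ i $ j) holomorphic_on T" if "entire_matrix M" for M :: "complex \<Rightarrow> complex^'n^'n" and i j T
    using that holomorphic_on_subset[of _ UNIV T] by (auto simp: entire_matrix_def)
  have hol: "h i j holomorphic_on - ?S" for i j
    unfolding h_def matrix_matrix_mult_def
    by (simp, intro holomorphic_intros ent A B matrix_inv_holomorphic)
  have hle: "norm (h i j z) \<le> norm (z - a) * norm ((B z - A z) *v v)"
    if "v = matrix_inv (A z) *v axis j 1" for i j z v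
    unfolding h_def norm_mult that matrix_vector_mul_assoc
    by (subst matrix_entry_eq_axis) (intro mult_left_mono Finite_Cartesian_Product.norm_nth_le norm_ge_zero)
  have col: "A z *v (matrix_inv (A z) *v axis j 1) = axis j 1" if "z \<notin> ?S" for z j
    using that by (simp add: invertible_off_singular_points matrix_inv_mult(1))
  have bd: "\<exists>K. \<forall>\<^sub>F z in at s. z \<notin> ?S \<and> norm (h i j z) \<le> K" if s: "s \<in> ?S" for s i j
  proof -
    obtain c where c: "c > 0" "\<forall>\<^sub>F z in at s. \<forall>v. c * norm (z - s) * norm v \<le> norm (A z *v v)"
      using poles[OF s] by (auto simp: simple_pole_bound_def)
    have iso: "\<forall>\<^sub>F z in at s. z \<notin> ?S"
      by (rule simple_pole_bound_isolated[OF poles[OF s]])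
    show ?thesis
    proof (cases "s = a")
      case True
      have "((\<lambda>z. norm (B z - A z)) \<longlongrightarrow> norm (B s - A s)) (at s)"
        by (intro tendsto_intros tendsto_entire_matrix A B)
      then have "\<forall>\<^sub>F z in at s. norm (B z - A z) < norm (B s - A s) + 1"
        by (rule order_tendstoD) simp
      with c(2) iso have "\<forall>\<^sub>F z in at s. z \<notin> ?S \<and> norm (h i j z) \<le> (norm (B s - A s) + 1) * (1 / c)"
      proof eventually_elim
        case (elim z)
        define v where "v = matrix_inv (A z) *v axis j 1"
        have "c * norm (z - s) * norm v \<le> norm (A z *v v)" using elim(1) by blast
        then have v: "norm (z - s) * norm v \<le> 1 / c"
          using col[OF elim(2)] c(1) by (simp add: v_def field_simps)
        have "norm (h i j z) \<le> norm (z - s) * (norm (B z - A z) * norm v)"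
          unfolding True
          by (rule order_trans[OF hle[OF v_def] mult_left_mono[OF norm_matrix_vector_mult_le]]) simp
        also have "\<dots> = norm (B z - A z) * (norm (z - s) * norm v)" by simp
        also have "\<dots> \<le> (norm (B s - A s) + 1) * (1 / c)"
          using v elim(3) by (intro mult_mono) auto
        finally show ?case using elim(2) by simp
      qed
      then show ?thesis by blast
    next
      case False
      have near: "\<forall>\<^sub>F z in at s. norm (z - s) < 1"
        unfolding eventually_at by (intro exI[of _ 1]) (auto simp: dist_norm)
      obtain LA where LA: "LA > 0" "\<forall>\<^sub>F z in at s. norm (A z - A s) \<le> LA * norm (z - s)"
        using entire_matrix_locally_Lipschitz[OF A] by blast
      obtain LB where LB: "LB > 0" "\<forall>\<^sub>F z in at s. norm (B z - B s) \<le> LB * norm (z - s)"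
        using entire_matrix_locally_Lipschitz[OF B] by blast
      \<comment> \<open>This is the only place where the kernels of \<open>A\<close> and \<open>B\<close> are compared.\<close>
      obtain K1 where K1: "K1 > 0" "\<And>v. norm (B s *v v) \<le> K1 * norm (A s *v v)"
        using kernel_inclusion_bound[of "A s" "B s"] ker[OF s False] by blast
      define K where "K = (1 + norm (s - a)) * (LB / c + K1 * (1 + LA / c) + 1)"
      have "\<forall>\<^sub>F z in at s. z \<notin> ?S \<and> norm (h i j z) \<le> K"
        using c(2) iso near LA(2) LB(2)
      proof eventually_elim
        case (elim z)
        define v where "v = matrix_inv (A z) *v axis j 1"
        have Av: "A z *v v = axis j 1" unfolding v_def by (rule col[OF elim(2)])
        have "c * norm (z - s) * norm v \<le> norm (A z *v v)" using elim(1) by blast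
        then have v: "norm (z - s) * norm v \<le> 1 / c"
          using Av c(1) by (simp add: field_simps)
        have small: "norm ((M z - M s) *v v) \<le> L / c"
          if "norm (M z - M s) \<le> L * norm (z - s)" "L > 0" for M :: "complex \<Rightarrow> complex^'n^'n" and L
        proof -
          have "norm ((M z - M s) *v v) \<le> (L * norm (z - s)) * norm v"
            by (rule order_trans[OF norm_matrix_vector_mult_le mult_right_mono[OF that(1)]]) simp
          also have "\<dots> \<le> L * (1 / c)"
            using v that(2) mult_left_mono[of "norm (z - s) * norm v" "1 / c" L] by (simp add: mult.assoc)
          finally show ?thesis by simp
        qed
        have "A s *v v = axis j 1 - (A z - A s) *v v"
          by (simp add: matrix_vector_mult_diff_rdistrib Av)
        then have "norm (A s *v v) \<le> 1 + LA / c"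
          using norm_triangle_ineq4[of "axis j 1 :: complex^'n" "(A z - A s) *v v"] small[OF elim(4) LA(1)] by simp
        then have Bs: "norm (B s *v v) \<le> K1 * (1 + LA / c)"
          using K1 by (meson less_imp_le mult_left_mono order_trans)
        have "(B z - A z) *v v = (B z - B s) *v v + B s *v v - axis j 1"
          by (simp add: matrix_vector_mult_diff_rdistrib Av)
        then have "norm ((B z - A z) *v v) \<le> norm ((B z - B s) *v v) + norm (B s *v v) + norm (axis j 1 :: complex^'n)"
          using norm_triangle_ineq4[of "(B z - B s) *v v + B s *v v" "axis j 1"]
            norm_triangle_ineq[of "(B z - B s) *v v" "B s *v v"] by simp
        also have "\<dots> \<le> LB / c + K1 * (1 + LA / c) + 1"
          using small[OF elim(5) LB(1)] Bs by simp
        finally have 1: "norm ((B z - A z) *v v) \<le> LB / c + K1 * (1 + LA / c) + 1" .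
        have 2: "norm (z - a) \<le> 1 + norm (s - a)"
          using norm_triangle_ineq[of "z - s" "s - a"] elim(3) by simp
        have "norm (h i j z) \<le> norm (z - a) * norm ((B z - A z) *v v)"
          by (rule hle[OF v_def])
        also have "\<dots> \<le> K"
          unfolding K_def by (intro mult_mono 1 2) auto
        finally show ?case using elim(2) by simp
      qed
      then show ?thesis by blast
    qed
  qed
  have "\<exists>F. F holomorphic_on UNIV \<and> (\<forall>z. z \<notin> ?S \<longrightarrow> F z = h i j z)" for i j
    using bounded_singularities_extend[OF hol[of i j] op bd] by metis
  then obtain F where F: "\<And>i j. F i j holomorphic_on UNIV" "\<And>i j z. z \<notin> ?S \<Longrightarrow> F i j z = h i j z"
    by metis
  define R where "R = (\<chi> i j. F i j 0)"
  have Fconst: "F i j z = R $ i $ j" for i j z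
  proof -
    have "F i j z = (\<Sum>k<1. (deriv ^^ k) (F i j) 0 / fact k * z ^ k)"
    proof (rule Liouville_on_circles[OF F(1)])
      show "filterlim (\<lambda>n. (\<rho> n)\<^sup>2) at_top sequentially"
        by (rule filterlim_compose[OF _ \<rho>]) real_asymp
      show "norm (F i j z) \<le> ((\<rho> n)\<^sup>2 + norm a) * (C / \<rho> n)" if n: "n \<ge> n0" and z: "norm z = (\<rho> n)\<^sup>2" for n z
      proof -
        define v where "v = matrix_inv (A z) *v axis j 1"
        have zS: "z \<notin> ?S" by (rule circ(1)[OF n z])
        have "norm (F i j z) \<le> norm (z - a) * norm ((B z - A z) *v v)"
          unfolding F(2)[OF zS] by (rule hle[OF v_def])
        also have "\<dots> \<le> ((\<rho> n)\<^sup>2 + norm a) * (C / \<rho> n)"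
          using circ(2)[OF n z, of v] col[OF zS, of j] norm_triangle_ineq4[of z a] z
          by (intro mult_mono) (auto simp: v_def)
        finally show ?thesis .
      qed
      have "((\<lambda>x. ((x\<^sup>2 + norm a) * (C / x)) / (x\<^sup>2) ^ 1) \<longlongrightarrow> 0) at_top"
        by real_asymp
      then show "(\<lambda>n. (((\<rho> n)\<^sup>2 + norm a) * (C / \<rho> n)) / ((\<rho> n)\<^sup>2) ^ 1) \<longlonglongrightarrow> 0"
        by (rule filterlim_compose[OF _ \<rho>])
    qed
    then show ?thesis by (simp add: R_def)
  qed
  have off: "mat (z - a) ** (B z - A z) = R ** A z" if z: "z \<notin> ?S" for z
  proof -
    have "mat (z - a) ** ((B z - A z) ** matrix_inv (A z)) = R"
      using F(2)[OF z] Fconst by (simp add: vec_eq_iff mat_matrix_mult_nth h_def)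
    then have "mat (z - a) ** ((B z - A z) ** matrix_inv (A z)) ** A z = R ** A z" by simp
    then show ?thesis
      using z by (simp add: matrix_inv_mult(3) invertible_off_singular_points flip: matrix_mul_assoc)
  qed
  have "mat (z - a) ** (B z - A z) = R ** A z" for z
  proof (cases "z \<in> ?S")
    case True
    let ?G = "\<lambda>z. mat (z - a) ** (B z - A z) - R ** A z"
    have "((\<lambda>z. mat (z - a) :: complex^'n^'n) \<longlongrightarrow> mat (z - a)) (at z)"
      unfolding mat_def by (intro vec_tendstoI) (auto intro!: tendsto_intros)
    then have "(?G \<longlongrightarrow> ?G z) (at z)"
      by (intro tendsto_diff mat_mat.tendsto
          tendsto_entire_matrix[OF A] tendsto_entire_matrix[OF B] tendsto_const)
    moreover have "\<forall>\<^sub>F y in at z. ?G y = 0"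
      using simple_pole_bound_isolated[OF poles[OF True]] by eventually_elim (simp add: off)
    then have "(?G \<longlongrightarrow> 0) (at z)"
      by (rule tendsto_eventually)
    ultimately have "?G z = 0" by (rule LIM_unique)
    then show ?thesis by simp
  qed (rule off)
  then show thesis by (rule that)
qed

text \<open>
  Otherwise \<open>p A\<^sup>-\<^sup>1\<close>, with \<open>p\<close> the polynomial vanishing at the finitely many singular points, would be
  entire, hence a polynomial by its growth on the circles. It decays exponentially along the negative
  half-axis, which is where \<open>|Im w| = |w|\<close>, so it is zero, and \<open>A\<^sup>-\<^sup>1\<close> would vanish.
\<close>

lemma singular_points_infinite:
  fixes A :: "complex \<Rightarrow> complex^'n^'n" and \<rho> :: "nat \<Rightarrow> real"
  assumes A: "entire_matrix A"
    and poles: "\<And>s. s \<in> singular_points A \<Longrightarrow> simple_pole_bound A s"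
    and \<rho>: "filterlim \<rho> at_top sequentially" and \<rho>0: "\<And>n. \<rho> n > 0"
    and circ: "\<And>n w v. n \<ge> n0 \<Longrightarrow> norm w = \<rho> n \<Longrightarrow> exp \<bar>Im w\<bar> * norm v \<le> C * \<rho> n * norm (A (w\<^sup>2) *v v)"
  shows "infinite (singular_points A)"
proof
  let ?S = "singular_points A"
  assume fin: "finite ?S"
  define p where "p z = (\<Prod>s\<in>?S. z - s)" for z :: complex
  define M where "M = (\<Sum>s\<in>?S. norm s)"
  define N where "N = card ?S"
  have M: "norm s \<le> M" if "s \<in> ?S" for s
    unfolding M_def using that fin by (intro member_le_sum) auto
  have op: "open (- ?S)" by (rule open_nonsingular_points[OF A])
  have col: "A z *v (matrix_inv (A z) *v axis j 1) = axis j 1" if "z \<notin> ?S" for z j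
    using that by (simp add: invertible_off_singular_points matrix_inv_mult(1))
  have ple: "norm (p z) \<le> (norm z + M) ^ N" for z
  proof -
    have "norm (p z) = (\<Prod>s\<in>?S. norm (z - s))" by (simp add: p_def prod_norm)
    also have "\<dots> \<le> (\<Prod>s\<in>?S. norm z + M)"
      using M by (intro prod_mono) (auto intro: order_trans[OF norm_triangle_ineq4])
    finally show ?thesis by (simp add: N_def)
  qed
  have entry: "matrix_inv (A z) $ i $ j = 0" if zS: "z \<notin> ?S" for i j z
  proof -
    define h where "h z = p z * matrix_inv (A z) $ i $ j" for z
    have hle: "norm (h z) \<le> norm (p z) * norm (matrix_inv (A z) *v axis j 1)" for z
      unfolding h_def norm_mult
      by (subst matrix_entry_eq_axis) (intro mult_left_mono Finite_Cartesian_Product.norm_nth_le norm_ge_zero)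
    have hol: "h holomorphic_on - ?S"
      unfolding h_def p_def by (intro holomorphic_intros matrix_inv_holomorphic A)
    have bd: "\<exists>K. \<forall>\<^sub>F z in at s. z \<notin> ?S \<and> norm (h z) \<le> K" if s: "s \<in> ?S" for s
    proof -
      obtain c where c: "c > 0" "\<forall>\<^sub>F z in at s. \<forall>v. c * norm (z - s) * norm v \<le> norm (A z *v v)"
        using poles[OF s] by (auto simp: simple_pole_bound_def)
      have iso: "\<forall>\<^sub>F z in at s. z \<notin> ?S"
        by (rule simple_pole_bound_isolated[OF poles[OF s]])
      define q where "q z = (\<Prod>t\<in>?S - {s}. z - t)" for z
      have pq: "p z = (z - s) * q z" for z
        unfolding p_def q_def by (rule prod.remove[OF fin s])
      have "((\<lambda>z. norm (q z)) \<longlongrightarrow> norm (q s)) (at s)"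
        unfolding q_def by (intro tendsto_intros)
      then have "\<forall>\<^sub>F z in at s. norm (q z) < norm (q s) + 1"
        by (rule order_tendstoD) simp
      with c(2) iso have "\<forall>\<^sub>F z in at s. z \<notin> ?S \<and> norm (h z) \<le> (norm (q s) + 1) * (1 / c)"
      proof eventually_elim
        case (elim z)
        define v where "v = matrix_inv (A z) *v axis j 1"
        have "c * norm (z - s) * norm v \<le> norm (A z *v v)" using elim(1) by blast
        then have v: "norm (z - s) * norm v \<le> 1 / c"
          using col[OF elim(2)] c(1) by (simp add: v_def field_simps)
        have "norm (h z) \<le> norm (q z) * (norm (z - s) * norm v)"
          using hle[of z] by (simp add: v_def pq norm_mult mult_ac)
        also have "\<dots> \<le> (norm (q s) + 1) * (1 / c)"
          using v elim(3) by (intro mult_mono) auto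
        finally show ?case using elim(2) by simp
      qed
      then show ?thesis by blast
    qed
    obtain F where F: "F holomorphic_on UNIV" "\<And>z. z \<notin> ?S \<Longrightarrow> F z = h z"
      using bounded_singularities_extend[OF hol op bd] by metis
    have Fle: "norm (F (w\<^sup>2)) * exp \<bar>Im w\<bar> \<le> ((\<rho> n)\<^sup>2 + M) ^ N * (C * \<rho> n)"
      if n: "n \<ge> n0" and w: "norm w = \<rho> n" for n w
    proof -
      have zS: "w\<^sup>2 \<notin> ?S"
      proof
        assume "w\<^sup>2 \<in> ?S"
        then obtain v where v: "v \<noteq> 0" "A (w\<^sup>2) *v v = 0" by (auto simp: singular_points_def)
        then have "exp \<bar>Im w\<bar> * norm v \<le> 0" using circ[OF n w, of v] by simp
        moreover have "exp \<bar>Im w\<bar> * norm v > 0" using v(1) by simp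
        ultimately show False by simp
      qed
      define v where "v = matrix_inv (A (w\<^sup>2)) *v axis j 1"
      have v: "exp \<bar>Im w\<bar> * norm v \<le> C * \<rho> n"
        using circ[OF n w, of v] col[OF zS, of j] by (simp add: v_def)
      have "norm (F (w\<^sup>2)) * exp \<bar>Im w\<bar> \<le> norm (p (w\<^sup>2)) * norm v * exp \<bar>Im w\<bar>"
        unfolding F(2)[OF zS] v_def by (intro mult_right_mono hle) auto
      also have "\<dots> = norm (p (w\<^sup>2)) * (exp \<bar>Im w\<bar> * norm v)" by simp
      also have "\<dots> \<le> ((\<rho> n)\<^sup>2 + M) ^ N * (C * \<rho> n)"
      proof (rule mult_mono[OF _ v])
        show "norm (p (w\<^sup>2)) \<le> ((\<rho> n)\<^sup>2 + M) ^ N"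
          using ple[of "w\<^sup>2"] w by (simp add: norm_power)
        then show "0 \<le> ((\<rho> n)\<^sup>2 + M) ^ N"
          by (rule order_trans[OF norm_ge_zero])
      qed auto
      finally show ?thesis .
    qed
    define c where "c k = (deriv ^^ k) F 0 / fact k" for k
    have Fpoly: "F z = (\<Sum>k\<le>N. c k * z ^ k)" for z
    proof -
      have "F z = (\<Sum>k<Suc N. (deriv ^^ k) F 0 / fact k * z ^ k)"
      proof (rule Liouville_on_circles[OF F(1)])
        show "filterlim (\<lambda>n. (\<rho> n)\<^sup>2) at_top sequentially"
          by (rule filterlim_compose[OF _ \<rho>]) real_asymp
        show "norm (F z) \<le> ((\<rho> n)\<^sup>2 + M) ^ N * (C * \<rho> n)" if n: "n \<ge> n0" and z: "norm z = (\<rho> n)\<^sup>2" for n z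
        proof -
          have "norm (csqrt z) = \<bar>\<rho> n\<bar>"
            using z by (simp add: norm_csqrt real_sqrt_abs)
          then have w: "norm (csqrt z) = \<rho> n" using \<rho>0[of n] by simp
          have "norm (F z) * 1 \<le> norm (F z) * exp \<bar>Im (csqrt z)\<bar>"
            by (intro mult_left_mono) auto
          also have "\<dots> \<le> ((\<rho> n)\<^sup>2 + M) ^ N * (C * \<rho> n)"
            using Fle[of n "csqrt z"] n w by simp
          finally show ?thesis by simp
        qed
        have "((\<lambda>x. ((x\<^sup>2 + M) ^ N * (C * x)) / (x\<^sup>2) ^ Suc N) \<longlongrightarrow> 0) at_top"
        proof -
          have "((\<lambda>x::real. ((x\<^sup>2 + M) / x\<^sup>2) ^ N * (C * x / x\<^sup>2)) \<longlongrightarrow> 1 ^ N * 0) at_top"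
            by (intro tendsto_mult tendsto_power) real_asymp+
          then show ?thesis by (simp add: power_divide mult.commute[of _ "(_\<^sup>2) ^ N"])
        qed
        then show "(\<lambda>n. (((\<rho> n)\<^sup>2 + M) ^ N * (C * \<rho> n)) / ((\<rho> n)\<^sup>2) ^ Suc N) \<longlonglongrightarrow> 0"
          by (rule filterlim_compose[OF _ \<rho>])
      qed
      then show ?thesis by (simp only: lessThan_Suc_atMost c_def)
    qed
    \<comment> \<open>The point \<open>- \<rho>\<^sup>2\<close> is the square of \<open>w = \<i> \<rho>\<close>, for which \<open>|Im w| = \<rho>\<close>.\<close>
    have lim0: "(\<lambda>n. F (- (of_real (\<rho> n))\<^sup>2)) \<longlonglongrightarrow> 0"
    proof (rule Lim_null_comparison)
      show "\<forall>\<^sub>F n in sequentially. norm (F (- (of_real (\<rho> n))\<^sup>2)) \<le> ((\<rho> n)\<^sup>2 + M) ^ N * (C * \<rho> n) / exp (\<rho> n)"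
        using filterlim_at_top[THEN iffD1, OF \<rho>, rule_format, of 0] eventually_ge_at_top[of n0]
      proof eventually_elim
        case (elim n)
        have "norm (F ((\<i> * of_real (\<rho> n))\<^sup>2)) * exp \<bar>Im (\<i> * of_real (\<rho> n))\<bar> \<le> ((\<rho> n)\<^sup>2 + M) ^ N * (C * \<rho> n)"
          using elim by (intro Fle) (auto simp: norm_mult)
        then show ?case using elim by (simp add: power_mult_distrib field_simps)
      qed
      have "((\<lambda>x. (x\<^sup>2 + M) ^ N * (C * x) / exp x) \<longlongrightarrow> 0) at_top"
      proof (rule Lim_transform_eventually)
        have "((\<lambda>x::real. (x\<^sup>2 + M) / x\<^sup>2) \<longlongrightarrow> 1) at_top" by real_asymp
        then have "((\<lambda>x. ((x\<^sup>2 + M) / x\<^sup>2) ^ N * (C * (x ^ (2 * N + 1) / exp x))) \<longlongrightarrow> 1 ^ N * (C * 0)) at_top"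
          by (intro tendsto_intros tendsto_power_div_exp_0)
        then show "((\<lambda>x. ((x\<^sup>2 + M) / x\<^sup>2) ^ N * (C * (x ^ (2 * N + 1) / exp x))) \<longlongrightarrow> 0) at_top"
          by simp
        show "\<forall>\<^sub>F x in at_top. ((x\<^sup>2 + M) / x\<^sup>2) ^ N * (C * (x ^ (2 * N + 1) / exp x)) = (x\<^sup>2 + M) ^ N * (C * x) / exp x"
          using eventually_gt_at_top[of 0]
          by eventually_elim (simp add: power_divide power_mult)
      qed
      then show "(\<lambda>n. ((\<rho> n)\<^sup>2 + M) ^ N * (C * \<rho> n) / exp (\<rho> n)) \<longlonglongrightarrow> 0"
        by (rule filterlim_compose[OF _ \<rho>])
    qed
    have inf: "filterlim (\<lambda>n. - (complex_of_real (\<rho> n))\<^sup>2) at_infinity sequentially"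
    proof -
      have "filterlim (\<lambda>n. norm (- (complex_of_real (\<rho> n))\<^sup>2)) at_top sequentially"
        by (simp add: norm_power, rule filterlim_compose[OF _ \<rho>]) real_asymp
      then show ?thesis by (rule filterlim_norm_at_top_imp_at_infinity)
    qed
    have c0: "c k = 0" if "k \<noteq> 0" "k \<le> N" for k
    proof (rule ccontr)
      assume "c k \<noteq> 0"
      then have "\<forall>\<^sub>F z in at_infinity. norm (F z) \<ge> 1"
        unfolding Fpoly using that by (intro polyfun_extremal) auto
      then have "\<forall>\<^sub>F n in sequentially. norm (F (- (of_real (\<rho> n))\<^sup>2)) \<ge> 1"
        by (rule eventually_compose_filterlim[OF _ inf])
      moreover have "\<forall>\<^sub>F n in sequentially. norm (F (- (of_real (\<rho> n))\<^sup>2)) < 1"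
        using order_tendstoD(2)[OF tendsto_norm[OF lim0], of 1] by simp
      ultimately have "\<forall>\<^sub>F n in sequentially. False"
        by eventually_elim simp
      then show False by simp
    qed
    have Fc: "F z = c 0" for z
    proof -
      have "F z = (\<Sum>k\<in>{0}. c k * z ^ k)"
        unfolding Fpoly by (rule sum.mono_neutral_right) (auto simp: c0)
      then show ?thesis by simp
    qed
    then have "(\<lambda>n::nat. c 0) \<longlonglongrightarrow> 0" using lim0 by simp
    then have "c 0 = 0" by (simp add: LIMSEQ_const_iff)
    then have "h z = 0" using F(2)[OF zS] Fc by simp
    moreover have "p z \<noteq> 0" using zS fin by (auto simp: p_def)
    ultimately show ?thesis by (simp add: h_def)
  qed
  have "\<exists>z. z \<notin> ?S" using fin ex_new_if_finite[OF infinite_UNIV_char_0] by blast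
  then obtain z where z: "z \<notin> ?S" by blast
  have "matrix_inv (A z) = 0" using entry[OF z] by (simp add: vec_eq_iff)
  then have "(mat 1 :: complex^'n^'n) = 0"
    using z matrix_inv_mult(2)[of "A z"] by (simp add: invertible_off_singular_points mat_mat.zero_right)
  then show False
    by (auto simp: vec_eq_iff mat_def split: if_splits)
qed

text \<open>
  In terms of the difference quotient \<open>D\<close> of \<open>A\<close> at \<open>a\<close> the relation reads \<open>B - A = R D\<close>. Its limit is
  \<open>B(a) - A(a) = R A'(a)\<close>, and its difference quotient shows \<open>B'(a) u - A'(a) u \<in> Ran R\<close>, because
  \<open>Ran R\<close> is closed. Finally \<open>Ran R \<subseteq> Ran B(a)\<close>: both inverses have simple poles, so
  \<open>B\<^sup>-\<^sup>1 R x = (z - a) (A\<^sup>-\<^sup>1 x - B\<^sup>-\<^sup>1 x)\<close> is bounded near \<open>a\<close>.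
\<close>

lemma range_inclusion_of_single_pole_quotient:
  fixes A B :: "complex \<Rightarrow> complex^'n^'n"
  assumes A: "entire_matrix A" and B: "entire_matrix B"
    and R: "\<And>z. mat (z - a) ** (B z - A z) = R ** A z"
    and sA: "simple_pole_bound A a" and sB: "simple_pole_bound B a"
    and u: "matrix_deriv A a *v u \<in> range ((*v) (A a))"
  shows "matrix_deriv B a *v u \<in> range ((*v) (B a))"
proof -
  let ?D = "\<lambda>z. mat (1 / (z - a)) ** (A z - A a)"
  have ne: "\<forall>\<^sub>F z in at a. z \<noteq> a" by (simp add: eventually_at_filter)
  have RA0: "R ** A a = 0"
    using R[of a] by (simp add: vec_eq_iff mat_matrix_mult_nth)
  have diff: "B z - A z = R ** ?D z" if "z \<noteq> a" for z
  proof -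
    have "R ** ?D z = mat (1 / (z - a)) ** (R ** A z)"
      by (simp add: mat_mult_left_commute[symmetric] mat_mat.diff_right RA0)
    also have "\<dots> = B z - A z"
      unfolding R[symmetric] using that by (simp add: vec_eq_iff mat_matrix_mult_nth)
    finally show ?thesis by simp
  qed
  have "((\<lambda>z. R ** ?D z) \<longlongrightarrow> R ** matrix_deriv A a) (at a)"
    by (intro mat_mat.tendsto tendsto_const tendsto_matrix_deriv A)
  moreover have "((\<lambda>z. R ** ?D z) \<longlongrightarrow> B a - A a) (at a)"
  proof (rule Lim_transform_eventually)
    show "((\<lambda>z. B z - A z) \<longlongrightarrow> B a - A a) (at a)"
      by (intro tendsto_diff tendsto_entire_matrix A B)
    show "\<forall>\<^sub>F z in at a. B z - A z = R ** ?D z"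
      using ne by eventually_elim (rule diff)
  qed
  ultimately have BA: "B a - A a = R ** matrix_deriv A a"
    using LIM_unique by blast
  have ran: "R *v x \<in> range ((*v) (B a))" for x
  proof -
    obtain c where c: "c > 0" "\<forall>\<^sub>F z in at a. \<forall>v. c * norm (z - a) * norm v \<le> norm (A z *v v)"
      using sA by (auto simp: simple_pole_bound_def)
    obtain d where d: "d > 0" "\<forall>\<^sub>F z in at a. \<forall>v. d * norm (z - a) * norm v \<le> norm (B z *v v)"
      using sB by (auto simp: simple_pole_bound_def)
    \<comment> \<open>As \<open>q\<close> is bounded and \<open>B(z) q(z) = R x\<close>, the vectors \<open>B(a) q(z)\<close> in \<open>Ran B(a)\<close> tend to \<open>R x\<close>.\<close>
    define q where "q z = (z - a) *s (matrix_inv (A z) *v x - matrix_inv (B z) *v x)" for z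
    have ev: "\<forall>\<^sub>F z in at a. B z *v q z = R *v x \<and> norm (q z) \<le> norm x / c + norm x / d"
      using c(2) d(2) ne simple_pole_bound_isolated[OF sA] simple_pole_bound_isolated[OF sB]
    proof eventually_elim
      case (elim z)
      define v where "v = matrix_inv (A z) *v x"
      define w where "w = matrix_inv (B z) *v x"
      have Av: "A z *v v = x" and Bw: "B z *v w = x"
        using elim by (auto simp: v_def w_def invertible_off_singular_points matrix_inv_mult(1))
      have "B z *v q z = (z - a) *s (B z *v v - x)"
        by (simp add: q_def matrix_vector_smult matrix_vector_mult_diff_distrib Bw flip: v_def w_def)
      also have "\<dots> = (mat (z - a) ** (B z - A z)) *v v"
        by (simp add: mat_mult_matrix_vec matrix_vector_mult_diff_rdistrib Av)
      also have "\<dots> = R *v x"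
        by (simp add: R Av flip: matrix_vector_mul_assoc)
      finally have 1: "B z *v q z = R *v x" .
      have "c * norm (z - a) * norm v \<le> norm x" "d * norm (z - a) * norm w \<le> norm x"
        using elim(1,2) Av Bw by metis+
      then have "norm (z - a) * norm v \<le> norm x / c" "norm (z - a) * norm w \<le> norm x / d"
        using c(1) d(1) by (simp_all add: field_simps)
      moreover have "norm (q z) \<le> norm (z - a) * norm v + norm (z - a) * norm w"
        unfolding q_def norm_smult_vec v_def[symmetric] w_def[symmetric] distrib_left[symmetric]
        by (intro mult_left_mono norm_triangle_ineq4) auto
      ultimately show ?case using 1 by simp
    qed
    have "((\<lambda>z. norm (B z - B a) * (norm x / c + norm x / d)) \<longlongrightarrow> 0) (at a)"
      by (rule tendsto_mult_left_zero[OF tendsto_norm_zero[OF LIM_zero[OF tendsto_entire_matrix[OF B]]]])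
    moreover have "\<forall>\<^sub>F z in at a. norm (B a *v q z - R *v x) \<le> norm (B z - B a) * (norm x / c + norm x / d)"
      using ev
    proof eventually_elim
      case (elim z)
      have "B a *v q z - R *v x = - ((B z - B a) *v q z)"
        using elim by (simp add: matrix_vector_mult_diff_rdistrib)
      then have "norm (B a *v q z - R *v x) = norm ((B z - B a) *v q z)" by simp
      also have "\<dots> \<le> norm (B z - B a) * (norm x / c + norm x / d)"
        using elim by (intro order_trans[OF norm_matrix_vector_mult_le mult_left_mono]) auto
      finally show ?case .
    qed
    ultimately have "((\<lambda>z. B a *v q z - R *v x) \<longlongrightarrow> 0) (at a)"
      by (rule Lim_null_comparison[rotated])
    then have "((\<lambda>z. B a *v q z) \<longlongrightarrow> R *v x) (at a)" by (rule LIM_zero_cancel)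
    then show ?thesis
      by (rule Lim_in_closed_set[OF range_mult_closed, rotated 2]) (auto simp: trivial_limit_at)
  qed
  have "((\<lambda>z. R *v ((mat (1 / (z - a)) ** (?D z - matrix_deriv A a)) *v u)) \<longlongrightarrow> matrix_deriv B a *v u - matrix_deriv A a *v u) (at a)"
  proof (rule Lim_transform_eventually)
    show "((\<lambda>z. (mat (1 / (z - a)) ** (B z - B a)) *v u - ?D z *v u) \<longlongrightarrow> matrix_deriv B a *v u - matrix_deriv A a *v u) (at a)"
      by (intro tendsto_diff mat_vec.tendsto tendsto_const tendsto_matrix_deriv A B)
    show "\<forall>\<^sub>F z in at a. (mat (1 / (z - a)) ** (B z - B a)) *v u - ?D z *v u =
        R *v ((mat (1 / (z - a)) ** (?D z - matrix_deriv A a)) *v u)"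
      using ne
    proof eventually_elim
      case (elim z)
      have "B z - B a = (A z - A a) + R ** (?D z - matrix_deriv A a)"
      proof -
        have "B z - B a = (A z - A a) + ((B z - A z) - (B a - A a))" by simp
        then show ?thesis
          unfolding diff[OF elim] BA by (simp only: mat_mat.diff_right)
      qed
      then have "mat (1 / (z - a)) ** (B z - B a) = ?D z + R ** (mat (1 / (z - a)) ** (?D z - matrix_deriv A a))"
        by (simp add: matrix_add_ldistrib mat_mult_left_commute)
      then show ?case
        by (simp add: matrix_vector_mult_add_rdistrib matrix_vector_mul_assoc)
    qed
  qed
  then have "matrix_deriv B a *v u - matrix_deriv A a *v u \<in> range ((*v) R)"
    by (rule Lim_in_closed_set[OF range_mult_closed, rotated 2]) (auto simp: trivial_limit_at)
  then obtain y where y: "matrix_deriv B a *v u = matrix_deriv A a *v u + R *v y"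
    by (auto simp: algebra_simps)
  obtain v where v: "matrix_deriv A a *v u = A a *v v" using u by blast
  have Av: "A a *v v = B a *v v - R *v (matrix_deriv A a *v v)"
  proof -
    have "(B a - A a) *v v = R *v (matrix_deriv A a *v v)"
      by (simp add: BA matrix_vector_mul_assoc)
    then show ?thesis by (simp add: matrix_vector_mult_diff_rdistrib algebra_simps)
  qed
  obtain x where x: "R *v (y - matrix_deriv A a *v v) = B a *v x" using ran by blast
  have "matrix_deriv B a *v u = B a *v (v + x)"
    using y v Av x by (simp add: matrix_vector_right_distrib matrix_vector_mult_diff_distrib algebra_simps)
  then show ?thesis by blast
qed

section \<open>The spectrum and the forbidden subspace\<close>

text \<open>
  Both the existence and the uniqueness come from the rank of \<open>x\<close>, the number of elements of \<open>X\<close> below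
  it: it is an order isomorphism from \<open>X\<close> onto the natural numbers.
\<close>

lemma increasing_enumeration:
  fixes X :: "real set"
  assumes inf: "infinite X" and fin: "\<And>r. finite (X \<inter> {..r})"
  shows "\<exists>!l :: nat \<Rightarrow> real. strict_mono l \<and> range l = X"
proof -
  define rank where "rank x = card {y \<in> X. y < x}" for x
  have fl: "finite {y \<in> X. y < x}" for x
    by (rule finite_subset[OF _ fin[of x]]) auto
  have mono: "rank x < rank y" if "x \<in> X" "x < y" for x y
    unfolding rank_def using that by (intro psubset_card_mono fl) auto
  have inj: "x = y" if "x \<in> X" "y \<in> X" "rank x = rank y" for x y
    using mono[of x y] mono[of y x] that by (cases x y rule: linorder_cases) auto
  have next_elem: "\<exists>x\<in>X. rank x = card Y" if Y: "Y \<subseteq> X" "finite Y" "\<And>x y. x \<in> X \<Longrightarrow> y \<in> Y \<Longrightarrow> x \<le> y \<Longrightarrow> x \<in> Y" for Y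
  proof -
    have "infinite (X - Y)" using inf Y(2) by (simp add: Diff_infinite_finite)
    then obtain x0 where x0: "x0 \<in> X - Y" by (metis finite.emptyI equals0I)
    define Z where "Z = (X - Y) \<inter> {..x0}"
    have Z: "finite Z" "Z \<noteq> {}"
      using x0 by (auto simp: Z_def intro: finite_subset[OF _ fin[of x0]])
    define m where "m = Min Z"
    have m: "m \<in> Z" "\<And>y. y \<in> Z \<Longrightarrow> m \<le> y"
      using Z by (auto simp: m_def)
    have mX: "m \<in> X" "m \<notin> Y" "m \<le> x0" using m(1) by (auto simp: Z_def)
    have "{y \<in> X. y < m} = Y"
    proof (intro set_eqI iffI)
      fix y assume y: "y \<in> {y \<in> X. y < m}"
      show "y \<in> Y"
      proof (rule ccontr)
        assume "y \<notin> Y"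
        then have "y \<in> Z" using y mX by (auto simp: Z_def)
        then show False using m(2)[of y] y by simp
      qed
    next
      fix y assume y: "y \<in> Y"
      then have "\<not> m \<le> y" using Y(3)[OF mX(1) y] mX(2) by blast
      then show "y \<in> {y \<in> X. y < m}" using y Y(1) by auto
    qed
    then show ?thesis using mX(1) by (auto simp: rank_def)
  qed
  have surj: "\<exists>x\<in>X. rank x = n" for n
  proof (induction n)
    case 0
    show ?case using next_elem[of "{}"] by simp
  next
    case (Suc n)
    then obtain x where x: "x \<in> X" "rank x = n" by blast
    have "card (insert x {y \<in> X. y < x}) = Suc n"
      using fl x(2) by (simp add: rank_def)
    moreover have "\<exists>x'\<in>X. rank x' = card (insert x {y \<in> X. y < x})"
      by (rule next_elem) (use x(1) fl in \<open>auto simp: order.order_iff_strict\<close>)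
    ultimately show ?case by simp
  qed
  define l where "l n = (THE x. x \<in> X \<and> rank x = n)" for n
  have l: "l n \<in> X" "rank (l n) = n" for n
  proof -
    have "\<exists>!x. x \<in> X \<and> rank x = n" using surj[of n] inj by metis
    from theI'[OF this] show "l n \<in> X" "rank (l n) = n" by (simp_all add: l_def)
  qed
  have sm: "strict_mono l"
  proof (rule strict_monoI)
    fix m n :: nat assume "m < n"
    then show "l m < l n"
      using mono[of "l n" "l m"] l by (metis less_irrefl linorder_neqE order_less_trans)
  qed
  have ran: "range l = X"
  proof
    show "range l \<subseteq> X" using l by auto
    show "X \<subseteq> range l" using l inj by (metis rangeI subsetI)
  qed
  show ?thesis
  proof (rule ex1I[of _ l])
    show "strict_mono l \<and> range l = X" using sm ran by blast
    fix k :: "nat \<Rightarrow> real" assume k: "strict_mono k \<and> range k = X"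
    have "rank (k n) = n" for n
    proof -
      have "{y \<in> X. y < k n} = k ` {..<n}"
        using k strict_mono_less[of k] by auto
      moreover have "inj_on k {..<n}"
        using k strict_mono_imp_inj_on by (meson inj_on_subset subset_UNIV)
      ultimately show ?thesis by (simp add: rank_def card_image)
    qed
    then have "k n = l n" for n
      using k by (intro inj l(1)) (auto simp: l(2))
    then show "k = l" by (rule ext)
  qed
qed

lemma singular_points_phi:
  assumes V: "hermitian_potential V"
  shows "singular_points (\<lambda>z. phi V z 1) = of_real ` eigenvalues V"
proof (intro set_eqI iffI)
  note Va = hermitian_potentialD(1)[OF V]
  fix z assume "z \<in> singular_points (\<lambda>z. phi V z 1)"
  then obtain h where h: "h \<noteq> 0" "phi V z 1 *v h = 0" by (auto simp: singular_points_def)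
  then have "Im z = 0" using phi_injective_nonreal[OF V] by blast
  then have "z = of_real (Re z)" by (simp add: complex_eq_iff)
  then show "z \<in> of_real ` eigenvalues V"
    using h eigenvalues_eq[OF Va] by (metis (mono_tags, lifting) imageI mem_Collect_eq)
next
  fix z assume "z \<in> complex_of_real ` eigenvalues V"
  then show "z \<in> singular_points (\<lambda>z. phi V z 1)"
    using eigenvalues_eq[OF hermitian_potentialD(1)[OF V]] by (auto simp: singular_points_def)
qed

text \<open>
  Positive definiteness of \<open>S\<^sub>\<alpha>\<close>, in the form that yields transversality of \<open>\<E>\<^sub>\<alpha>\<close> and \<open>\<F>\<^sub>\<alpha>\<close>.
\<close>

lemma phi_deriv_injective_on_kernel:
  assumes V: "hermitian_potential V" and a: "a \<in> \<real>"
    and u: "phi V a 1 *v u = 0" and orth: "cinner (matrix_deriv (\<lambda>z. phi V z 1) a *v u) (phi_deriv V a 1 *v u) = 0"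
  shows "u = 0"
  using phi_gram_zero_imp[OF hermitian_potentialD(1)[OF V]] phi_derivative_gram[OF V a u, of u] orth by simp

lemma phi_simple_pole_bound:
  assumes V: "hermitian_potential V" and a: "a \<in> \<real>"
  shows "simple_pole_bound (\<lambda>z. phi V z 1) a"
proof (rule simple_pole_boundI[OF entire_matrix_phi[OF hermitian_potentialD(1)[OF V]]])
  fix u w
  assume u: "phi V a 1 *v u = 0" and w: "matrix_deriv (\<lambda>z. phi V z 1) a *v u = phi V a 1 *v w"
  show "u = 0"
    by (rule phi_deriv_injective_on_kernel[OF V a u]) (simp add: w phi_range_orthogonal[OF V a u])
qed

lemma dim_kernel_eq_dim_range_comp:
  fixes f :: "'a::euclidean_space \<Rightarrow> 'a"
  assumes f: "linear f"
  shows "dim {x. f x = 0} = dim ((range f)\<^sup>\<bottom>)"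
proof -
  let ?N = "{x. f x = 0}"
  have sN: "subspace ?N" using f by (rule linear_subspace_kernel)
  have sR: "subspace (range f)" using f by (intro linear_subspace_image subspace_UNIV)
  have comp: "dim (U\<^sup>\<bottom>) + dim U = DIM('a)" if "subspace U" for U :: "'a set"
    using dim_subspace_orthogonal_to_vectors[OF that subspace_UNIV] by (simp add: orthogonal_comp_def)
  \<comment> \<open>On the complement of its kernel \<open>f\<close> is a bijection onto its range.\<close>
  have "range f = f ` (?N\<^sup>\<bottom>)"
  proof
    show "range f \<subseteq> f ` (?N\<^sup>\<bottom>)"
    proof (intro image_subsetI)
      fix x
      obtain p q where "x = p + q" "p \<in> ?N" "q \<in> ?N\<^sup>\<bottom>"
        using subspace_sum_orthogonal_comp[OF sN] by (metis UNIV_I set_plus_elim)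
      then show "f x \<in> f ` (?N\<^sup>\<bottom>)" using f by (auto simp: linear_add)
    qed
  qed auto
  moreover have "inj_on f (span (?N\<^sup>\<bottom>))"
  proof -
    have "inj_on f (?N\<^sup>\<bottom>)"
    proof (rule inj_onI)
      fix x y assume xy: "x \<in> ?N\<^sup>\<bottom>" "y \<in> ?N\<^sup>\<bottom>" "f x = f y"
      then have "x - y \<in> ?N \<inter> ?N\<^sup>\<bottom>"
        using f subspace_diff[OF subspace_orthogonal_comp] by (auto simp: linear_diff)
      then show "x = y" using orthogonal_Int_0[OF sN] by simp
    qed
    then show ?thesis by (simp add: span_eq_iff[THEN iffD2, OF subspace_orthogonal_comp])
  qed
  ultimately have "dim (range f) = dim (?N\<^sup>\<bottom>)"
    using dim_image_eq[OF f] by metis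
  then show ?thesis using comp[OF sN] comp[OF sR] by simp
qed

text \<open>
  The vectors \<open>\<partial>\<^sub>x\<phi>(1, a) h\<close> with \<open>h\<close> in the kernel of \<open>\<phi>(1, a)\<close> are orthogonal to the range of
  \<open>\<phi>(1, a)\<close>; since \<open>\<partial>\<^sub>x\<phi>(1, a)\<close> is injective on the kernel, they have the right dimension to fill its
  orthogonal complement. Complex subspaces have the same orthogonal complement for the Hermitian form
  and for its real part, so real dimensions may be counted.
\<close>

lemma phi_range_eq:
  fixes V :: "real \<Rightarrow> complex^'n^'n"
  assumes V: "hermitian_potential V" and a: "a \<in> \<real>"
  shows "y \<in> range ((*v) (phi V a 1)) \<longleftrightarrow> (\<forall>h. phi V a 1 *v h = 0 \<longrightarrow> cinner y (phi_deriv V a 1 *v h) = 0)"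
proof
  assume "y \<in> range ((*v) (phi V a 1))"
  then show "\<forall>h. phi V a 1 *v h = 0 \<longrightarrow> cinner y (phi_deriv V a 1 *v h) = 0"
    using phi_range_orthogonal[OF V a] by auto
next
  assume y: "\<forall>h. phi V a 1 *v h = 0 \<longrightarrow> cinner y (phi_deriv V a 1 *v h) = 0"
  let ?f = "(*v) (phi V a 1)" and ?k = "(*v) (phi_deriv V a 1)"
  have lin: "linear ((*v) M)" for M :: "complex^'n^'n"
    by (rule bounded_linear.linear[OF matrix_vector_mul_bounded_linear])
  have sE: "subspace {h. ?f h = 0}" by (rule linear_subspace_kernel[OF lin])
  have sR: "subspace (range ?f)" by (intro linear_subspace_image lin subspace_UNIV)
  have sK: "subspace (?k ` {h. ?f h = 0})" by (intro linear_subspace_image lin sE)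
  have sub: "?k ` {h. ?f h = 0} \<subseteq> (range ?f)\<^sup>\<bottom>"
    using phi_range_orthogonal[OF V a] by (auto simp: orthogonal_comp_def orthogonal_def simp flip: Re_cinner)
  have "inj_on ?k (span {h. ?f h = 0})"
    unfolding span_eq_iff[THEN iffD2, OF sE]
  proof (rule inj_onI)
    fix g h assume gh: "g \<in> {h. ?f h = 0}" "h \<in> {h. ?f h = 0}" "?k g = ?k h"
    have "g - h = 0"
      by (rule phi_deriv_injective_on_kernel[OF V a])
         (use gh in \<open>simp_all add: matrix_vector_mult_diff_distrib cinner.zero_right\<close>)
    then show "g = h" by simp
  qed
  then have "dim (?k ` {h. ?f h = 0}) = dim {h. ?f h = 0}"
    by (rule dim_image_eq[OF lin])
  then have "dim (?k ` {h. ?f h = 0}) = dim ((range ?f)\<^sup>\<bottom>)"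
    using dim_kernel_eq_dim_range_comp[OF lin] by metis
  then have eq: "?k ` {h. ?f h = 0} = (range ?f)\<^sup>\<bottom>"
    by (intro subspace_dim_equal[OF sK subspace_orthogonal_comp sub]) simp
  have "y \<in> (?k ` {h. ?f h = 0})\<^sup>\<bottom>"
    using y by (auto simp: orthogonal_comp_def orthogonal_def inner_commute simp flip: Re_cinner)
  then show "y \<in> range ?f"
    unfolding eq orthogonal_comp_self[OF sR] .
qed

text \<open>
  This describes \<open>\<F>\<^sub>\<alpha>\<close> by the function \<open>z \<mapsto> \<phi>(1, z)\<close> near \<open>\<lambda>\<^sub>\<alpha>\<close> alone.
\<close>

lemma F_space_eq:
  fixes V :: "real \<Rightarrow> complex^'n^'n" and \<alpha> :: nat
  assumes V: "hermitian_potential V"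
  defines "a \<equiv> complex_of_real (eigval V \<alpha>)"
  shows "F_space V \<alpha> = {u. matrix_deriv (\<lambda>z. phi V z 1) a *v u \<in> range ((*v) (phi V a 1))}"
proof -
  note Va = hermitian_potentialD(1)[OF V]
  have a: "a \<in> \<real>" by (simp add: a_def)
  have key: "cinner u (S_mat V \<alpha> *v h) = cinner (matrix_deriv (\<lambda>z. phi V z 1) a *v u) (phi_deriv V a 1 *v h)"
    if h: "phi V a 1 *v h = 0" for u h
  proof -
    have "cinner u (S_mat V \<alpha> *v h) = cnj (cinner (S_mat V \<alpha> *v h) u)" by (simp add: cinner_commute)
    also have "\<dots> = cnj (integral {0..1} (\<lambda>t. cinner (phi V a t *v h) (phi V a t *v u)))"
      unfolding S_mat_def a_def[symmetric] S_mat_cinner[OF Va] ..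
    also have "\<dots> = integral {0..1} (\<lambda>t. cnj (cinner (phi V a t *v h) (phi V a t *v u)))"
      using integral_linear[OF integrable_continuous_real[OF cinner_phi_integrable[OF Va, of a h a u]] bounded_linear_cnj]
      by (simp add: o_def)
    also have "\<dots> = cinner (matrix_deriv (\<lambda>z. phi V z 1) a *v u) (phi_deriv V a 1 *v h)"
      by (simp add: cinner_commute phi_derivative_gram[OF V a h])
    finally show ?thesis .
  qed
  show ?thesis
    unfolding F_space_def orth_compl_def E_space_def phi_range_eq[OF V a]
    using key by (auto simp flip: a_def)
qed

text \<open>
  Far out on the negative half-axis \<open>sin w / w\<close> dominates the error term, so the spectrum is bounded
  below; and singular points do not accumulate because each of them is isolated.
\<close>

lemma eigenvalues_locally_finite:
  assumes V: "hermitian_potential V"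
  shows "finite (eigenvalues V \<inter> {..r})"
proof -
  note Va = hermitian_potentialD(1)[OF V]
  let ?A = "\<lambda>z. phi V z 1"
  obtain C where C: "C > 0" "\<And>w. norm w \<ge> C \<Longrightarrow>
    norm (phi V (w\<^sup>2) 1 - mat (sin w / w)) \<le> C * exp \<bar>Im w\<bar> / (norm w)\<^sup>2"
    using phi_asymptotics[OF Va] by blast
  \<comment> \<open>From this \<open>|w|\<close> on the error \<open>C exp |Im w| / |w|\<^sup>2\<close> is smaller than \<open>|sin w / w|\<close>.\<close>
  define k where "k = 8 * C + 1"
  have lower: "l \<ge> - k\<^sup>2" if l: "l \<in> eigenvalues V" for l
  proof (rule ccontr)
    assume "\<not> l \<ge> - k\<^sup>2"
    then have "k\<^sup>2 < - l" by simp
    define x where "x = sqrt (- l)"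
    have k1: "k \<ge> 1" using C(1) by (simp add: k_def)
    have xk: "x > k" unfolding x_def using \<open>k\<^sup>2 < - l\<close> by (rule real_less_rsqrt)
    have l0: "l < 0" using \<open>k\<^sup>2 < - l\<close> zero_le_power2[of k] by linarith
    define w where "w = \<i> * complex_of_real x"
    have w2: "w\<^sup>2 = of_real l"
      using l0 by (simp add: w_def power_mult_distrib x_def flip: of_real_power)
    have nw: "norm w = x" "\<bar>Im w\<bar> = x" using xk k1 by (simp_all add: w_def norm_mult)
    obtain h where h: "h \<noteq> 0" "phi V (of_real l) 1 *v h = 0"
      using l eigenvalues_eq[OF Va] by auto
    have "norm ((sin w / w) *s h) = norm ((phi V (w\<^sup>2) 1 - mat (sin w / w)) *v h)"
      using h by (simp add: w2 matrix_vector_mult_diff_rdistrib mat_mult_vec)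
    also have "\<dots> \<le> C * exp \<bar>Im w\<bar> / (norm w)\<^sup>2 * norm h"
      by (rule order_trans[OF norm_matrix_vector_mult_le mult_right_mono[OF C(2)]])
         (use xk C(1) in \<open>auto simp: nw k_def\<close>)
    finally have "norm (sin w) / x \<le> C * exp x / x\<^sup>2"
      unfolding norm_smult_vec norm_divide nw
      by (rule mult_right_le_imp_le) (use h(1) in simp)
    moreover have "exp x \<le> 8 * norm (sin w)"
      using exp_le_norm_sin_off_axis[of w] xk k1 by (simp add: nw)
    moreover have "x * norm (sin w) \<le> C * exp x"
      using calculation(1) xk k1 by (simp add: field_simps power2_eq_square)
    moreover have "x * exp x \<le> x * (8 * norm (sin w))"
      using calculation(2) xk k1 by (intro mult_left_mono) auto
    ultimately have "x * exp x \<le> (8 * C) * exp x"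
      by linarith
    then have "x \<le> 8 * C" by simp
    then show False using xk by (simp add: k_def)
  qed
  have "\<not> z islimpt singular_points ?A" for z
  proof -
    have "\<forall>\<^sub>F y in at z. y \<notin> singular_points ?A"
    proof (cases "z \<in> singular_points ?A")
      case True
      then have "z \<in> \<real>" using singular_points_phi[OF V] by auto
      then show ?thesis by (intro simple_pole_bound_isolated phi_simple_pole_bound V)
    next
      case False
      then show ?thesis
        using eventually_at_topological open_nonsingular_points[OF entire_matrix_phi[OF Va]] by blast
    qed
    then show ?thesis by (simp add: islimpt_iff_eventually)
  qed
  then have "finite (cball 0 (\<bar>r\<bar> + k\<^sup>2) \<inter> singular_points ?A)"
    by (intro finite_not_islimpt_in_compact) auto
  moreover have "complex_of_real ` (eigenvalues V \<inter> {..r}) \<subseteq> cball 0 (\<bar>r\<bar> + k\<^sup>2) \<inter> singular_points ?A"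
    unfolding singular_points_phi[OF V]
  proof (intro image_subsetI IntI imageI)
    fix l assume "l \<in> eigenvalues V \<inter> {..r}"
    then have "- k\<^sup>2 \<le> l" "l \<le> r" "l \<in> eigenvalues V" using lower[of l] by auto
    then have "\<bar>l\<bar> \<le> \<bar>r\<bar> + k\<^sup>2" using zero_le_power2[of k] by linarith
    then show "complex_of_real l \<in> cball 0 (\<bar>r\<bar> + k\<^sup>2)" by simp
  qed auto
  ultimately have "finite (complex_of_real ` (eigenvalues V \<inter> {..r}))"
    by (rule finite_subset[rotated])
  then show ?thesis
    by (rule finite_imageD) (simp add: inj_on_def)
qed

text \<open>
  The lower bounds on the circles are exactly the growth condition that excludes a finite spectrum.
\<close>

lemma eigenvalues_infinite:
  fixes V :: "real \<Rightarrow> complex^'n^'n"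
  assumes V: "hermitian_potential V"
  shows "infinite (eigenvalues V)"
proof -
  note Va = hermitian_potentialD(1)[OF V]
  obtain C n0 where on: "\<And>n w (v::complex^'n). n \<ge> n0 \<Longrightarrow> norm w = dirichlet_radius n \<Longrightarrow>
     norm (sin w / w) * norm v \<le> 2 * norm (phi V (w\<^sup>2) 1 *v v)"
    "\<And>n w. n \<ge> n0 \<Longrightarrow> norm w = dirichlet_radius n \<Longrightarrow>
     exp \<bar>Im w\<bar> \<le> 8 * dirichlet_radius n * norm (sin w / w)"
    using phi_on_circles[OF Va] by metis
  have "infinite (singular_points (\<lambda>z. phi V z 1))"
  proof (rule singular_points_infinite[OF entire_matrix_phi[OF Va] _ filterlim_dirichlet_radius dirichlet_radius_pos])
    show "simple_pole_bound (\<lambda>z. phi V z 1) s" if "s \<in> singular_points (\<lambda>z. phi V z 1)" for s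
      using that unfolding singular_points_phi[OF V] by (intro phi_simple_pole_bound V) auto
    fix n and w :: complex and v :: "complex^'n"
    assume n: "n \<ge> n0" and w: "norm w = dirichlet_radius n"
    have "exp \<bar>Im w\<bar> * norm v \<le> 8 * dirichlet_radius n * norm (sin w / w) * norm v"
      by (intro mult_right_mono on(2)[OF n w]) auto
    also have "\<dots> = 8 * dirichlet_radius n * (norm (sin w / w) * norm v)" by simp
    also have "\<dots> \<le> 8 * dirichlet_radius n * (2 * norm (phi V (w\<^sup>2) 1 *v v))"
      using dirichlet_radius_pos[of n] by (intro mult_left_mono on(1)[OF n w]) auto
    finally show "exp \<bar>Im w\<bar> * norm v \<le> 16 * dirichlet_radius n * norm (phi V (w\<^sup>2) 1 *v v)" by simp
  qed
  then show ?thesis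
    unfolding singular_points_phi[OF V] by (meson finite_imageI)
qed

lemma range_eigval:
  assumes V: "hermitian_potential V"
  shows "eigval V ` {1..} = eigenvalues V" "inj_on (eigval V) {1..}"
proof -
  let ?l = "THE l :: nat \<Rightarrow> real. strict_mono l \<and> range l = eigenvalues V"
  have l: "strict_mono ?l" "range ?l = eigenvalues V"
    using theI'[OF increasing_enumeration[OF eigenvalues_infinite[OF V] eigenvalues_locally_finite[OF V]]] by auto
  have eq: "eigval V = (\<lambda>\<alpha>. ?l (\<alpha> - 1))" by (simp add: eigval_def fun_eq_iff)
  have "(\<lambda>\<alpha>. \<alpha> - 1) ` {1..} = (UNIV :: nat set)"
    by (auto simp: image_iff intro!: bexI[of _ "Suc _"])
  then show "eigval V ` {1..} = eigenvalues V"
    using l(2) unfolding eq by (metis image_image)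
  show "inj_on (eigval V) {1..}"
    unfolding eq using strict_mono_eq[OF l(1)] by (auto simp: inj_on_def)
qed

lemma isospectral_F_space_subset:
  assumes V: "hermitian_potential V" and W: "hermitian_potential W"
    and ev: "\<And>\<beta>. \<beta> \<ge> 1 \<Longrightarrow> eigval W \<beta> = eigval V \<beta>" and \<alpha>: "\<alpha> \<ge> 1"
    and E: "\<And>\<beta>. \<beta> \<ge> 1 \<Longrightarrow> \<beta> \<noteq> \<alpha> \<Longrightarrow> E_space W \<beta> = E_space V \<beta>"
  shows "F_space V \<alpha> \<subseteq> F_space W \<alpha>"
proof -
  note Va = hermitian_potentialD(1)[OF V] and Wa = hermitian_potentialD(1)[OF W]
  let ?A = "\<lambda>z. phi V z 1" and ?B = "\<lambda>z. phi W z 1"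
  define a where "a = complex_of_real (eigval V \<alpha>)"
  have a: "a \<in> \<real>" and aW: "a = complex_of_real (eigval W \<alpha>)" by (simp_all add: a_def ev[OF \<alpha>])
  note eA = entire_matrix_phi[OF Va] and eB = entire_matrix_phi[OF Wa]
  obtain C n0 where V1: "C > 0" "\<And>n w. n \<ge> n0 \<Longrightarrow> norm w = dirichlet_radius n \<Longrightarrow>
     norm (phi V (w\<^sup>2) 1 - mat (sin w / w)) \<le> C / dirichlet_radius n * norm (sin w / w)"
    "\<And>n w v. n \<ge> n0 \<Longrightarrow> norm w = dirichlet_radius n \<Longrightarrow>
     norm (sin w / w) * norm v \<le> 2 * norm (phi V (w\<^sup>2) 1 *v v)"
    "\<And>n w. n \<ge> n0 \<Longrightarrow> norm w = dirichlet_radius n \<Longrightarrow>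
     exp \<bar>Im w\<bar> \<le> 8 * dirichlet_radius n * norm (sin w / w)"
    by (rule phi_on_circles[OF Va]) (rule that; assumption)
  obtain C' n0' where W1: "C' > 0" "\<And>n w. n \<ge> n0' \<Longrightarrow> norm w = dirichlet_radius n \<Longrightarrow>
     norm (phi W (w\<^sup>2) 1 - mat (sin w / w)) \<le> C' / dirichlet_radius n * norm (sin w / w)"
    by (rule phi_on_circles[OF Wa]) (rule that; assumption)
  have csq: "norm (csqrt z) = dirichlet_radius n" if "norm z = (dirichlet_radius n)\<^sup>2" for z n
    using that dirichlet_radius_pos[of n] by (simp add: norm_csqrt)
  obtain R where R: "\<And>z. mat (z - a) ** (?B z - ?A z) = R ** ?A z"
  proof (rule quotient_single_pole[OF eA eB _ _ filterlim_dirichlet_radius])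
    show "simple_pole_bound ?A s" if "s \<in> singular_points ?A" for s
      using that unfolding singular_points_phi[OF V] by (intro phi_simple_pole_bound V) auto
    show "phi W s 1 *v v = 0" if s: "s \<in> singular_points ?A" "s \<noteq> a" and v: "phi V s 1 *v v = 0" for s v
    proof -
      obtain \<beta> where \<beta>: "\<beta> \<ge> 1" "s = of_real (eigval V \<beta>)"
        using s(1) unfolding singular_points_phi[OF V] range_eigval(1)[OF V, symmetric] by auto
      then have "\<beta> \<noteq> \<alpha>" using s(2) a_def by auto
      then have "E_space W \<beta> = E_space V \<beta>" by (rule E[OF \<beta>(1)])
      moreover have "v \<in> E_space V \<beta>" using v \<beta>(2) by (simp add: E_space_def)
      ultimately have "v \<in> E_space W \<beta>" by simp
      then show ?thesis using \<beta>(2) by (simp add: E_space_def ev[OF \<beta>(1)])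
    qed
    show "z \<notin> singular_points ?A" if n: "n \<ge> max n0 n0'" and z: "norm z = (dirichlet_radius n)\<^sup>2" for n z
    proof
      assume "z \<in> singular_points ?A"
      then obtain v where v: "v \<noteq> 0" "phi V z 1 *v v = 0" by (auto simp: singular_points_def)
      have "norm (sin (csqrt z) / csqrt z) * norm v \<le> 0"
        using V1(3)[of n "csqrt z" v] n csq[OF z] v(2) by simp
      then have "norm (sin (csqrt z) / csqrt z) \<le> 0"
        using v(1) by (simp add: mult_le_0_iff)
      then have "norm (sin (csqrt z) / csqrt z) = 0"
        by (rule order_antisym) (rule norm_ge_zero)
      moreover have "0 < 8 * dirichlet_radius n * norm (sin (csqrt z) / csqrt z)"
        using V1(4)[of n "csqrt z"] n csq[OF z] exp_gt_zero[of "\<bar>Im (csqrt z)\<bar>"]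
        by (meson less_le_trans max.boundedE)
      ultimately show False by (simp only: mult_zero_right)
    qed
    show "norm ((?B z - ?A z) *v v) \<le> (2 * (C + C')) / dirichlet_radius n * norm (?A z *v v)"
      if n: "n \<ge> max n0 n0'" and z: "norm z = (dirichlet_radius n)\<^sup>2" for n z v
    proof -
      define w where "w = csqrt z"
      have w: "norm w = dirichlet_radius n" and w2: "w\<^sup>2 = z" using csq[OF z] by (simp_all add: w_def)
      have "?B z - ?A z = (?B z - mat (sin w / w)) - (?A z - mat (sin w / w))" by simp
      then have "norm (?B z - ?A z) \<le> norm (?B z - mat (sin w / w)) + norm (?A z - mat (sin w / w))"
        by (metis norm_triangle_ineq4)
      also have "\<dots> \<le> C' / dirichlet_radius n * norm (sin w / w) + C / dirichlet_radius n * norm (sin w / w)"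
        using V1(2)[OF _ w] W1(2)[OF _ w] n by (intro add_mono) (auto simp: w2)
      also have "\<dots> = (C + C') / dirichlet_radius n * norm (sin w / w)"
        by (simp add: add_divide_distrib distrib_right)
      finally have BA: "norm (?B z - ?A z) \<le> (C + C') / dirichlet_radius n * norm (sin w / w)" .
      have "norm ((?B z - ?A z) *v v) \<le> ((C + C') / dirichlet_radius n * norm (sin w / w)) * norm v"
        by (rule order_trans[OF norm_matrix_vector_mult_le mult_right_mono[OF BA]]) simp
      also have "\<dots> = (C + C') / dirichlet_radius n * (norm (sin w / w) * norm v)" by simp
      also have "\<dots> \<le> (C + C') / dirichlet_radius n * (2 * norm (?A z *v v))"
        using V1(3)[OF _ w, of v] n V1(1) W1(1) dirichlet_radius_pos[of n]
        by (intro mult_left_mono) (auto simp: w2)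
      finally show ?thesis by (simp add: algebra_simps)
    qed
  qed (rule that)
  show ?thesis
    unfolding F_space_eq[OF V] F_space_eq[OF W] a_def[symmetric] aW[symmetric]
    using range_inclusion_of_single_pole_quotient[OF eA eB R phi_simple_pole_bound[OF V a] phi_simple_pole_bound[OF W a]]
    by blast
qed

lemma E_space_Int_F_space:
  assumes V: "hermitian_potential V"
  shows "E_space V \<alpha> \<inter> F_space V \<alpha> = {0}"
proof -
  let ?a = "complex_of_real (eigval V \<alpha>)"
  have "u = 0" if u: "u \<in> E_space V \<alpha>" "u \<in> F_space V \<alpha>" for u
  proof (rule phi_deriv_injective_on_kernel[OF V, of ?a])
    show k: "phi V ?a 1 *v u = 0" using u(1) by (simp add: E_space_def)
    show "cinner (matrix_deriv (\<lambda>z. phi V z 1) ?a *v u) (phi_deriv V ?a 1 *v u) = 0"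
      using u(2) k phi_range_eq[OF V, of ?a] unfolding F_space_eq[OF V] by auto
  qed simp
  moreover have "0 \<in> E_space V \<alpha> \<inter> F_space V \<alpha>"
    by (simp add: E_space_def F_space_def orth_compl_def cinner.zero_left)
  ultimately show ?thesis by blast
qed

theorem proposition1p4:
  fixes V W :: "real \<Rightarrow> complex^'n^'n" and \<alpha> :: nat
  assumes "hermitian_potential V"
    and "W \<in> Iso V"
    and "\<alpha> \<ge> 1"
    and "\<And>\<beta>. \<beta> \<ge> 1 \<Longrightarrow> \<beta> \<noteq> \<alpha> \<Longrightarrow> E_space W \<beta> = E_space V \<beta>"
  shows "F_space W \<alpha> = F_space V \<alpha> \<and> E_space W \<alpha> \<inter> F_space V \<alpha> = {0}"
proof -
  have W: "hermitian_potential W" and ev: "\<And>\<beta>. \<beta> \<ge> 1 \<Longrightarrow> eigval W \<beta> = eigval V \<beta>"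
    using assms(2) by (auto simp: Iso_def)
  have "F_space W \<alpha> = F_space V \<alpha>"
    by (intro equalityI isospectral_F_space_subset assms W) (simp_all add: ev assms(4))
  then show ?thesis
    using E_space_Int_F_space[OF W, of \<alpha>] by simp
qed

end
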